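(* Let $\mathcal{A}$ be a compact set of real $d\times d$ matrices and let $\boldsymbol{m}:\mathcal{A}\to(0,+\infty)$, $A\mapsto m(A)$, be a dwell time function. The linear switching system $\xi=\{\mathcal{A},\boldsymbol{m}\}$ (dwell time restrictions only, no upper restrictions on the lengths of switching intervals) is stable if and only if every matrix $A\in\mathcal{A}$ is Hurwitz and the system $\xi_{cut}=\{\mathcal{A},\boldsymbol{m},\boldsymbol{m}+\mathcal{T}_{cut}\}$, in which the length of every switching interval of each regime $A\in\mathcal{A}$ is restricted to the segment $[m(A),\,m(A)+T_{cut}(A)]$, is stable.
   Context: Switching systems. A linear switching system has the form $\dot{\boldsymbol{x}}(t)=A(t)\boldsymbol{x}(t)$, $t\ge 0$, $\boldsymbol{x}(0)=\boldsymbol{x}_0\in\mathbb{R}^d$, where the switching law $A(\cdot):[0,+\infty)\to\mathcal{A}$ is a piecewise-constant function with values in the compact set $\mathcal{A}$ of real $d\times d$ matrices. Each matrix of $\mathcal{A}$ is called a regime. Switching points are the points of discontinuity of $A(\cdot)$, and the interval between two consecutive switching points is a switching interval (of the regime $A$, if $A(\cdot)$ equals $A$ on it). Given $m(A)>0$ and $M(A)\in[m(A),+\infty]$ for each $A\in\mathcal{A}$, the system $\{\mathcal{A},\boldsymbol{m},\mathcal{M}\}$ admits exactly those switching laws for which, for every regime $A\in\mathcal{A}$, the lengths of all switching intervals of $A$ lie in $[m(A),M(A)]$. The notation $\{\mathcal{A},\boldsymbol{m}\}$ means $M(A)=+\infty$ for all $A$. A system is (asymptotically) stable if for every admissible switching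 law and every $\boldsymbol{x}_0\in\mathbb{R}^d$ we have $\boldsymbol{x}(t)\to 0$ as $t\to+\infty$. A matrix is Hurwitz if all its eigenvalues have negative real parts. Definition of $T_{cut}(A)$. Let $A$ be a real Hurwitz $d\times d$ matrix. For $\boldsymbol{x}_0\in\mathbb{R}^d$ let $\boldsymbol{x}(t)=e^{tA}\boldsymbol{x}_0$, $\Gamma=\{\boldsymbol{x}(t): t\ge 0\}$ and $G=\mathrm{co}\,(\Gamma\cup(-\Gamma))$ (convex hull). A number $T>0$ is a cut tail point of the trajectory if for every $t\ge T$ the point $\boldsymbol{x}(t)$ belongs to the relative interior of $G$ (the interior in its affine span). $T_{cut}(\boldsymbol{x}_0)$ is the infimum of all cut tail points of the trajectory starting at $\boldsymbol{x}_0$. Let $L_{\boldsymbol{x}_0}$ be the smallest $A$-invariant subspace containing $\boldsymbol{x}_0$, and let $n$ be the degree of the minimal polynomial of $A$; the point $\boldsymbol{x}_0$ is generic if $\dim L_{\boldsymbol{x}_0}=n$. The value $T_{cut}(\boldsymbol{x}_0)$ is the same for all generic $\boldsymbol{x}_0$ and is denoted $T_{cut}(A)$. $\mathcal{T}_{cut}$ denotes the map $A\mapsto T_{cut}(A)$. *)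

theory Defs
  imports "HOL-Analysis.Analysis" "HOL-Computational_Algebra.Polynomial"
begin

section \<open>Matrices\<close>

primrec mat_pow :: "real^'n^'n \<Rightarrow> nat \<Rightarrow> real^'n^'n" where
  "mat_pow A 0 = mat 1"
| "mat_pow A (Suc k) = A ** mat_pow A k"

definition mat_exp :: "real^'n^'n \<Rightarrow> real^'n^'n" where
  "mat_exp A = (\<Sum>k. mat_pow A k /\<^sub>R fact k)"

definition mat_poly :: "real poly \<Rightarrow> real^'n^'n \<Rightarrow> real^'n^'n" where
  "mat_poly p A = (\<Sum>i\<le>degree p. coeff p i *\<^sub>R mat_pow A i)"

definition minimal_poly :: "real^'n^'n \<Rightarrow> real poly" where
  "minimal_poly A = (THE p. lead_coeff p = 1 \<and> mat_poly p A = 0 \<and>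
     (\<forall>q. q \<noteq> 0 \<and> mat_poly q A = 0 \<longrightarrow> degree p \<le> degree q))"

text \<open>Eigenvalues of a real matrix are taken over the complex numbers.\<close>

definition eigenvalue :: "real^'n^'n \<Rightarrow> complex \<Rightarrow> bool" where
  "eigenvalue A z \<longleftrightarrow> (\<exists>v. v \<noteq> 0 \<and> map_matrix complex_of_real A *v v = z *s v)"

definition Hurwitz :: "real^'n^'n \<Rightarrow> bool" where
  "Hurwitz A \<longleftrightarrow> (\<forall>z. eigenvalue A z \<longrightarrow> Re z < 0)"


section \<open>Cut tail points\<close>

definition trajectory :: "real^'n^'n \<Rightarrow> real^'n \<Rightarrow> real \<Rightarrow> real^'n" where
  "trajectory A x0 t = mat_exp (t *\<^sub>R A) *v x0"

definition sym_hull :: "real^'n^'n \<Rightarrow> real^'n \<Rightarrow> (real^'n) set" where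
  "sym_hull A x0 = (let \<Gamma> = trajectory A x0 ` {0..} in convex hull (\<Gamma> \<union> uminus ` \<Gamma>))"

definition cut_tail_point :: "real^'n^'n \<Rightarrow> real^'n \<Rightarrow> real \<Rightarrow> bool" where
  "cut_tail_point A x0 T \<longleftrightarrow>
     T > 0 \<and> (\<forall>t\<ge>T. trajectory A x0 t \<in> rel_interior (sym_hull A x0))"

definition T_cut_at :: "real^'n^'n \<Rightarrow> real^'n \<Rightarrow> real" where
  "T_cut_at A x0 = Inf {T. cut_tail_point A x0 T}"

definition invariant_subspace :: "real^'n^'n \<Rightarrow> (real^'n) set \<Rightarrow> bool" where
  "invariant_subspace A S \<longleftrightarrow> subspace S \<and> (\<forall>v\<in>S. A *v v \<in> S)"

definition generic :: "real^'n^'n \<Rightarrow> real^'n \<Rightarrow> bool" where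
  "generic A x0 \<longleftrightarrow> dim (invariant_subspace A hull {x0}) = degree (minimal_poly A)"

text \<open>Meaningful for Hurwitz \<open>A\<close> only; there the value at generic points exists and is unique.\<close>

definition T_cut :: "real^'n^'n \<Rightarrow> real" where
  "T_cut A = (THE T. \<forall>x0. generic A x0 \<longrightarrow> T_cut_at A x0 = T)"


section \<open>Linear switching systems\<close>

text \<open>
  A switching law is a function on the reals of which only the values on \<open>{0..}\<close> matter.
  Piecewise constant means that the breakpoints are locally finite and that the function is
  constant on each half-open piece between two of them. The pieces are closed on the left: the
  value at a single instant does not influence the trajectories, and this normalisation
  excludes laws that differ from their one-sided limits at an isolated instant (which would
  split a switching interval without changing the dynamics).
\<close>

definition piecewise_constant :: "(real \<Rightarrow> 'a) \<Rightarrow> bool" where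
  "piecewise_constant L \<longleftrightarrow>
     (\<exists>P. (\<forall>T. finite (P \<inter> {0..T})) \<and>
          (\<forall>s t. 0 \<le> s \<and> s \<le> t \<and> P \<inter> {s<..t} = {} \<longrightarrow> L s = L t))"

definition switching_points :: "(real \<Rightarrow> 'a::topological_space) \<Rightarrow> real set" where
  "switching_points L = {t. 0 \<le> t \<and> \<not> continuous (at t within {0..}) L}"

text \<open>
  The initial piece (before the first switching point) and the final unbounded piece, if any,
  are not intervals between two consecutive switching points.
\<close>

definition switching_interval :: "(real \<Rightarrow> 'a::topological_space) \<Rightarrow> 'a \<Rightarrow> real \<Rightarrow> real \<Rightarrow> bool" where
  "switching_interval L A s t \<longleftrightarrow>
     s < t \<and> s \<in> switching_points L \<and> t \<in> switching_points L \<and>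
     {s<..<t} \<inter> switching_points L = {} \<and> (\<forall>u\<in>{s<..<t}. L u = A)"

definition admissible ::
  "(real^'n^'n) set \<Rightarrow> (real^'n^'n \<Rightarrow> real) \<Rightarrow> (real^'n^'n \<Rightarrow> ereal) \<Rightarrow> (real \<Rightarrow> real^'n^'n) \<Rightarrow> bool" where
  "admissible \<A> m M L \<longleftrightarrow>
     L ` {0..} \<subseteq> \<A> \<and> piecewise_constant L \<and>
     (\<forall>A\<in>\<A>. \<forall>s t. switching_interval L A s t \<longrightarrow> ereal (t - s) \<in> {ereal (m A)..M A})"

definition solution :: "(real \<Rightarrow> real^'n^'n) \<Rightarrow> real^'n \<Rightarrow> (real \<Rightarrow> real^'n) \<Rightarrow> bool" where
  "solution L x0 x \<longleftrightarrow>
     x 0 = x0 \<and> continuous_on {0..} x \<and>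
     (\<forall>t\<ge>0. t \<notin> switching_points L \<longrightarrow>
        (x has_vector_derivative L t *v x t) (at t within {0..}))"

definition stable ::
  "(real^'n^'n) set \<Rightarrow> (real^'n^'n \<Rightarrow> real) \<Rightarrow> (real^'n^'n \<Rightarrow> ereal) \<Rightarrow> bool" where
  "stable \<A> m M \<longleftrightarrow>
     (\<forall>L x0 x. admissible \<A> m M L \<and> solution L x0 x \<longrightarrow> (x \<longlongrightarrow> 0) at_top)"

end

theory Submission
  imports Defs
    "HOL-Computational_Algebra.Field_as_Ring"
    "HOL-Computational_Algebra.Polynomial_Factorial"
    "HOL-Computational_Algebra.Fundamental_Theorem_Algebra"
begin

text \<open>
  Genericity of \<open>x\<close> means that \<open>M \<mapsto> M x\<close> is injective on the algebra generated by \<open>A\<close>, so cut tail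
  points can be read off from the symmetric hull of \<open>{e\<^sup>t\<^sup>A | t \<ge> 0}\<close> in matrix space. By Krein--Milman,
  every \<open>e\<^sup>u\<^sup>A\<close> is a signed convex combination of the \<open>e\<^sup>s\<^sup>A\<close> with \<open>0 \<le> s \<le> T_cut A\<close>. Hence any seminorm
  that does not increase along intervals of length in \<open>[m(A), m(A) + T_cut A]\<close> does not increase along
  longer ones.

  Stability of the cut system is first upgraded to a uniform exponential bound, which provides for
  each regime \<open>A\<close> a norm: the weighted supremum over all continuations that do not start with \<open>A\<close>.
  As \<open>m\<close> need not be bounded away from 0, monotonicity of these norms is not enough: the combination
  might use only tiny lengths \<open>m(A) + s\<close>. But then the vector would nearly be an eigenvector of
  \<open>e\<^sup>u\<^sup>A\<close> with an eigenvalue of modulus 1, which the Hurwitz property excludes. So the norms decay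
  exponentially in the true elapsed time.
\<close>

section \<open>The matrix exponential\<close>

text \<open>Stability of the cut system is given law by law, and the letters (regime, length) do not
  form a compact set, as no continuity of \<open>m\<close> is assumed. A uniform rate therefore
  cannot come from compactness of the laws; infinite laws are built greedily, and for words
  compactness is used only in the vector space. The second obstacle is that consecutive intervals
  must have different regimes, so words are not closed under concatenation. This is why words carry
  the preceding label, why a family of norms indexed by that label replaces a single Lyapunov norm,
  and why boundedness is first shown for words that can be chained. Lengths enter through
  \<open>min l 1\<close>, as no bound on \<open>m\<close> or \<open>T_cut\<close> over \<A> is
  assumed: the truncated cost controls the growth of each letter uniformly and lets words be cut
  into pieces of bounded cost. A rate in true time is recovered at the end from the uniform decay of
  \<open>e\<^sup>t\<^sup>A\<close> over the compact set, which takes over on long intervals. It also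
  handles the initial and the final piece of a law, whose lengths are unrestricted.\<close>

lemma bounded_bilinear_matrix_mult:
  "bounded_bilinear ((**) :: real^'n^'m \<Rightarrow> real^'p^'n \<Rightarrow> real^'p^'m)"
  by (auto simp: bilinear_conv_bounded_bilinear[symmetric] bilinear_def linear_iff vec_eq_iff
      matrix_matrix_mult_def sum.distrib algebra_simps sum_distrib_left)

lemma bounded_bilinear_matrix_vector_mult:
  "bounded_bilinear ((*v) :: real^'n^'m \<Rightarrow> real^'n \<Rightarrow> real^'m)"
  by (auto simp: bilinear_conv_bounded_bilinear[symmetric] bilinear_def linear_iff vec_eq_iff
      matrix_vector_mult_def sum.distrib algebra_simps sum_distrib_left)

lemma bounded_linear_apply_matrix:
  "bounded_linear (\<lambda>M :: real^'n^'m. M *v x)"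
  using bounded_bilinear_matrix_vector_mult bounded_bilinear.bounded_linear_left by blast

lemma linear_apply_matrix: "linear (\<lambda>M :: real^'n^'m. M *v x)"
  using bounded_linear_apply_matrix bounded_linear.linear by blast

lemma mat_pow_scaleR: "mat_pow (t *\<^sub>R A) k = t ^ k *\<^sub>R mat_pow A k"
  by (induction k) (simp_all add: scalar_matrix_assoc[symmetric] matrix_scalar_ac)

lemma mat_pow_commute: "A ** mat_pow A k = mat_pow A k ** A"
  by (induction k) (simp_all add: matrix_mul_assoc)

text \<open>The norm is that of nested vectors, not an operator norm: bilinear boundedness of the
  product supplies \<open>c\<close>, and \<open>norm (mat 1)\<close> need not be 1. The geometric
  bound makes the exponential series summable.\<close>

lemma norm_mat_pow_bound:
  obtains c where "c > 0" "\<And>(A::real^'n^'n) k. norm (mat_pow A k) \<le> norm (mat 1 :: real^'n^'n) * (c * norm A) ^ k"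
proof -
  obtain c where c: "c > 0" "\<And>(A::real^'n^'n) (B::real^'n^'n). norm (A ** B) \<le> norm A * norm B * c"
    using bounded_bilinear.pos_bounded[OF bounded_bilinear_matrix_mult] by blast
  have "norm (mat_pow A k) \<le> norm (mat 1 :: real^'n^'n) * (c * norm A) ^ k" for A :: "real^'n^'n" and k
  proof (induction k)
    case (Suc k)
    have "norm (mat_pow A (Suc k)) \<le> norm A * norm (mat_pow A k) * c"
      using c(2)[of A "mat_pow A k"] by simp
    also have "\<dots> \<le> norm A * (norm (mat 1 :: real^'n^'n) * (c * norm A) ^ k) * c"
      by (intro mult_right_mono mult_left_mono Suc.IH) (use c in auto)
    finally show ?case by (simp add: algebra_simps)
  qed simp
  then show ?thesis using that c by blast
qed

lemma sums_mat_exp: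
  fixes A :: "real^'n^'n"
  shows "(\<lambda>k. mat_pow A k /\<^sub>R fact k) sums mat_exp A"
proof -
  obtain c where c: "\<And>(A::real^'n^'n) k. norm (mat_pow A k) \<le> norm (mat 1 :: real^'n^'n) * (c * norm A) ^ k"
    using norm_mat_pow_bound by blast
  have "summable (\<lambda>k. norm (mat 1 :: real^'n^'n) * ((c * norm A) ^ k /\<^sub>R fact k))"
    by (intro summable_mult summable_exp_generic)
  then have "summable (\<lambda>k. mat_pow A k /\<^sub>R fact k)"
  proof (rule summable_comparison_test'[where N = 0])
    show "norm (mat_pow A k /\<^sub>R fact k) \<le> norm (mat 1 :: real^'n^'n) * ((c * norm A) ^ k /\<^sub>R fact k)" for k
      using c[of A k] by (simp add: field_simps)
  qed
  then show ?thesis by (simp add: mat_exp_def summable_sums)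
qed

lemma sums_mat_exp_scaleR:
  "(\<lambda>k. t ^ k *\<^sub>R (mat_pow A k /\<^sub>R fact k)) sums mat_exp (t *\<^sub>R A)"
  using sums_mat_exp[of "t *\<^sub>R A"] by (simp add: mat_pow_scaleR mult.commute)

lemma mat_exp_0 [simp]: "mat_exp (0::real^'n^'n) = mat 1"
proof -
  have "(\<lambda>k. 0 ^ k *\<^sub>R (mat_pow (0::real^'n^'n) k /\<^sub>R fact k)) sums mat_exp (0::real^'n^'n)"
    using sums_mat_exp_scaleR[of 0 "0::real^'n^'n"] by simp
  moreover have "(\<lambda>k. (0::real) ^ k *\<^sub>R (mat_pow (0::real^'n^'n) k /\<^sub>R fact k)) = (\<lambda>k. if k = 0 then mat 1 else 0)"
    by (auto simp: fun_eq_iff)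
  ultimately have "(\<lambda>k. if k = 0 then mat 1 else 0 :: real^'n^'n) sums mat_exp 0" by simp
  from sums_unique2[OF this sums_single[of 0 "\<lambda>_. mat 1 :: real^'n^'n"]] show ?thesis .
qed

lemma mat_exp_commute: "A ** mat_exp (t *\<^sub>R A) = mat_exp (t *\<^sub>R A) ** A"
proof -
  have "(\<lambda>k. A ** (t ^ k *\<^sub>R (mat_pow A k /\<^sub>R fact k))) sums (A ** mat_exp (t *\<^sub>R A))"
    by (rule bounded_linear.sums[OF bounded_bilinear.bounded_linear_right[OF bounded_bilinear_matrix_mult] sums_mat_exp_scaleR])
  moreover have "(\<lambda>k. (t ^ k *\<^sub>R (mat_pow A k /\<^sub>R fact k)) ** A) sums (mat_exp (t *\<^sub>R A) ** A)"
    by (rule bounded_linear.sums[OF bounded_bilinear.bounded_linear_left[OF bounded_bilinear_matrix_mult] sums_mat_exp_scaleR])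
  moreover have "A ** (t ^ k *\<^sub>R (mat_pow A k /\<^sub>R fact k)) = (t ^ k *\<^sub>R (mat_pow A k /\<^sub>R fact k)) ** A" for k
    by (simp add: matrix_scalar_ac scalar_matrix_assoc[symmetric] mat_pow_commute)
  ultimately show ?thesis by (simp add: sums_iff)
qed

text \<open>Each entry is a scalar power series in \<open>t\<close>, which may be differentiated
  termwise; the coefficient shift done by \<open>diffs\<close> is multiplication by
  \<open>A\<close>.\<close>

lemma mat_exp_has_vector_derivative:
  "((\<lambda>t. mat_exp (t *\<^sub>R A)) has_vector_derivative A ** mat_exp (t *\<^sub>R A)) (at t within S)"
proof -
  define C where "C k = mat_pow A k /\<^sub>R fact k" for k
  have ent: "(\<lambda>k. C k $ i $ j * s ^ k) sums (mat_exp (s *\<^sub>R A) $ i $ j)" for i j s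
  proof -
    have "(\<lambda>k. (s ^ k *\<^sub>R C k) $ i $ j) sums (mat_exp (s *\<^sub>R A) $ i $ j)"
      unfolding C_def
      by (intro bounded_linear.sums[OF bounded_linear_vec_nth] sums_mat_exp_scaleR)
    then show ?thesis by (simp add: mult.commute)
  qed
  have "((\<lambda>t. mat_exp (t *\<^sub>R A) $ i $ j) has_field_derivative (A ** mat_exp (t *\<^sub>R A)) $ i $ j) (at t)" for i j
  proof -
    have "((\<lambda>x. \<Sum>k. C k $ i $ j * x ^ k) has_field_derivative (\<Sum>k. diffs (\<lambda>k. C k $ i $ j) k * t ^ k)) (at t)"
      by (rule termdiffs_strong_converges_everywhere) (rule sums_summable[OF ent])
    moreover have "(\<lambda>x. \<Sum>k. C k $ i $ j * x ^ k) = (\<lambda>t. mat_exp (t *\<^sub>R A) $ i $ j)"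
      by (rule ext) (rule sums_unique[OF ent, symmetric])
    moreover have "(\<Sum>k. diffs (\<lambda>k. C k $ i $ j) k * t ^ k) = (A ** mat_exp (t *\<^sub>R A)) $ i $ j"
    proof -
      have "(\<lambda>k. (A ** (t ^ k *\<^sub>R C k)) $ i $ j) sums ((A ** mat_exp (t *\<^sub>R A)) $ i $ j)"
        unfolding C_def
        by (intro bounded_linear.sums[OF bounded_linear_vec_nth] sums_mat_exp_scaleR
            bounded_linear.sums[OF bounded_bilinear.bounded_linear_right[OF bounded_bilinear_matrix_mult]])
      moreover have "(A ** (t ^ k *\<^sub>R C k)) $ i $ j = diffs (\<lambda>k. C k $ i $ j) k * t ^ k" for k
        by (simp add: C_def diffs_def matrix_scalar_ac scalar_matrix_assoc[symmetric] field_simps del: of_nat_Suc)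
      ultimately show ?thesis by (simp add: sums_iff)
    qed
    ultimately show ?thesis by simp
  qed
  then have "((\<lambda>t. mat_exp (t *\<^sub>R A)) has_derivative (\<lambda>h. h *\<^sub>R (A ** mat_exp (t *\<^sub>R A)))) (at t)"
    by (subst has_derivative_componentwise_within)
      (auto simp: Basis_vec_def inner_axis has_field_derivative_def mult_commute_abs)
  then show ?thesis
    unfolding has_vector_derivative_def by (rule has_derivative_at_withinI)
qed

lemma mat_exp_apply_has_vector_derivative:
  "((\<lambda>t. mat_exp (t *\<^sub>R A) *v x) has_vector_derivative A *v (mat_exp (t *\<^sub>R A) *v x)) (at t within S)"
  using bounded_linear.has_vector_derivative[OF bounded_linear_apply_matrix mat_exp_has_vector_derivative[of A t S], of x]
  by (simp add: matrix_vector_mul_assoc)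

lemma mat_exp_minus_has_vector_derivative:
  "((\<lambda>t. mat_exp ((c - t) *\<^sub>R A)) has_vector_derivative - (A ** mat_exp ((c - t) *\<^sub>R A))) (at t within S)"
proof -
  have "((\<lambda>t. c - t) has_vector_derivative -1) (at t within S)"
    by (auto intro!: derivative_eq_intros)
  from vector_diff_chain_within[OF this mat_exp_has_vector_derivative[of A "c - t"]]
  show ?thesis by (simp add: o_def scaleR_minus_left)
qed

lemma continuous_on_mat_exp: "continuous_on S (\<lambda>t. mat_exp (t *\<^sub>R A))"
  by (rule continuous_on_vector_derivative, rule mat_exp_has_vector_derivative)

text \<open>For a solution \<open>y\<close> on \<open>[a, b]\<close> the curve
  \<open>e^((a-t)A) y(t)\<close> has derivative zero, hence is constant. With
  \<open>y(t) = e^(tA) x\<close> this makes \<open>e^(-tA)\<close> a left inverse of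
  \<open>e^(tA)\<close>, hence an inverse, and inverting gives uniqueness.\<close>

lemma mat_exp_minus_mult_apply: "mat_exp (t *\<^sub>R A) *v (mat_exp ((- t) *\<^sub>R A) *v x) = x"
  and mat_exp_ode_unique:
    "\<lbrakk>a \<le> b; continuous_on {a..b} y; \<And>t. a < t \<Longrightarrow> t < b \<Longrightarrow> (y has_vector_derivative A *v y t) (at t)\<rbrakk>
      \<Longrightarrow> y b = mat_exp ((b - a) *\<^sub>R A) *v y a"
proof -
  have const: "mat_exp ((a - b) *\<^sub>R A) *v y b = y a"
    if "a \<le> b" and "continuous_on {a..b} y"
      and y': "\<And>t. a < t \<Longrightarrow> t < b \<Longrightarrow> (y has_vector_derivative A *v y t) (at t)" for a b y
  proof (cases "a = b")
    case False
    define g where "g t = mat_exp ((a - t) *\<^sub>R A) *v y t" for t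
    have "continuous_on {a..b} (\<lambda>t. mat_exp ((a - t) *\<^sub>R A))"
      by (rule continuous_on_vector_derivative, rule mat_exp_minus_has_vector_derivative)
    then have "continuous_on {a..b} g" unfolding g_def
      by (rule bounded_bilinear.continuous_on[OF bounded_bilinear_matrix_vector_mult _ that(2)])
    moreover have "(g has_derivative (\<lambda>h. 0)) (at t within {a..b})" if "a < t" "t < b" for t
    proof -
      have "(g has_vector_derivative 0) (at t)"
        using bounded_bilinear.has_vector_derivative[OF bounded_bilinear_matrix_vector_mult
            mat_exp_minus_has_vector_derivative[of a A t UNIV] y'[OF that]]
        unfolding g_def
        by (simp add: matrix_vector_mul_assoc mat_exp_commute bounded_bilinear.minus_left[OF bounded_bilinear_matrix_vector_mult])
      then show ?thesis by (auto simp: has_vector_derivative_def intro: has_derivative_at_withinI)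
    qed
    ultimately have "g b = g a"
      using has_derivative_zero_unique_strong_interval[of "{a,b}" a b g "g a" b] \<open>a \<le> b\<close> by auto
    then show ?thesis by (simp add: g_def)
  qed simp
  have one: "mat_exp ((- t) *\<^sub>R A) *v (mat_exp (t *\<^sub>R A) *v x) = x" if "t \<ge> 0" for t x
    using const[OF that continuous_on_vector_derivative[OF mat_exp_apply_has_vector_derivative[of A x]]
        mat_exp_apply_has_vector_derivative[of A x]] by simp
  have inv: "mat_exp ((- t) *\<^sub>R A) ** mat_exp (t *\<^sub>R A) = mat 1" if "t \<ge> 0" for t
    unfolding matrix_eq using one[OF that] by (simp only: matrix_vector_mul_assoc[symmetric] matrix_vector_mul_lid) simp
  have inv': "mat_exp (t *\<^sub>R A) ** mat_exp ((- t) *\<^sub>R A) = mat 1" for t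
  proof (cases "t \<ge> 0")
    case True then show ?thesis using inv matrix_left_right_inverse by blast
  next
    case False
    then have "mat_exp ((- (- t)) *\<^sub>R A) ** mat_exp ((- t) *\<^sub>R A) = mat 1"
      by (intro inv) simp
    then show ?thesis by (simp only: minus_minus)
  qed
  show two: "mat_exp (t *\<^sub>R A) *v (mat_exp ((- t) *\<^sub>R A) *v x) = x" for t x
    by (simp only: matrix_vector_mul_assoc inv' matrix_vector_mul_lid)
  show "y b = mat_exp ((b - a) *\<^sub>R A) *v y a" if "a \<le> b" "continuous_on {a..b} y"
    "\<And>t. a < t \<Longrightarrow> t < b \<Longrightarrow> (y has_vector_derivative A *v y t) (at t)" for a b y
    using two[of "b - a" "y b"] const[OF that] by simp
qed

text \<open>Both sides solve the same equation in \<open>s\<close> and agree at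
  \<open>s = 0\<close>. Uniqueness is stated forward in time, hence \<open>s \<ge> 0\<close>, while
  \<open>t\<close> is arbitrary.\<close>

lemma mat_exp_add_apply:
  "mat_exp ((s + t) *\<^sub>R A) *v x = mat_exp (s *\<^sub>R A) *v (mat_exp (t *\<^sub>R A) *v x)" if "s \<ge> 0" 
proof -
  define y where "y r = mat_exp ((r + t) *\<^sub>R A) *v x" for r
  have "((\<lambda>r. r + t) has_vector_derivative 1) (at r)" for r
    by (auto intro!: derivative_eq_intros)
  from vector_diff_chain_within[OF this mat_exp_apply_has_vector_derivative[of A x]]
  have d: "(y has_vector_derivative A *v y r) (at r)" for r
    by (simp add: y_def[abs_def] o_def)
  have "y s = mat_exp ((s - 0) *\<^sub>R A) *v y 0"
    using that d by (intro mat_exp_ode_unique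
        continuous_on_vector_derivative[OF has_vector_derivative_at_within]) auto
  then show ?thesis by (simp add: y_def)
qed

lemma norm_mat_pow_apply_le:
  assumes "\<And>x. norm (A *v x) \<le> R * norm x" "R \<ge> 0"
  shows "norm (mat_pow A k *v x) \<le> R ^ k * norm x"
proof (induction k)
  case (Suc k)
  have "norm (mat_pow A (Suc k) *v x) \<le> R * norm (mat_pow A k *v x)"
    using assms(1)[of "mat_pow A k *v x"] by (simp add: matrix_vector_mul_assoc)
  also have "\<dots> \<le> R * (R ^ k * norm x)"
    by (intro mult_left_mono Suc.IH assms)
  finally show ?case by simp
qed simp

text \<open>The exponential series of the number \<open>R * t\<close> majorises the matrix series
  term by term. For the second bound the constant term is dropped on both sides, which gives an
  estimate of order \<open>t\<close> for small \<open>t\<close>.\<close>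

lemma
  assumes A: "\<And>x. norm (A *v x) \<le> R * norm x" and "R \<ge> 0" "t \<ge> 0"
  shows norm_mat_exp_apply_le: "norm (mat_exp (t *\<^sub>R A) *v x) \<le> exp (R * t) * norm x"
    and norm_mat_exp_apply_diff_le: "norm (mat_exp (t *\<^sub>R A) *v x - x) \<le> (exp (R * t) - 1) * norm x"
proof -
  define f where "f k = (t ^ k *\<^sub>R (mat_pow A k /\<^sub>R fact k)) *v x" for k
  define g where "g k = ((R * t) ^ k /\<^sub>R fact k) * norm x" for k
  have f: "f sums (mat_exp (t *\<^sub>R A) *v x)"
    unfolding f_def by (intro bounded_linear.sums[OF bounded_linear_apply_matrix] sums_mat_exp_scaleR)
  have g: "g sums (exp (R * t) * norm x)"
    unfolding g_def by (intro sums_mult2 exp_converges)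
  have fg: "norm (f k) \<le> g k" for k
  proof -
    have "norm (f k) = t ^ k / fact k * norm (mat_pow A k *v x)"
      using \<open>t \<ge> 0\<close> by (simp add: f_def scaleR_matrix_vector_assoc[symmetric] divide_inverse mult.commute)
    also have "\<dots> \<le> t ^ k / fact k * (R ^ k * norm x)"
      using \<open>t \<ge> 0\<close> by (intro mult_left_mono norm_mat_pow_apply_le assms) auto
    finally show ?thesis by (simp add: g_def field_simps power_mult_distrib)
  qed
  show "norm (mat_exp (t *\<^sub>R A) *v x) \<le> exp (R * t) * norm x"
    by (rule norm_sums_le[OF f g fg])
  have "(\<lambda>k. f k - (if k = 0 then x else 0)) sums (mat_exp (t *\<^sub>R A) *v x - x)"
    by (intro sums_diff f sums_single)
  moreover have "(\<lambda>k. g k - (if k = 0 then norm x else 0)) sums (exp (R * t) * norm x - norm x)"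
    by (intro sums_diff g sums_single)
  moreover have "norm (f k - (if k = 0 then x else 0)) \<le> g k - (if k = 0 then norm x else 0)" for k
    using fg[of k] by (cases "k = 0") (auto simp: f_def g_def)
  ultimately have "norm (mat_exp (t *\<^sub>R A) *v x - x) \<le> exp (R * t) * norm x - norm x"
    by (rule norm_sums_le)
  then show "norm (mat_exp (t *\<^sub>R A) *v x - x) \<le> (exp (R * t) - 1) * norm x"
    by (simp add: algebra_simps)
qed

lemma continuous_on_mat_pow: "continuous_on S (\<lambda>A. mat_pow A k)"
  by (induction k) (auto intro!: continuous_intros bounded_bilinear.continuous_on[OF bounded_bilinear_matrix_mult])

text \<open>The partial sums converge uniformly on balls. Continuity in the matrix is what carries
  decay at one regime over to nearby ones.\<close>

lemma isCont_mat_exp: "isCont mat_exp (A :: real^'n^'n)"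
proof -
  obtain c where c: "c > 0" "\<And>(A::real^'n^'n) k. norm (mat_pow A k) \<le> norm (mat 1 :: real^'n^'n) * (c * norm A) ^ k"
    using norm_mat_pow_bound by blast
  define r where "r = norm A + 1"
  have "uniform_limit (ball 0 r) (\<lambda>n (B :: real^'n^'n). \<Sum>k<n. mat_pow B k /\<^sub>R fact k)
      (\<lambda>B :: real^'n^'n. \<Sum>k. mat_pow B k /\<^sub>R fact k) sequentially"
  proof (rule Weierstrass_m_test)
    show "norm (mat_pow B k /\<^sub>R fact k) \<le> norm (mat 1 :: real^'n^'n) * ((c * r) ^ k /\<^sub>R fact k)"
      if "B \<in> ball 0 r" for B :: "real^'n^'n" and k
    proof -
      have "norm (mat_pow B k) \<le> norm (mat 1 :: real^'n^'n) * (c * norm B) ^ k" by (rule c(2))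
      also have "\<dots> \<le> norm (mat 1 :: real^'n^'n) * (c * r) ^ k"
        using that c(1) by (intro mult_left_mono power_mono) auto
      finally show ?thesis by (simp add: field_simps)
    qed
    show "summable (\<lambda>k. norm (mat 1 :: real^'n^'n) * ((c * r) ^ k /\<^sub>R fact k))"
      by (intro summable_mult summable_exp_generic)
  qed
  then have "continuous_on (ball 0 r) (\<lambda>B :: real^'n^'n. \<Sum>k. mat_pow B k /\<^sub>R fact k)"
    by (intro uniform_limit_theorem[rotated]) (auto intro!: always_eventually continuous_intros continuous_on_mat_pow)
  then have "continuous_on (ball 0 r) (mat_exp :: real^'n^'n \<Rightarrow> _)"
    by (simp add: mat_exp_def[abs_def])
  moreover have "A \<in> ball 0 r" by (simp add: r_def)
  ultimately show ?thesis using continuous_on_eq_continuous_at open_ball by blast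
qed

section \<open>The minimal polynomial and generic points\<close>

lemma mat_poly_0 [simp]: "mat_poly 0 A = 0"
  by (simp add: mat_poly_def)

lemma mat_poly_eq_sum:
  assumes "degree p \<le> n"
  shows "mat_poly p A = (\<Sum>i\<le>n. coeff p i *\<^sub>R mat_pow A i)"
  unfolding mat_poly_def
  by (rule sum.mono_neutral_left) (use assms in \<open>auto simp: coeff_eq_0\<close>)

lemma mat_poly_pCons: "mat_poly (pCons a p) A = a *\<^sub>R mat 1 + A ** mat_poly p A"
proof -
  have "mat_poly (pCons a p) A = (\<Sum>i\<le>Suc (degree p). coeff (pCons a p) i *\<^sub>R mat_pow A i)"
    by (rule mat_poly_eq_sum) (simp add: degree_pCons_le)
  also have "\<dots> = a *\<^sub>R mat 1 + (\<Sum>i\<le>degree p. coeff p i *\<^sub>R (A ** mat_pow A i))"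
    by (subst sum.atMost_Suc_shift) simp
  also have "(\<Sum>i\<le>degree p. coeff p i *\<^sub>R (A ** mat_pow A i)) = A ** mat_poly p A"
    by (simp add: mat_poly_def bounded_bilinear.sum_right[OF bounded_bilinear_matrix_mult]
        bounded_bilinear.scaleR_right[OF bounded_bilinear_matrix_mult])
  finally show ?thesis .
qed

lemma mat_poly_add: "mat_poly (p + q) A = mat_poly p A + mat_poly q A"
  by (induction p q rule: poly_induct2) (simp_all add: mat_poly_pCons matrix_add_ldistrib scaleR_add_left)

lemma mat_poly_smult: "mat_poly (smult c p) A = c *\<^sub>R mat_poly p A"
  by (induction p) (simp_all add: mat_poly_pCons scaleR_add_right
      bounded_bilinear.scaleR_right[OF bounded_bilinear_matrix_mult])

lemma mat_poly_diff: "mat_poly (p - q) A = mat_poly p A - mat_poly q A"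
  using mat_poly_add[of "p - q" q A] by simp

lemma mat_poly_mult: "mat_poly (p * q) A = mat_poly p A ** mat_poly q A"
proof (induction p)
  case (pCons a p)
  have "mat_poly (pCons a p * q) A = mat_poly (smult a q + pCons 0 (p * q)) A" by simp
  also have "\<dots> = a *\<^sub>R mat_poly q A + A ** (mat_poly p A ** mat_poly q A)"
    using pCons by (simp only: mat_poly_add mat_poly_smult mat_poly_pCons) simp
  also have "\<dots> = mat_poly (pCons a p) A ** mat_poly q A"
    by (simp add: mat_poly_pCons matrix_mul_assoc bounded_bilinear.add_left[OF bounded_bilinear_matrix_mult]
        bounded_bilinear.scaleR_left[OF bounded_bilinear_matrix_mult])
  finally show ?case .
qed (simp add: bounded_bilinear.zero_left[OF bounded_bilinear_matrix_mult])

lemma mat_poly_monom: "mat_poly (monom 1 k) A = mat_pow A k"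
  by (induction k) (simp_all add: monom_Suc mat_poly_pCons monom_0)

lemma mat_poly_in_span_lessThan:
  assumes "\<And>i. i \<ge> k \<Longrightarrow> coeff p i = 0"
  shows "mat_poly p A \<in> span (mat_pow A ` {..<k})"
  unfolding mat_poly_def
proof (rule span_sum)
  fix i assume "i \<in> {..degree p}"
  show "coeff p i *\<^sub>R mat_pow A i \<in> span (mat_pow A ` {..<k})"
    using assms[of i] by (cases "i < k") (auto intro: span_scale span_base simp: span_zero)
qed

lemma span_lessThan_mat_poly:
  assumes "M \<in> span (mat_pow A ` {..<k})"
  obtains p where "M = mat_poly p A" "\<And>i. i \<ge> k \<Longrightarrow> coeff p i = 0"
proof -
  define T where "T = {mat_poly p A |p. \<forall>i\<ge>k. coeff p i = 0}"
  have "span (mat_pow A ` {..<k}) \<subseteq> T"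
  proof (rule span_minimal)
    show "mat_pow A ` {..<k} \<subseteq> T"
    proof safe
      fix i assume "i < k"
      then show "mat_pow A i \<in> T"
        unfolding T_def by (auto intro!: exI[of _ "monom 1 i"] simp: mat_poly_monom)
    qed
    show "subspace T"
      unfolding subspace_def
    proof safe
      show "0 \<in> T" unfolding T_def by (auto intro!: exI[of _ 0])
      fix x y assume "x \<in> T" "y \<in> T"
      then obtain p q where "x = mat_poly p A" "y = mat_poly q A"
        "\<forall>i\<ge>k. coeff p i = 0" "\<forall>i\<ge>k. coeff q i = 0" by (auto simp: T_def)
      then show "x + y \<in> T"
        unfolding T_def by (auto intro!: exI[of _ "p + q"] simp: mat_poly_add)
    next
      fix c x assume "x \<in> T"
      then obtain p where "x = mat_poly p A" "\<forall>i\<ge>k. coeff p i = 0" by (auto simp: T_def)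
      then show "c *\<^sub>R x \<in> T"
        unfolding T_def by (auto intro!: exI[of _ "smult c p"] simp: mat_poly_smult)
    qed
  qed
  then show ?thesis using assms that by (auto simp: T_def)
qed

section \<open>The minimal polynomial from linear dependence of the powers\<close>

lemma ex_mat_pow_dependent:
  "\<exists>k. mat_pow (A :: real^'n^'n) k \<in> span (mat_pow A ` {..<k})"
proof (rule ccontr)
  assume neg: "\<nexists>k. mat_pow A k \<in> span (mat_pow A ` {..<k})"
  have "independent (mat_pow A ` {..<k}) \<and> card (mat_pow A ` {..<k}) = k" for k
  proof (induction k)
    case (Suc k)
    have "mat_pow A k \<notin> mat_pow A ` {..<k}"
      using neg span_base[of "mat_pow A k" "mat_pow A ` {..<k}"] by auto
    then show ?case
      using Suc neg by (simp add: lessThan_Suc independent_insert)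
  qed (simp add: independent_empty)
  from this[of "Suc (DIM(real^'n^'n))"] independent_bound[of "mat_pow A ` {..<Suc (DIM(real^'n^'n))}"]
  show False by simp
qed

text \<open>The degree of the minimal polynomial, described by linear dependence alone so that it is
  available before that polynomial is known to exist.\<close>

definition pow_dim :: "real^'n^'n \<Rightarrow> nat" where
  "pow_dim A = (LEAST k. mat_pow A k \<in> span (mat_pow A ` {..<k}))"

lemma pow_dim_in_span: "mat_pow A (pow_dim A) \<in> span (mat_pow A ` {..<pow_dim A})"
  unfolding pow_dim_def by (rule LeastI_ex[OF ex_mat_pow_dependent])

lemma pow_dim_independent:
  "k \<le> pow_dim A \<Longrightarrow> independent (mat_pow A ` {..<k}) \<and> card (mat_pow A ` {..<k}) = k"
proof (induction k)
  case (Suc k)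
  have *: "mat_pow A k \<notin> span (mat_pow A ` {..<k})"
    using Suc.prems not_less_Least[of k "\<lambda>k. mat_pow A k \<in> span (mat_pow A ` {..<k})"]
    by (simp add: pow_dim_def)
  then have "mat_pow A k \<notin> mat_pow A ` {..<k}"
    using span_base[of "mat_pow A k" "mat_pow A ` {..<k}"] by auto
  then show ?case
    using Suc * by (simp add: lessThan_Suc independent_insert)
qed (simp add: independent_empty)

lemma pow_dim_le_degree:
  assumes "q \<noteq> 0" "mat_poly q A = 0"
  shows "pow_dim A \<le> degree q"
proof -
  define r where "r = q - monom (lead_coeff q) (degree q)"
  have r: "coeff r i = 0" if "i \<ge> degree q" for i
    using that by (auto simp: r_def coeff_eq_0)
  have "mat_poly r A = - lead_coeff q *\<^sub>R mat_pow A (degree q)"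
    using assms(2) mat_poly_smult[of "lead_coeff q" "monom 1 (degree q)" A]
    by (simp add: r_def mat_poly_diff smult_monom mat_poly_monom)
  then have "mat_pow A (degree q) = (- 1 / lead_coeff q) *\<^sub>R mat_poly r A"
    using assms(1) by simp
  then have "mat_pow A (degree q) \<in> span (mat_pow A ` {..<degree q})"
    using mat_poly_in_span_lessThan[OF r] by (metis span_scale)
  then show ?thesis unfolding pow_dim_def by (rule Least_le)
qed

text \<open>The first linear dependence among the powers, made monic, is a witness. Two candidates
  have equal degree and leading coefficient, so their difference annihilates \<open>A\<close> with
  smaller degree and must vanish; this makes the \<open>THE\<close> well defined.\<close>

lemma minimal_poly:
  shows lead_coeff_minimal_poly: "lead_coeff (minimal_poly A) = 1"
    and mat_poly_minimal_poly: "mat_poly (minimal_poly A) A = 0"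
    and degree_minimal_poly: "degree (minimal_poly A) = pow_dim A"
proof -
  define P where "P p \<longleftrightarrow> lead_coeff p = 1 \<and> mat_poly p A = 0 \<and>
     (\<forall>q. q \<noteq> 0 \<and> mat_poly q A = 0 \<longrightarrow> degree p \<le> degree q)" for p
  obtain q where q: "mat_pow A (pow_dim A) = mat_poly q A" "\<And>i. i \<ge> pow_dim A \<Longrightarrow> coeff q i = 0"
    using span_lessThan_mat_poly[OF pow_dim_in_span] by blast
  define p where "p = monom 1 (pow_dim A) - q"
  have c: "coeff p i = (if i = pow_dim A then 1 else 0)" if "i \<ge> pow_dim A" for i
    using that q(2)[of i] by (auto simp: p_def)
  then have deg: "degree p = pow_dim A"
    by (intro antisym degree_le le_degree) auto
  have "P p"
    unfolding P_def using c[of "pow_dim A"] pow_dim_le_degree[of _ A] deg q(1)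
    by (simp add: p_def mat_poly_diff mat_poly_monom)
  moreover have "p' = p" if "P p'" for p'
  proof (rule ccontr)
    assume "p' \<noteq> p"
    have "degree p' = degree p" "p \<noteq> 0" "p' \<noteq> 0"
      using that \<open>P p\<close> unfolding P_def by (metis antisym leading_coeff_0_iff zero_neq_one)+
    have "degree (p' - p) < degree p"
    proof (rule degree_less_if_less_eqI)
      show "degree (p' - p) \<le> degree p"
        using \<open>degree p' = degree p\<close> by (metis degree_diff_le order_refl)
      show "coeff (p' - p) (degree p) = 0"
        using that \<open>P p\<close> \<open>degree p' = degree p\<close> by (auto simp: P_def)
      show "p' - p \<noteq> 0" using \<open>p' \<noteq> p\<close> by simp
    qed
    moreover have "mat_poly (p' - p) A = 0" using that \<open>P p\<close> by (simp add: P_def mat_poly_diff)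
    ultimately show False using \<open>P p\<close> \<open>p' \<noteq> p\<close> unfolding P_def by (meson eq_iff_diff_eq_0 not_less)
  qed
  ultimately have "minimal_poly A = p"
    unfolding minimal_poly_def P_def by (rule the_equality)
  then show "lead_coeff (minimal_poly A) = 1" "mat_poly (minimal_poly A) A = 0"
    "degree (minimal_poly A) = pow_dim A"
    using \<open>P p\<close> deg by (auto simp: P_def)
qed

lemma mat_poly_in_span: "mat_poly p A \<in> span (mat_pow A ` {..<pow_dim A})"
proof -
  let ?m = "minimal_poly A"
  have "?m \<noteq> 0" using lead_coeff_minimal_poly[of A] by auto
  have "mat_poly p A = mat_poly (p div ?m * ?m + p mod ?m) A" by simp
  also have "\<dots> = mat_poly (p mod ?m) A"
    by (simp only: mat_poly_add mat_poly_mult mat_poly_minimal_poly)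
      (simp add: bounded_bilinear.zero_right[OF bounded_bilinear_matrix_mult])
  also have "\<dots> \<in> span (mat_pow A ` {..<pow_dim A})"
  proof (rule mat_poly_in_span_lessThan)
    fix i assume "i \<ge> pow_dim A"
    then show "coeff (p mod ?m) i = 0"
      using degree_mod_less[OF \<open>?m \<noteq> 0\<close>, of p] degree_minimal_poly[of A] by (auto intro: coeff_eq_0)
  qed
  finally show ?thesis .
qed

lemma span_range_mat_pow: "span (range (mat_pow A)) = span (mat_pow A ` {..<pow_dim A})"
proof (rule antisym)
  have "mat_pow A i \<in> span (mat_pow A ` {..<pow_dim A})" for i
    using mat_poly_in_span[of "monom 1 i" A] by (simp add: mat_poly_monom)
  then show "span (range (mat_pow A)) \<subseteq> span (mat_pow A ` {..<pow_dim A})"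
    by (intro span_minimal) auto
qed (intro span_mono image_mono, simp)

lemma dim_span_mat_pow: "dim (span (range (mat_pow A))) = degree (minimal_poly A)"
  unfolding span_range_mat_pow degree_minimal_poly
  using pow_dim_independent[of "pow_dim A" A] by (simp add: dim_span_eq_card_independent dim_eq_card_independent)

section \<open>Generic points and evaluation of the algebra generated by a matrix\<close>

lemma invariant_subspace_hull_singleton:
  fixes A :: "real^'n^'n"
  shows "invariant_subspace A hull {x} = (\<lambda>M. M *v x) ` span (range (mat_pow A))"
proof (rule antisym)
  have L: "linear (\<lambda>M :: real^'n^'n. M *v x)" by (rule linear_apply_matrix)
  have closed: "A ** M \<in> span (range (mat_pow A))" if "M \<in> span (range (mat_pow A))" for M
    using that
  proof (induction rule: span_induct_alt)
    case base
    show ?case by (simp add: span_zero bounded_bilinear.zero_right[OF bounded_bilinear_matrix_mult])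
  next
    case (step c M N)
    then obtain i where "M = mat_pow A i" by auto
    then have "A ** (c *\<^sub>R M + N) = c *\<^sub>R mat_pow A (Suc i) + A ** N"
      by (simp add: matrix_add_ldistrib bounded_bilinear.scaleR_right[OF bounded_bilinear_matrix_mult])
    also have "\<dots> \<in> span (range (mat_pow A))"
      by (intro span_add span_scale step.IH span_base rangeI)
    finally show ?case .
  qed
  show "invariant_subspace A hull {x} \<subseteq> (\<lambda>M. M *v x) ` span (range (mat_pow A))"
  proof (rule hull_minimal)
    have "mat_pow A 0 \<in> span (range (mat_pow A))" by (rule span_base) blast
    then show "{x} \<subseteq> (\<lambda>M. M *v x) ` span (range (mat_pow A))" by force
    show "invariant_subspace A ((\<lambda>M. M *v x) ` span (range (mat_pow A)))"
      unfolding invariant_subspace_def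
    proof (intro conjI ballI)
      show "subspace ((\<lambda>M. M *v x) ` span (range (mat_pow A)))"
        using L by (rule linear_subspace_image) simp
      fix v assume "v \<in> (\<lambda>M. M *v x) ` span (range (mat_pow A))"
      then show "A *v v \<in> (\<lambda>M. M *v x) ` span (range (mat_pow A))"
        using closed by (auto simp: matrix_vector_mul_assoc)
    qed
  qed
  show "(\<lambda>M. M *v x) ` span (range (mat_pow A)) \<subseteq> invariant_subspace A hull {x}"
  proof (unfold hull_def, intro Inter_greatest)
    fix T assume "T \<in> {t. invariant_subspace A t \<and> {x} \<subseteq> t}"
    then have T: "subspace T" "\<And>v. v \<in> T \<Longrightarrow> A *v v \<in> T" "x \<in> T"
      by (auto simp: invariant_subspace_def)
    have "mat_pow A i *v x \<in> T" for i
      by (induction i) (use T in \<open>auto simp: matrix_vector_mul_assoc[symmetric]\<close>)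
    then have "span ((\<lambda>M. M *v x) ` range (mat_pow A)) \<subseteq> T"
      by (intro span_minimal T) auto
    then show "(\<lambda>M. M *v x) ` span (range (mat_pow A)) \<subseteq> T"
      by (simp add: linear_span_image[OF L])
  qed
qed

text \<open>The invariant subspace is the image of the algebra generated by \<open>A\<close> under
  evaluation at \<open>x\<close>, and the dimension of that algebra is the degree of the minimal
  polynomial. Genericity thus says that evaluation loses no dimension.\<close>

lemma generic_iff_inj_on:
  fixes A :: "real^'n^'n"
  shows "generic A x \<longleftrightarrow> inj_on (\<lambda>M. M *v x) (span (range (mat_pow A)))"
proof -
  have L: "linear (\<lambda>M :: real^'n^'n. M *v x)" by (rule linear_apply_matrix)
  define B where "B = mat_pow A ` {..<pow_dim A}"
  have B: "independent B" "card B = pow_dim A" "finite B"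
    using pow_dim_independent[of "pow_dim A" A] by (auto simp: B_def)
  have "inj_on (\<lambda>M. M *v x) (span (range (mat_pow A)))" if "generic A x"
  proof -
    from that have d: "dim (span ((\<lambda>M. M *v x) ` B)) = card B"
      using B(2) by (simp add: generic_def invariant_subspace_hull_singleton span_range_mat_pow
          degree_minimal_poly linear_span_image[OF L] B_def)
    have "card ((\<lambda>M. M *v x) ` B) \<ge> card B"
      using d dim_le_card[of "span ((\<lambda>M. M *v x) ` B)" "(\<lambda>M. M *v x) ` B"] B(3) by simp
    then have c: "card ((\<lambda>M. M *v x) ` B) = card B"
      using B(3) card_image_le by (metis le_antisym)
    then have "inj_on (\<lambda>M. M *v x) B" using B(3) eq_card_imp_inj_on by blast
    moreover have "independent ((\<lambda>M. M *v x) ` B)"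
      by (rule card_le_dim_spanning[of _ "span ((\<lambda>M. M *v x) ` B)"])
        (use d c B(3) in \<open>auto intro: span_base\<close>)
    ultimately have "inj_on (\<lambda>M. M *v x) (span B)"
      using linear_inj_on_span_independent_image[OF L] by blast
    then show ?thesis
      by (simp only: span_range_mat_pow B_def)
  qed
  moreover have "generic A x" if "inj_on (\<lambda>M. M *v x) (span (range (mat_pow A)))"
  proof -
    from that have "dim ((\<lambda>M. M *v x) ` span (range (mat_pow A))) = dim (span (range (mat_pow A)))"
      by (intro dim_image_eq L) (simp only: span_span)
    then show ?thesis
      by (simp only: generic_def invariant_subspace_hull_singleton dim_span_mat_pow)
  qed
  ultimately show ?thesis by (rule iffI)
qed

text \<open>A point is generic as soon as it is not annihilated by any maximal proper divisor of the
  minimal polynomial; each of these finitely many conditions excludes a null set only.\<close>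

lemma ex_generic: "\<exists>x. generic (A :: real^'n^'n) x"
proof -
  let ?m = "minimal_poly A"
  have m0: "?m \<noteq> 0" using lead_coeff_minimal_poly[of A] by auto
  define Z where "Z \<pi> = {x. mat_poly (?m div \<pi>) A *v x = 0}" for \<pi>
  have "negligible (Z \<pi>)" if "\<pi> \<in> prime_factors ?m" for \<pi>
  proof (rule negligible_lowdim)
    have \<pi>: "prime \<pi>" "\<pi> dvd ?m" using that by (auto simp: prime_factors_dvd)
    then have e: "?m = ?m div \<pi> * \<pi>" by simp
    have "\<pi> \<noteq> 0" "degree \<pi> > 0"
      using \<pi>(1) by (auto simp: prime_elem_def is_unit_iff_degree dest!: prime_imp_prime_elem)
    have "?m div \<pi> \<noteq> 0" using e m0 by force
    have "degree ?m = degree (?m div \<pi>) + degree \<pi>"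
      using e \<open>?m div \<pi> \<noteq> 0\<close> \<open>\<pi> \<noteq> 0\<close> by (metis degree_mult_eq)
    then have "mat_poly (?m div \<pi>) A \<noteq> 0"
      using pow_dim_le_degree[OF \<open>?m div \<pi> \<noteq> 0\<close>, of A] \<open>degree \<pi> > 0\<close> by (auto simp: degree_minimal_poly)
    then obtain y where "mat_poly (?m div \<pi>) A *v y \<noteq> 0"
      unfolding matrix_eq[of "mat_poly (?m div \<pi>) A"] by auto
    then have "Z \<pi> \<noteq> UNIV" by (auto simp: Z_def)
    moreover have "subspace (Z \<pi>)"
      unfolding Z_def by (intro linear_subspace_kernel matrix_vector_mul_linear)
    ultimately show "dim (Z \<pi>) < DIM(real^'n)"
      using dim_eq_full[of "Z \<pi>"] dim_subset_UNIV[of "Z \<pi>"] span_eq_iff[of "Z \<pi>"] by (metis nless_le)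
  qed
  then have "negligible (\<Union>(Z ` prime_factors ?m))" by (intro negligible_Union) auto
  then obtain x where x: "\<And>\<pi>. \<pi> \<in> prime_factors ?m \<Longrightarrow> mat_poly (?m div \<pi>) A *v x \<noteq> 0"
  proof -
    have "\<Union>(Z ` prime_factors ?m) \<noteq> UNIV"
      using \<open>negligible (\<Union>(Z ` prime_factors ?m))\<close> non_negligible_UNIV[where 'a = "real^'n"] by metis
    then show ?thesis using that by (auto simp: Z_def)
  qed
  \<comment> \<open>Killing the single vector \<open>x\<close> forces killing everything:
    \<open>g\<close>, the gcd of \<open>q\<close> and the minimal polynomial, kills \<open>x\<close>
    by Bezout. If the cofactor \<open>h\<close> had a prime factor, \<open>g\<close> would divide
    one of the maximal proper divisors, which do not kill \<open>x\<close>.\<close>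
  have ann: "mat_poly q A = 0" if q: "mat_poly q A *v x = 0" for q
  proof -
    define g where "g = gcd q ?m"
    obtain a b where ab: "g = a * q + b * ?m"
      unfolding g_def using bezout_coefficients_fst_snd[of q ?m] by metis
    have g: "mat_poly g A *v x = 0"
      by (simp add: ab mat_poly_add mat_poly_mult mat_poly_minimal_poly q matrix_vector_mul_assoc[symmetric]
          matrix_vector_mult_add_rdistrib bounded_bilinear.zero_right[OF bounded_bilinear_matrix_mult])
    obtain h where h: "?m = g * h" unfolding g_def by (meson dvdE gcd_dvd2)
    have "is_unit h"
    proof (rule ccontr)
      assume "\<not> is_unit h"
      moreover have "h \<noteq> 0" using h m0 by auto
      ultimately obtain \<pi> where \<pi>: "prime \<pi>" "\<pi> dvd h" using prime_divisor_exists by blast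
      then obtain k where k: "h = \<pi> * k" by blast
      have "\<pi> \<noteq> 0" using \<pi> by auto
      have "?m div \<pi> = k * g" using h k \<open>\<pi> \<noteq> 0\<close> by (simp add: mult.left_commute mult.commute)
      then have "mat_poly (?m div \<pi>) A *v x = 0"
        by (simp add: mat_poly_mult g matrix_vector_mul_assoc[symmetric])
      moreover have "\<pi> \<in> prime_factors ?m" using \<pi> h m0 by (simp add: prime_factors_dvd)
      ultimately show False using x by blast
    qed
    then have "?m dvd g" using h by (metis dvd_refl mult_unit_dvd_iff)
    then have "?m dvd q" unfolding g_def by (meson dvd_trans gcd_dvd1)
    then show ?thesis by (auto elim!: dvdE simp: mat_poly_mult mat_poly_minimal_poly
          bounded_bilinear.zero_left[OF bounded_bilinear_matrix_mult])
  qed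
  have "inj_on (\<lambda>M. M *v x) (span (range (mat_pow A)))"
  proof (rule inj_onI)
    fix M N assume "M \<in> span (range (mat_pow A))" "N \<in> span (range (mat_pow A))" and eq: "M *v x = N *v x"
    then obtain p q where "M = mat_poly p A" "N = mat_poly q A"
      unfolding span_range_mat_pow by (meson span_lessThan_mat_poly)
    moreover from this have "mat_poly (p - q) A *v x = 0"
      using eq by (simp add: mat_poly_diff matrix_vector_mult_diff_rdistrib)
    ultimately show "M = N" using ann[of "p - q"] by (simp add: mat_poly_diff)
  qed
  then show ?thesis by (auto simp: generic_iff_inj_on)
qed

section \<open>Cut tail points\<close>

definition mat_hull :: "real^'n^'n \<Rightarrow> (real^'n^'n) set" where
  "mat_hull A = convex hull ((\<lambda>t. mat_exp (t *\<^sub>R A)) ` {0..} \<union> uminus ` (\<lambda>t. mat_exp (t *\<^sub>R A)) ` {0..})"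

lemma convex_mat_hull: "convex (mat_hull A)"
  by (simp add: mat_hull_def)

lemma mat_exp_in_mat_hull: "t \<ge> 0 \<Longrightarrow> mat_exp (t *\<^sub>R A) \<in> mat_hull A"
  unfolding mat_hull_def by (rule hull_inc) auto

lemma uminus_image_mat_hull: "uminus ` mat_hull A = mat_hull A"
proof -
  have "uminus ` mat_hull A = convex hull (uminus ` ((\<lambda>t. mat_exp (t *\<^sub>R A)) ` {0..} \<union> uminus ` (\<lambda>t. mat_exp (t *\<^sub>R A)) ` {0..}))"
    unfolding mat_hull_def by (rule convex_hull_linear_image[OF module_hom_uminus])
  then show ?thesis
    by (simp add: mat_hull_def image_Un image_image Un_commute)
qed

lemma zero_in_mat_hull: "0 \<in> mat_hull A"
proof -
  have "mat 1 \<in> mat_hull A" "- mat 1 \<in> mat_hull A"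
    using mat_exp_in_mat_hull[of 0 A] uminus_image_mat_hull[of A] by auto
  from convexD[OF convex_mat_hull this, of "1/2" "1/2"] show ?thesis by simp
qed

lemma sym_hull_eq_image: "sym_hull A x = (\<lambda>M. M *v x) ` mat_hull A"
proof -
  have "(\<lambda>M. M *v x) ` mat_hull A = convex hull ((\<lambda>M. M *v x) ` ((\<lambda>t. mat_exp (t *\<^sub>R A)) ` {0..} \<union> uminus ` (\<lambda>t. mat_exp (t *\<^sub>R A)) ` {0..}))"
    unfolding mat_hull_def by (rule convex_hull_linear_image[OF linear_apply_matrix])
  then show ?thesis
    by (simp add: sym_hull_def Let_def trajectory_def[abs_def] image_Un image_image
        bounded_bilinear.minus_left[OF bounded_bilinear_matrix_vector_mult])
qed

lemma mat_exp_in_span: "mat_exp (t *\<^sub>R A) \<in> span (range (mat_pow A))"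
proof (rule closed_sequentially[OF closed_span])
  show "(\<lambda>n. \<Sum>k<n. t ^ k *\<^sub>R (mat_pow A k /\<^sub>R fact k)) \<longlonglongrightarrow> mat_exp (t *\<^sub>R A)"
    using sums_mat_exp_scaleR unfolding sums_def .
  show "(\<Sum>k<n. t ^ k *\<^sub>R (mat_pow A k /\<^sub>R fact k)) \<in> span (range (mat_pow A))" for n
    by (intro span_sum span_scale span_base rangeI)
qed

lemma mat_hull_subset_span: "mat_hull A \<subseteq> span (range (mat_pow A))"
  unfolding mat_hull_def
  by (rule hull_minimal) (auto intro: mat_exp_in_span span_neg subspace_imp_convex)

text \<open>Taking the relative interior commutes with linear images of convex sets, and evaluation
  at a generic point is injective on the span containing the hull, so membership can be pulled back
  to matrices.\<close>

lemma rel_interior_sym_hull_iff: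
  assumes "generic A x" "t \<ge> 0"
  shows "trajectory A x t \<in> rel_interior (sym_hull A x) \<longleftrightarrow>
    mat_exp (t *\<^sub>R A) \<in> rel_interior (mat_hull A)"
proof -
  have "rel_interior (sym_hull A x) = (\<lambda>M. M *v x) ` rel_interior (mat_hull A)"
    unfolding sym_hull_eq_image
    by (rule rel_interior_convex_linear_image[OF linear_apply_matrix convex_mat_hull, symmetric])
  moreover have "rel_interior (mat_hull A) \<subseteq> span (range (mat_pow A))"
    using mat_hull_subset_span rel_interior_subset by blast
  ultimately show ?thesis
    using assms(1) mat_exp_in_span[of t A] unfolding generic_iff_inj_on trajectory_def
    by (metis inj_on_image_mem_iff)
qed

definition mat_cut_points :: "real^'n^'n \<Rightarrow> real set" where
  "mat_cut_points A = {T. T > 0 \<and> (\<forall>t\<ge>T. mat_exp (t *\<^sub>R A) \<in> rel_interior (mat_hull A))}"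

text \<open>The cut tail points of a generic \<open>x\<close> are described without reference to
  \<open>x\<close>. That a generic point exists is essential: otherwise the condition under
  \<open>THE\<close> would hold for every number.\<close>

lemma T_cut_eq: "T_cut A = Inf (mat_cut_points A)"
proof -
  have "T_cut_at A x = Inf (mat_cut_points A)" if "generic A x" for x
    unfolding T_cut_at_def mat_cut_points_def cut_tail_point_def
    using rel_interior_sym_hull_iff[OF that] by (intro arg_cong[where f = Inf] Collect_cong) force
  moreover obtain x where "generic A x" using ex_generic by blast
  ultimately show ?thesis unfolding T_cut_def by (intro the_equality) metis+
qed

lemma zero_in_rel_interior_mat_hull: "0 \<in> rel_interior (mat_hull A)"
proof -
  have "rel_interior (mat_hull A) \<noteq> {}"
    using zero_in_mat_hull convex_mat_hull rel_interior_eq_empty by blast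
  then obtain M where M: "M \<in> rel_interior (mat_hull A)" by blast
  have "uminus ` rel_interior (mat_hull A) = rel_interior (mat_hull A)"
    using rel_interior_convex_linear_image[OF module_hom_uminus convex_mat_hull, of A]
    by (simp add: uminus_image_mat_hull)
  then have "- M \<in> rel_interior (mat_hull A)" using M by blast
  from convexD[OF convex_rel_interior[OF convex_mat_hull] M this, of "1/2" "1/2"] show ?thesis by simp
qed

lemma mat_cut_points_nonempty:
  assumes "((\<lambda>t. mat_exp (t *\<^sub>R A)) \<longlongrightarrow> 0) at_top"
  shows "mat_cut_points A \<noteq> {}"
proof -
  obtain U where U: "open U" "rel_interior (mat_hull A) = U \<inter> affine hull (mat_hull A)"
    using openin_rel_interior[of "mat_hull A"] by (auto simp: openin_open)
  then have "0 \<in> U" using zero_in_rel_interior_mat_hull by auto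
  from topological_tendstoD[OF assms U(1) this]
  obtain T where T: "\<And>t. t \<ge> T \<Longrightarrow> mat_exp (t *\<^sub>R A) \<in> U"
    by (auto simp: eventually_at_top_linorder)
  have "max T 1 \<in> mat_cut_points A"
    unfolding mat_cut_points_def U(2) using T by (auto intro!: hull_inc mat_exp_in_mat_hull)
  then show ?thesis by blast
qed

lemma T_cut_nonneg:
  assumes "((\<lambda>t. mat_exp (t *\<^sub>R A)) \<longlongrightarrow> 0) at_top"
  shows "T_cut A \<ge> 0"
  unfolding T_cut_eq using mat_cut_points_nonempty[OF assms]
  by (rule cInf_greatest) (auto simp: mat_cut_points_def)

lemma compact_orbit:
  fixes A :: "real^'n^'n"
  assumes "((\<lambda>t. mat_exp (t *\<^sub>R A)) \<longlongrightarrow> 0) at_top"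
  shows "compact (insert 0 ((\<lambda>t. mat_exp (t *\<^sub>R A)) ` {0..}))"
proof (rule compactI)
  fix \<C> :: "(real^'n^'n) set set"
  assume \<C>: "\<forall>U\<in>\<C>. open U" "insert 0 ((\<lambda>t. mat_exp (t *\<^sub>R A)) ` {0..}) \<subseteq> \<Union>\<C>"
  then obtain U where U: "U \<in> \<C>" "0 \<in> U" by auto
  with \<C> topological_tendstoD[OF assms, of U]
  obtain T where T: "\<And>t. t \<ge> T \<Longrightarrow> mat_exp (t *\<^sub>R A) \<in> U"
    by (auto simp: eventually_at_top_linorder)
  have "compact ((\<lambda>t. mat_exp (t *\<^sub>R A)) ` {0..T})"
    by (intro compact_continuous_image continuous_on_mat_exp compact_Icc)
  moreover have "(\<lambda>t. mat_exp (t *\<^sub>R A)) ` {0..T} \<subseteq> \<Union>\<C>" using \<C>(2) by auto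
  ultimately obtain \<D> where \<D>: "\<D> \<subseteq> \<C>" "finite \<D>" "(\<lambda>t. mat_exp (t *\<^sub>R A)) ` {0..T} \<subseteq> \<Union>\<D>"
    using \<C>(1) by (elim compactE) auto
  have "insert 0 ((\<lambda>t. mat_exp (t *\<^sub>R A)) ` {0..}) \<subseteq> \<Union>(insert U \<D>)"
  proof safe
    fix t :: real assume "0 \<le> t"
    show "mat_exp (t *\<^sub>R A) \<in> \<Union>(insert U \<D>)"
    proof (cases "t \<le> T")
      case True
      then have "mat_exp (t *\<^sub>R A) \<in> (\<lambda>t. mat_exp (t *\<^sub>R A)) ` {0..T}" using \<open>0 \<le> t\<close> by auto
      then show ?thesis using \<D>(3) by auto
    qed (use T[of t] in auto)
  qed (use U in auto)
  then show "\<exists>\<C>'\<subseteq>\<C>. finite \<C>' \<and> insert 0 ((\<lambda>t. mat_exp (t *\<^sub>R A)) ` {0..}) \<subseteq> \<Union>\<C>'"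
    using U \<D> by (intro exI[of _ "insert U \<D>"]) auto
qed

lemma compact_mat_hull:
  assumes "((\<lambda>t. mat_exp (t *\<^sub>R A)) \<longlongrightarrow> 0) at_top"
  shows "compact (mat_hull A)"
proof -
  let ?G = "(\<lambda>t. mat_exp (t *\<^sub>R A)) ` {0..}"
  have "mat_hull A = convex hull (insert 0 ?G \<union> uminus ` insert 0 ?G)"
  proof (rule antisym)
    show "mat_hull A \<subseteq> convex hull (insert 0 ?G \<union> uminus ` insert 0 ?G)"
      unfolding mat_hull_def by (rule hull_mono) auto
    show "convex hull (insert 0 ?G \<union> uminus ` insert 0 ?G) \<subseteq> mat_hull A"
      using zero_in_mat_hull[of A] mat_exp_in_mat_hull[of _ A] uminus_image_mat_hull[of A] convex_mat_hull[of A]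
      by (intro hull_minimal) auto
  qed
  moreover have "compact (uminus ` insert 0 ?G)"
    by (intro compact_continuous_image compact_orbit[OF assms] continuous_intros)
  ultimately show ?thesis
    using compact_orbit[OF assms] by (metis compact_Un compact_convex_hull)
qed

text \<open>The compact hull is spanned by its extreme points, and past the cut tail point the
  trajectory stays in the relative interior, which contains no extreme point.\<close>

lemma mat_exp_in_hull_cut:
  fixes A :: "real^'n^'n"
  assumes tend: "((\<lambda>t. mat_exp (t *\<^sub>R A)) \<longlongrightarrow> 0) at_top" and "u \<ge> 0"
  shows "mat_exp (u *\<^sub>R A) \<in> convex hull ((\<lambda>t. mat_exp (t *\<^sub>R A)) ` {0..T_cut A} \<union> uminus ` (\<lambda>t. mat_exp (t *\<^sub>R A)) ` {0..T_cut A})"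
proof -
  let ?S = "(\<lambda>t. mat_exp (t *\<^sub>R A)) ` {0..T_cut A}"
  \<comment> \<open>\<open>T_cut A\<close> is an infimum that need not be attained, so only times
    beyond it are known to give points of the relative interior; the endpoint itself has to stay in
    \<open>?S\<close>.\<close>
  have ri: "mat_exp (t *\<^sub>R A) \<in> rel_interior (mat_hull A)" if t: "t > T_cut A" for t
  proof -
    obtain T where "T \<in> mat_cut_points A" "T < t"
      using cInf_lessD[OF mat_cut_points_nonempty[OF tend], of t] t unfolding T_cut_eq by auto
    then show ?thesis by (auto simp: mat_cut_points_def)
  qed
  have uri: "- M \<in> rel_interior (mat_hull A)" if "M \<in> rel_interior (mat_hull A)" for M
    using rel_interior_convex_linear_image[OF module_hom_uminus convex_mat_hull, of A] that
    by (auto simp: uminus_image_mat_hull)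
  \<comment> \<open>A one-point hull would be its own relative interior, and its point extreme; this
    is the only case in which an extreme point lies in the relative interior.\<close>
  have nsing: "mat_hull A \<noteq> {M}" for M
  proof
    assume "mat_hull A = {M}"
    moreover have "0 \<in> mat_hull A" "mat 1 \<in> mat_hull A"
      using zero_in_mat_hull mat_exp_in_mat_hull[of 0 A] by auto
    ultimately have "mat 1 = (0 :: real^'n^'n)" by simp
    then have "(mat 1 :: real^'n^'n) *v axis undefined 1 = 0" by simp
    then show False by (simp add: axis_eq_0_iff)
  qed
  have "M \<in> ?S \<union> uminus ` ?S" if M: "M extreme_point_of mat_hull A" for M
  proof -
    have nri: "M \<notin> rel_interior (mat_hull A)"
      by (rule extreme_point_not_in_REL_INTERIOR[OF M nsing])
    have "M \<in> (\<lambda>t. mat_exp (t *\<^sub>R A)) ` {0..} \<union> uminus ` (\<lambda>t. mat_exp (t *\<^sub>R A)) ` {0..}"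
      using M unfolding mat_hull_def by (rule extreme_point_of_convex_hull)
    then consider t where "t \<ge> 0" "M = mat_exp (t *\<^sub>R A)" | t where "t \<ge> 0" "M = - mat_exp (t *\<^sub>R A)"
      by auto
    then show ?thesis
    proof cases
      case 1
      then show ?thesis using ri[of t] nri by (cases "t \<le> T_cut A") auto
    next
      case 2
      then show ?thesis using uri[OF ri[of t]] nri by (cases "t \<le> T_cut A") auto
    qed
  qed
  then have "convex hull {M. M extreme_point_of mat_hull A} \<subseteq> convex hull (?S \<union> uminus ` ?S)"
    by (intro hull_mono) blast
  then show ?thesis
    using Krein_Milman_Minkowski[OF compact_mat_hull[OF tend] convex_mat_hull] mat_exp_in_mat_hull[OF \<open>u \<ge> 0\<close>, of A]
    by blast
qed

section \<open>Hurwitz matrices\<close>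

text \<open>\<open>\<bullet>\<close> on complex vectors is the real inner product, so an imaginary
  multiple of \<open>v\<close> is orthogonal to \<open>v\<close> and only \<open>Re c\<close> drives
  the growth of the norm.\<close>

lemma inner_vector_scalar_mult_self: "((c::complex) *s v) \<bullet> v = Re c * (v \<bullet> v)"
  by (simp add: inner_vec_def inner_complex_def sum_distrib_left algebra_simps)

text \<open>Energy estimate for \<open>\<phi>\<close>, the squared norm of \<open>f\<close>: half of
  the damping \<open>2 a \<phi>\<close> absorbs the mixed term after completing the square, leaving
  the forcing \<open>norm (g t) ^ 2 / a\<close>.\<close>

lemma ode_forced_decay:
  fixes f g :: "real \<Rightarrow> complex^'n"
  assumes f: "\<And>t. (f has_vector_derivative c *s f t + g t) (at t)"
    and "Re c < 0" and g: "(g \<longlongrightarrow> 0) at_top"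
  shows "(f \<longlongrightarrow> 0) at_top"
proof -
  define a where "a = - Re c"
  have "a > 0" using \<open>Re c < 0\<close> by (simp add: a_def)
  define \<phi> where "\<phi> t = f t \<bullet> f t" for t
  define \<phi>' where "\<phi>' t = 2 * (f t \<bullet> (c *s f t + g t))" for t
  have d: "(\<phi> has_real_derivative \<phi>' t) (at t)" for t
    unfolding \<phi>_def[abs_def] \<phi>'_def has_real_derivative_iff_has_vector_derivative
    using bounded_bilinear.has_vector_derivative[OF bounded_bilinear_inner f[of t] f[of t]]
    by (simp add: inner_commute)
  have bound: "\<phi>' t \<le> - a * \<phi> t + norm (g t) ^ 2 / a" for t
  proof -
    have "2 * (f t \<bullet> g t) \<le> 2 * (norm (f t) * norm (g t))"
      using norm_cauchy_schwarz[of "f t" "g t"] by simp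
    also have "\<dots> \<le> a * norm (f t) ^ 2 + norm (g t) ^ 2 / a"
    proof -
      have "0 \<le> (a * norm (f t) - norm (g t)) ^ 2 / a" using \<open>a > 0\<close> by simp
      also have "\<dots> = a * norm (f t) ^ 2 + norm (g t) ^ 2 / a - 2 * (norm (f t) * norm (g t))"
        using \<open>a > 0\<close> by (simp add: power2_diff power_mult_distrib diff_divide_distrib add_divide_distrib)
          (simp add: power2_eq_square)
      finally show ?thesis by simp
    qed
    finally show ?thesis
      using inner_vector_scalar_mult_self[of c "f t"]
      by (simp add: \<phi>'_def \<phi>_def a_def inner_right_distrib inner_commute power2_norm_eq_inner)
  qed
  have "(\<phi> \<longlongrightarrow> 0) at_top"
  proof (rule tendstoI)
    fix e :: real assume "e > 0"
    define \<epsilon> where "\<epsilon> = e / 2"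
    have "\<epsilon> > 0" using \<open>e > 0\<close> by (simp add: \<epsilon>_def)
    have "((\<lambda>t. norm (g t) ^ 2 / a) \<longlongrightarrow> norm (0 :: complex^'n) ^ 2 / a) at_top"
      using \<open>a > 0\<close> by (intro tendsto_intros g) auto
    then have "\<forall>\<^sub>F t in at_top. norm (g t) ^ 2 / a < a * \<epsilon>"
      using \<open>a > 0\<close> \<open>\<epsilon> > 0\<close> by (intro order_tendstoD(2)) auto
    then obtain T where T: "\<And>t. t \<ge> T \<Longrightarrow> norm (g t) ^ 2 / a < a * \<epsilon>"
      by (auto simp: eventually_at_top_linorder)
    \<comment> \<open>Once the forcing is below \<open>a * \<epsilon>\<close>, the excess of
      \<open>\<phi>\<close> over \<open>\<epsilon>\<close> obeys a decay inequality with rate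
      \<open>a\<close>; multiplied by \<open>exp (a * t)\<close> it cannot increase.\<close>
    define \<psi> where "\<psi> t = exp (a * t) * (\<phi> t - \<epsilon>)" for t
    have \<psi>: "\<psi> t \<le> \<psi> T" if "t \<ge> T" for t
    proof (rule DERIV_nonpos_imp_nonincreasing[OF that])
      fix s assume "T \<le> s" "s \<le> t"
      have "(\<psi> has_real_derivative exp (a * s) * (a * (\<phi> s - \<epsilon>) + \<phi>' s)) (at s)"
        unfolding \<psi>_def[abs_def] by (auto intro!: derivative_eq_intros d simp: algebra_simps)
      moreover have "exp (a * s) * (a * (\<phi> s - \<epsilon>) + \<phi>' s) \<le> 0"
        using bound[of s] T[OF \<open>T \<le> s\<close>] by (intro mult_nonneg_nonpos) (auto simp: algebra_simps)
      ultimately show "\<exists>y. (\<psi> has_real_derivative y) (at s) \<and> y \<le> 0" by blast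
    qed
    have "((\<lambda>t. exp (- a * t) * \<psi> T) \<longlongrightarrow> 0) at_top"
    proof (rule tendsto_mult_left_zero)
      have "filterlim (\<lambda>t. - a * t) at_bot at_top"
        using \<open>a > 0\<close> by (intro filterlim_tendsto_neg_mult_at_bot[OF tendsto_const] filterlim_ident) auto
      then show "((\<lambda>t. exp (- a * t)) \<longlongrightarrow> 0) at_top"
        by (rule filterlim_compose[OF exp_at_bot])
    qed
    then have "\<forall>\<^sub>F t in at_top. exp (- a * t) * \<psi> T < \<epsilon>"
      using \<open>\<epsilon> > 0\<close> by (rule order_tendstoD(2))
    moreover have "\<forall>\<^sub>F t in at_top. t \<ge> T" by (rule eventually_ge_at_top)
    ultimately show "\<forall>\<^sub>F t in at_top. dist (\<phi> t) 0 < e"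
    proof eventually_elim
      case (elim t)
      have "\<phi> t = \<epsilon> + exp (- a * t) * \<psi> t"
        by (simp add: \<psi>_def exp_minus field_simps)
      also have "\<dots> \<le> \<epsilon> + exp (- a * t) * \<psi> T"
        using \<psi>[OF elim(2)] by simp
      also have "\<dots> < e" using elim(1) by (simp add: \<epsilon>_def)
      finally show ?case by (simp add: \<phi>_def)
    qed
  qed
  then have "((\<lambda>t. sqrt (\<phi> t)) \<longlongrightarrow> sqrt 0) at_top" by (rule tendsto_real_sqrt)
  then show ?thesis
    by (simp add: \<phi>_def norm_eq_sqrt_inner[symmetric] tendsto_norm_zero_iff)
qed

text \<open>Horner evaluation of \<open>p(M) v\<close> over the complex numbers, where roots of
  \<open>p\<close> can be split off; \<open>mat_poly\<close> covers real matrices only.\<close>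

definition poly_apply :: "complex^'n^'n \<Rightarrow> complex poly \<Rightarrow> complex^'n \<Rightarrow> complex^'n" where
  "poly_apply M p = fold_coeffs (\<lambda>a g v. a *s v + M *v g v) p (\<lambda>v. 0)"

lemma poly_apply_0 [simp]: "poly_apply M 0 v = 0"
  by (simp add: poly_apply_def)

lemma poly_apply_pCons [simp]: "poly_apply M (pCons a p) v = a *s v + M *v poly_apply M p v"
  by (cases "p = 0 \<and> a = 0") (auto simp: poly_apply_def)

lemma poly_apply_add: "poly_apply M (p + q) v = poly_apply M p v + poly_apply M q v"
  by (induction p q rule: poly_induct2) (simp_all add: matrix_vector_right_distrib vector_sadd_rdistrib)

lemma poly_apply_smult: "poly_apply M (smult c p) v = c *s poly_apply M p v"
  by (induction p) (simp_all add: vector_add_ldistrib vector_smult_assoc vector_scalar_commute)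

lemma poly_apply_mult: "poly_apply M (p * q) v = poly_apply M p (poly_apply M q v)"
  by (induction p) (simp_all add: poly_apply_add poly_apply_smult)

lemma map_matrix_of_real_mult:
  "map_matrix complex_of_real A *v (\<chi> i. complex_of_real (x $ i)) = (\<chi> i. complex_of_real ((A *v x) $ i))"
  by (simp add: vec_eq_iff matrix_vector_mult_def map_matrix_def)

lemma poly_apply_of_real:
  "poly_apply (map_matrix complex_of_real A) (map_poly complex_of_real p) (\<chi> i. complex_of_real (x $ i)) =
    (\<chi> i. complex_of_real ((mat_poly p A *v x) $ i))"
proof (induction p)
  case (pCons a p)
  then show ?case
    by (simp add: map_poly_pCons map_matrix_of_real_mult mat_poly_pCons)
      (simp add: vec_eq_iff matrix_vector_mult_add_rdistrib matrix_vector_mul_assoc[symmetric]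
        scaleR_matrix_vector_assoc[symmetric])
qed (simp add: vec_eq_iff)

text \<open>Peeling off one linear factor \<open>X - c\<close> turns \<open>f\<close> into \<open>g = f' - c f\<close>. If \<open>c\<close> is an
  eigenvalue then it has negative real part and \<open>f\<close> is a damped response to \<open>g\<close>; otherwise
  \<open>M - c\<close> is bounded below.\<close>

lemma ode_poly_decay:
  fixes f :: "real \<Rightarrow> complex^'n" and M :: "complex^'n^'n"
  assumes ev: "\<And>z v. \<lbrakk>v \<noteq> 0; M *v v = z *s v\<rbrakk> \<Longrightarrow> Re z < 0"
  shows "\<lbrakk>p \<noteq> 0; \<And>t. (f has_vector_derivative M *v f t) (at t); \<And>t. poly_apply M p (f t) = 0\<rbrakk>
    \<Longrightarrow> (f \<longlongrightarrow> 0) at_top"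
proof (induction "degree p" arbitrary: p f)
  case 0
  then obtain c where "p = [:c:]" "c \<noteq> 0" by (metis degree_eq_zeroE pCons_0_0)
  then have "f t = 0" for t using "0.prems"(3)[of t] by (simp add: vector_mul_eq_0)
  then show ?case by simp
next
  case (Suc n)
  have "\<not> constant (poly p)" using Suc.hyps(2) by (simp add: constant_degree)
  then obtain c where "poly p c = 0" using fundamental_theorem_of_algebra by blast
  then obtain q where q: "p = [:- c, 1:] * q" by (auto simp: poly_eq_0_iff_dvd)
  \<comment> \<open>The linear factor is placed on the right so that it acts on \<open>f\<close>
    first: \<open>q\<close> then annihilates \<open>g\<close>, and the induction hypothesis applies
    to \<open>g\<close>.\<close>
  then have p: "p = q * [:- c, 1:]" by (simp only: mult.commute)
  have "q \<noteq> 0" using q Suc.prems(1) by auto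
  then have "degree q = n" using q Suc.hyps(2) by (simp add: degree_mult_eq del: mult_pCons_left)
  define N where "N = M - mat c"
  have N: "N *v v = M *v v - c *s v" for v
  proof -
    have "mat c *v v = c *s v"
      by (simp add: vec_eq_iff matrix_vector_mult_def mat_def if_distrib if_distribR cong del: if_weak_cong)
    then show ?thesis by (simp add: N_def matrix_vector_mult_diff_rdistrib)
  qed
  define g where "g t = N *v f t" for t
  have g: "g t = - c *s f t + M *v f t" for t
    by (simp add: g_def N vec_eq_iff)
  have MN: "M *v (N *v v) = N *v (M *v v)" for v
    by (simp add: N matrix_vector_mult_diff_distrib vector_scalar_commute)
  have "(g \<longlongrightarrow> 0) at_top"
  proof (rule Suc.hyps(1)[OF \<open>degree q = n\<close>[symmetric] \<open>q \<noteq> 0\<close>])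
    show "(g has_vector_derivative M *v g t) (at t)" for t
      unfolding g_def[abs_def] MN
      by (rule bounded_linear.has_vector_derivative[OF matrix_vector_mul_bounded_linear Suc.prems(2)])
    show "poly_apply M q (g t) = 0" for t
      using Suc.prems(3)[of t] unfolding p poly_apply_mult g by simp
  qed
  show ?case
  proof (cases "\<exists>v. v \<noteq> 0 \<and> M *v v = c *s v")
    case True
    then have "Re c < 0" using ev by blast
    show ?thesis
      by (rule ode_forced_decay[OF _ \<open>Re c < 0\<close> \<open>(g \<longlongrightarrow> 0) at_top\<close>])
        (use Suc.prems(2) in \<open>simp add: g_def N\<close>)
  next
    case False
    have L: "linear ((*v) N)" by (rule bounded_linear.linear[OF matrix_vector_mul_bounded_linear])
    have "inj ((*v) N)"
      unfolding linear_injective_0[OF L] using False by (auto simp: N)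
    from linear_inj_bounded_below_pos[OF L this]
    obtain B where B: "B > 0" "\<And>v. B * norm v \<le> norm (N *v v)" by blast
    have "((\<lambda>t. norm (g t) / B) \<longlongrightarrow> 0) at_top"
      using \<open>(g \<longlongrightarrow> 0) at_top\<close> by (intro tendsto_divide_zero tendsto_norm_zero)
    then show ?thesis
      by (rule Lim_null_comparison[rotated])
        (use B in \<open>auto intro!: always_eventually simp: g_def field_simps\<close>)
  qed
qed

lemma Hurwitz_imp_mat_exp_apply_tendsto:
  assumes "Hurwitz A"
  shows "((\<lambda>t. mat_exp (t *\<^sub>R A) *v x) \<longlongrightarrow> 0) at_top"
proof -
  let ?c = "\<lambda>x :: real^'n. (\<chi> i. complex_of_real (x $ i))"
  have "bounded_linear ?c"
    unfolding linear_conv_bounded_linear[symmetric] 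
    by (simp add: linear_iff vec_eq_iff complex_eq_iff)
  have "((\<lambda>t. ?c (mat_exp (t *\<^sub>R A) *v x)) \<longlongrightarrow> 0) at_top"
  proof (rule ode_poly_decay[where M = "map_matrix complex_of_real A" and p = "map_poly complex_of_real (minimal_poly A)"])
    show "Re z < 0" if "v \<noteq> 0" "map_matrix complex_of_real A *v v = z *s v" for z v
      using assms that by (auto simp: Hurwitz_def eigenvalue_def)
    have "lead_coeff (minimal_poly A) = 1" by (rule lead_coeff_minimal_poly)
    then have "minimal_poly A \<noteq> 0" by auto
    then show "map_poly complex_of_real (minimal_poly A) \<noteq> 0"
      by (subst map_poly_eq_0_iff) auto
    show "((\<lambda>t. ?c (mat_exp (t *\<^sub>R A) *v x)) has_vector_derivative
        map_matrix complex_of_real A *v ?c (mat_exp (t *\<^sub>R A) *v x)) (at t)" for t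
      unfolding map_matrix_of_real_mult
      by (rule bounded_linear.has_vector_derivative[OF \<open>bounded_linear ?c\<close> mat_exp_apply_has_vector_derivative])
    show "poly_apply (map_matrix complex_of_real A) (map_poly complex_of_real (minimal_poly A))
        (?c (mat_exp (t *\<^sub>R A) *v x)) = 0" for t
      by (simp add: poly_apply_of_real mat_poly_minimal_poly vec_eq_iff)
  qed
  then have "((\<lambda>t. ?c (mat_exp (t *\<^sub>R A) *v x) $ i) \<longlongrightarrow> 0 $ i) at_top" for i
    by (rule tendsto_vec_nth)
  then have "((\<lambda>t. Re (?c (mat_exp (t *\<^sub>R A) *v x) $ i)) \<longlongrightarrow> Re (0 $ i)) at_top" for i
    by (rule tendsto_Re)
  then show ?thesis by (intro vec_tendstoI) simp
qed

lemma Hurwitz_imp_mat_exp_tendsto: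
  assumes "Hurwitz A"
  shows "((\<lambda>t. mat_exp (t *\<^sub>R A)) \<longlongrightarrow> 0) at_top"
proof (intro vec_tendstoI)
  fix i j
  have "((\<lambda>t. (mat_exp (t *\<^sub>R A) *v axis j 1) $ i) \<longlongrightarrow> 0 $ i) at_top"
    by (intro tendsto_vec_nth Hurwitz_imp_mat_exp_apply_tendsto assms)
  then show "((\<lambda>t. mat_exp (t *\<^sub>R A) $ i $ j) \<longlongrightarrow> 0 $ i $ j) at_top"
    by (simp add: matrix_vector_mult_basis column_def)
qed

section \<open>Real solutions coming from complex eigenvalues\<close>

lemma has_vector_derivative_vec_lambda:
  assumes "\<And>i. ((\<lambda>t. f t i) has_real_derivative f' i) (at t)"
  shows "((\<lambda>t. \<chi> i. f t i) has_vector_derivative (\<chi> i. f' i)) (at t)"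
  unfolding has_vector_derivative_def
  by (subst has_derivative_componentwise_within)
    (use assms in \<open>auto simp: Basis_vec_def inner_axis has_field_derivative_def mult_commute_abs\<close>)

lemma eigenvalue_solution:
  assumes "eigenvalue A z"
  obtains v where "v \<noteq> 0"
    "\<And>t. ((\<lambda>t. \<chi> i. Re (exp (t *\<^sub>R z) * v $ i)) has_vector_derivative A *v (\<chi> i. Re (exp (t *\<^sub>R z) * v $ i))) (at t)"
    "\<And>t. ((\<lambda>t. \<chi> i. Im (exp (t *\<^sub>R z) * v $ i)) has_vector_derivative A *v (\<chi> i. Im (exp (t *\<^sub>R z) * v $ i))) (at t)"
proof -
  obtain v where v: "v \<noteq> 0" "map_matrix complex_of_real A *v v = z *s v"
    using assms by (auto simp: eigenvalue_def)
  have e: "((\<lambda>t. exp (t *\<^sub>R z) * w) has_vector_derivative exp (t *\<^sub>R z) * (z * w)) (at t)" for w t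
    using has_vector_derivative_mult_left[OF exp_scaleR_has_vector_derivative_right[of z t UNIV], of w]
    by (simp add: mult.assoc)
  have zv: "z * v $ i = (\<Sum>j\<in>UNIV. complex_of_real (A $ i $ j) * v $ j)" for i
    using v(2) by (simp add: vec_eq_iff matrix_vector_mult_def map_matrix_def)
  have eq: "exp (t *\<^sub>R z) * (z * v $ i) = (\<Sum>j\<in>UNIV. complex_of_real (A $ i $ j) * (exp (t *\<^sub>R z) * v $ j))" for i t
    by (simp add: zv sum_distrib_left mult_ac)
  have "((\<lambda>t. \<chi> i. Re (exp (t *\<^sub>R z) * v $ i)) has_vector_derivative (\<chi> i. Re (exp (t *\<^sub>R z) * (z * v $ i)))) (at t)" for t
    by (intro has_vector_derivative_vec_lambda
        bounded_linear.has_vector_derivative[OF bounded_linear_Re e, folded has_real_derivative_iff_has_vector_derivative])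
  moreover have "((\<lambda>t. \<chi> i. Im (exp (t *\<^sub>R z) * v $ i)) has_vector_derivative (\<chi> i. Im (exp (t *\<^sub>R z) * (z * v $ i)))) (at t)" for t
    by (intro has_vector_derivative_vec_lambda
        bounded_linear.has_vector_derivative[OF bounded_linear_Im e, folded has_real_derivative_iff_has_vector_derivative])
  moreover have "(\<chi> i. Re (exp (t *\<^sub>R z) * (z * v $ i))) = A *v (\<chi> i. Re (exp (t *\<^sub>R z) * v $ i))" for t
    unfolding eq by (simp add: vec_eq_iff matrix_vector_mult_def)
  moreover have "(\<chi> i. Im (exp (t *\<^sub>R z) * (z * v $ i))) = A *v (\<chi> i. Im (exp (t *\<^sub>R z) * v $ i))" for t
    unfolding eq by (simp add: vec_eq_iff matrix_vector_mult_def)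
  ultimately show ?thesis using that[OF v(1)] by simp
qed

text \<open>The real and imaginary parts of \<open>exp (t z) v\<close> are real solutions.\<close>

lemma Hurwitz_if_solutions_tendsto:
  assumes "\<And>x. (\<And>t. (x has_vector_derivative A *v x t) (at t)) \<Longrightarrow> (x \<longlongrightarrow> 0) at_top"
  shows "Hurwitz A"
  unfolding Hurwitz_def
proof (intro allI impI)
  fix z assume "eigenvalue A z"
  then obtain v where v: "v \<noteq> 0"
    "\<And>t. ((\<lambda>t. \<chi> i. Re (exp (t *\<^sub>R z) * v $ i)) has_vector_derivative A *v (\<chi> i. Re (exp (t *\<^sub>R z) * v $ i))) (at t)"
    "\<And>t. ((\<lambda>t. \<chi> i. Im (exp (t *\<^sub>R z) * v $ i)) has_vector_derivative A *v (\<chi> i. Im (exp (t *\<^sub>R z) * v $ i))) (at t)"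
    by (rule eigenvalue_solution) blast
  obtain i where i: "v $ i \<noteq> 0" using v(1) by (auto simp: vec_eq_iff)
  have "((\<lambda>t. Re (exp (t *\<^sub>R z) * v $ i)) \<longlongrightarrow> 0) at_top"
    using tendsto_vec_nth[OF assms[OF v(2)], of i] by simp
  moreover have "((\<lambda>t. Im (exp (t *\<^sub>R z) * v $ i)) \<longlongrightarrow> 0) at_top"
    using tendsto_vec_nth[OF assms[OF v(3)], of i] by simp
  ultimately have "((\<lambda>t. exp (t *\<^sub>R z) * v $ i) \<longlongrightarrow> 0) at_top"
    by (simp add: tendsto_complex_iff)
  then have "((\<lambda>t. norm (exp (t *\<^sub>R z) * v $ i)) \<longlongrightarrow> 0) at_top"
    by (rule tendsto_norm_zero)
  then have lim: "((\<lambda>t. exp (t * Re z) * norm (v $ i)) \<longlongrightarrow> 0) at_top"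
    by (simp add: norm_mult)
  show "Re z < 0"
  proof (rule ccontr)
    assume "\<not> Re z < 0"
    have "norm (v $ i) \<le> 0"
    proof (rule tendsto_lowerbound[OF lim])
      show "\<forall>\<^sub>F t in at_top. norm (v $ i) \<le> exp (t * Re z) * norm (v $ i)"
        using eventually_ge_at_top[of 0]
      proof eventually_elim
        case (elim t)
        then have "1 \<le> exp (t * Re z)" using \<open>\<not> Re z < 0\<close> by simp
        then show ?case by (simp add: mult_le_cancel_right1)
      qed
    qed simp
    then show False using i by simp
  qed
qed

lemma bounded_matrices_apply_le:
  assumes "bounded (\<A> :: (real^'n^'n) set)"
  obtains R where "R \<ge> 0" "\<And>A x. A \<in> \<A> \<Longrightarrow> norm (A *v x) \<le> R * norm x"
proof -
  obtain K where K: "K \<ge> 0" "\<And>(A::real^'n^'n) x. norm (A *v x) \<le> norm A * norm x * K"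
    using bounded_bilinear.nonneg_bounded[OF bounded_bilinear_matrix_vector_mult] by blast
  obtain r where r: "\<And>A. A \<in> \<A> \<Longrightarrow> norm A \<le> r" "r > 0"
    using assms by (auto simp: bounded_pos)
  have "norm (A *v x) \<le> r * K * norm x" if "A \<in> \<A>" for A x
  proof -
    have "norm (A *v x) \<le> norm A * norm x * K" by (rule K(2))
    also have "\<dots> \<le> r * norm x * K" using r(1)[OF that] K(1) by (intro mult_right_mono) auto
    finally show ?thesis by (simp add: mult_ac)
  qed
  then show ?thesis using that[of "r * K"] r(2) K(1) by auto
qed

text \<open>At each regime some time brings the flow below one half; by continuity the same time
  works nearby, and finitely many such times serve all of \<A>. Repeated halving then yields an
  exponential rate.\<close>

lemma compact_Hurwitz_uniform_decay:
  fixes \<A> :: "(real^'n^'n) set"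
  assumes "compact \<A>" and H: "\<And>A. A \<in> \<A> \<Longrightarrow> Hurwitz A"
  obtains C b where "C \<ge> 1" "b > 0"
    "\<And>A t x. \<lbrakk>A \<in> \<A>; t \<ge> 0\<rbrakk> \<Longrightarrow> norm (mat_exp (t *\<^sub>R A) *v x) \<le> C * exp (- b * t) * norm x"
proof -
  obtain R where R: "R \<ge> 0" "\<And>A x. A \<in> \<A> \<Longrightarrow> norm (A *v x) \<le> R * norm x"
    using bounded_matrices_apply_le[OF compact_imp_bounded[OF assms(1)]] by blast
  obtain K where K: "K > 0" "\<And>(M::real^'n^'n) x. norm (M *v x) \<le> norm M * norm x * K"
    using bounded_bilinear.pos_bounded[OF bounded_bilinear_matrix_vector_mult] by blast
  have "\<exists>T\<ge>1. norm (mat_exp (T *\<^sub>R A)) * K < 1 / 2" if "A \<in> \<A>" for A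
  proof -
    have "((\<lambda>t. norm (mat_exp (t *\<^sub>R A)) * K) \<longlongrightarrow> 0) at_top"
      by (intro tendsto_mult_left_zero tendsto_norm_zero Hurwitz_imp_mat_exp_tendsto H that)
    then have "\<forall>\<^sub>F t in at_top. norm (mat_exp (t *\<^sub>R A)) * K < 1 / 2"
      by (rule order_tendstoD(2)) simp
    then have "\<forall>\<^sub>F t in at_top. t \<ge> 1 \<and> norm (mat_exp (t *\<^sub>R A)) * K < 1 / 2"
      using eventually_ge_at_top by (rule eventually_conj[rotated])
    then show ?thesis using eventually_happens trivial_limit_at_top_linorder by blast
  qed
  then obtain T where T: "\<And>A. A \<in> \<A> \<Longrightarrow> T A \<ge> 1"
    "\<And>A. A \<in> \<A> \<Longrightarrow> norm (mat_exp (T A *\<^sub>R A)) * K < 1 / 2" by metis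
  define U where "U A = {B :: real^'n^'n. norm (mat_exp (T A *\<^sub>R B)) * K < 1 / 2}" for A
  have "open (U A)" for A
  proof -
    have "continuous_on UNIV (mat_exp :: real^'n^'n \<Rightarrow> _)"
      by (simp add: continuous_on_eq_continuous_at isCont_mat_exp)
    moreover have "continuous_on UNIV (\<lambda>B :: real^'n^'n. T A *\<^sub>R B)" by (intro continuous_intros)
    ultimately have "continuous_on UNIV (\<lambda>B :: real^'n^'n. mat_exp (T A *\<^sub>R B))"
      using continuous_on_compose2 subset_UNIV by blast
    then show ?thesis
      unfolding U_def by (intro open_Collect_less continuous_intros)
  qed
  moreover have "\<A> \<subseteq> (\<Union>A\<in>\<A>. U A)" using T(2) by (auto simp: U_def)
  ultimately obtain F where F: "F \<subseteq> \<A>" "finite F" "\<A> \<subseteq> (\<Union>A\<in>F. U A)"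
    using compactE_image[OF assms(1), of \<A> U] by blast
  define \<tau> where "\<tau> = Max (insert 1 (T ` F))"
  have \<tau>: "\<tau> \<ge> 1" "\<And>A. A \<in> F \<Longrightarrow> T A \<le> \<tau>" using F(2) by (auto simp: \<tau>_def)
  \<comment> \<open>With this rate \<open>exp (- b * s)\<close> loses at most a factor 2 over a
    block of length \<open>s \<le> \<tau>\<close>, which is what one halving gains. In
    \<open>C\<close>, \<open>exp (R * \<tau>)\<close> covers growth within an unfinished block and 2
    makes up for the weight there.\<close>
  define b where "b = ln 2 / \<tau>"
  have "b > 0" using \<tau>(1) by (simp add: b_def)
  define C where "C = 2 * exp (R * \<tau>)"
  have "C \<ge> 1" using R(1) \<tau>(1) mult_mono[of 1 2 1 "exp (R * \<tau>)"] by (simp add: C_def)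
  have expb: "exp (b * s) \<le> 2" if "s \<le> \<tau>" for s
  proof -
    have "b * s \<le> b * \<tau>" using that \<open>b > 0\<close> by simp
    also have "\<dots> = ln 2" using \<tau>(1) by (simp add: b_def)
    finally show ?thesis by (metis exp_le_cancel_iff exp_ln zero_less_numeral)
  qed
  \<comment> \<open>Every block has length at least 1, so removing one lowers the integer bound
    \<open>n\<close> on the time.\<close>
  have *: "norm (mat_exp (t *\<^sub>R A) *v x) \<le> C * exp (- b * t) * norm x"
    if A: "A \<in> \<A>" and "t \<ge> 0" "t < real n" for A t x n
    using that(2,3)
  proof (induction n arbitrary: t x)
    case (Suc n)
    show ?case
    proof (cases "t \<le> \<tau>")
      case True
      have "norm (mat_exp (t *\<^sub>R A) *v x) \<le> exp (R * t) * norm x"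
        using R A Suc.prems(1) by (intro norm_mat_exp_apply_le) auto
      also have "\<dots> \<le> exp (R * \<tau>) * norm x"
        using True R(1) by (intro mult_right_mono) (auto simp: mult_left_mono)
      also have "\<dots> \<le> C * exp (- b * t) * norm x"
      proof (rule mult_right_mono)
        have "1 \<le> 2 * exp (- b * t)" using expb[OF True] by (simp add: exp_minus field_simps)
        then have "exp (R * \<tau>) * 1 \<le> exp (R * \<tau>) * (2 * exp (- b * t))" by (intro mult_left_mono) auto
        then show "exp (R * \<tau>) \<le> C * exp (- b * t)" by (simp add: C_def mult_ac)
      qed simp
      finally show ?thesis .
    next
      case False
      obtain B where B: "B \<in> F" "A \<in> U B" using F(3) A by auto
      define s where "s = T B"
      have s: "1 \<le> s" "s \<le> \<tau>" "norm (mat_exp (s *\<^sub>R A)) * K < 1 / 2"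
        using B F(1) T(1) \<tau>(2) by (auto simp: s_def U_def)
      have "norm (mat_exp (s *\<^sub>R A) *v x) \<le> norm (mat_exp (s *\<^sub>R A)) * K * norm x"
        using K(2)[of "mat_exp (s *\<^sub>R A)" x] by (simp add: mult_ac)
      also have "\<dots> \<le> 1 / 2 * norm x" using s(3) by (intro mult_right_mono) auto
      finally have half: "norm (mat_exp (s *\<^sub>R A) *v x) \<le> 1 / 2 * norm x" .
      have "norm (mat_exp (t *\<^sub>R A) *v x) = norm (mat_exp ((t - s) *\<^sub>R A) *v (mat_exp (s *\<^sub>R A) *v x))"
        using mat_exp_add_apply[of "t - s" s A x] False s(2) by simp
      also have "\<dots> \<le> C * exp (- b * (t - s)) * norm (mat_exp (s *\<^sub>R A) *v x)"
        using False s Suc.prems by (intro Suc.IH) auto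
      also have "\<dots> \<le> C * exp (- b * (t - s)) * (1 / 2 * norm x)"
        using half \<open>C \<ge> 1\<close> by (intro mult_left_mono) auto
      also have "\<dots> = C * exp (- b * t) * (exp (b * s) / 2) * norm x"
      proof -
        have "exp (- b * (t - s)) = exp (- b * t) * exp (b * s)"
          by (subst exp_add[symmetric]) (simp add: algebra_simps)
        then show ?thesis by simp
      qed
      also have "\<dots> \<le> C * exp (- b * t) * 1 * norm x"
        using expb[OF s(2)] \<open>C \<ge> 1\<close> by (intro mult_right_mono mult_left_mono) auto
      finally show ?thesis by simp
    qed
  qed simp
  have "norm (mat_exp (t *\<^sub>R A) *v x) \<le> C * exp (- b * t) * norm x"
    if "A \<in> \<A>" "t \<ge> 0" for A t x
  proof -
    obtain n where "t < real n" using reals_Archimedean2 by blast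
    then show ?thesis by (rule *[OF that])
  qed
  then show ?thesis using that[OF \<open>C \<ge> 1\<close> \<open>b > 0\<close>] by simp
qed

section \<open>Products along words without repeated labels\<close>

text \<open>Abstract form of a switching law: a letter is an interval, its label the regime,
  \<open>op\<close> the flow across it, \<open>cost\<close> its truncated length. Flows are
  invertible, and their growth is controlled by the cost.\<close>

locale labelled_words =
  fixes E :: "'l set" and lab :: "'l \<Rightarrow> 'k" and cost :: "'l \<Rightarrow> real"
    and op :: "'l \<Rightarrow> 'a::euclidean_space \<Rightarrow> 'a" and R :: real
  assumes cost_pos: "l \<in> E \<Longrightarrow> cost l > 0" and cost_le_1: "l \<in> E \<Longrightarrow> cost l \<le> 1"
    and op_linear: "l \<in> E \<Longrightarrow> linear (op l)" and op_inj: "l \<in> E \<Longrightarrow> inj (op l)"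
    and R_nonneg: "R \<ge> 0" and op_norm_le: "l \<in> E \<Longrightarrow> norm (op l x) \<le> exp (R * cost l) * norm x"
begin

text \<open>The first argument is the label just before the word, with \<open>None\<close> for no
  constraint. Adjacent labels must differ because two neighbouring intervals of one regime would be
  a single longer one.\<close>

fun word :: "'k option \<Rightarrow> 'l list \<Rightarrow> bool" where
  "word k [] \<longleftrightarrow> True"
| "word k (l # w) \<longleftrightarrow> l \<in> E \<and> k \<noteq> Some (lab l) \<and> word (Some (lab l)) w"

fun end_label :: "'k option \<Rightarrow> 'l list \<Rightarrow> 'k option" where
  "end_label k [] = k"
| "end_label k (l # w) = end_label (Some (lab l)) w"

definition word_cost :: "'l list \<Rightarrow> real" where
  "word_cost w = sum_list (map cost w)"

abbreviation act :: "'l list \<Rightarrow> 'a \<Rightarrow> 'a" where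
  "act w x \<equiv> fold op w x"

lemma word_cost_simps [simp]: "word_cost [] = 0" "word_cost (l # w) = cost l + word_cost w"
  "word_cost (u @ v) = word_cost u + word_cost v"
  by (simp_all add: word_cost_def)

lemma word_append: "word k (u @ v) \<longleftrightarrow> word k u \<and> word (end_label k u) v"
  by (induction u arbitrary: k) auto

lemma end_label_append [simp]: "end_label k (u @ v) = end_label (end_label k u) v"
  by (induction u arbitrary: k) auto

lemma end_label_last: "w \<noteq> [] \<Longrightarrow> end_label k w = Some (lab (last w))"
  by (induction w arbitrary: k) (auto simp: neq_Nil_conv)

lemma word_change: "\<lbrakk>word k w; w = [] \<or> k' \<noteq> Some (lab (hd w))\<rbrakk> \<Longrightarrow> word k' w"
  by (cases w) auto

lemma word_None: "word k w \<Longrightarrow> word None w"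
  by (cases w) auto

lemma word_nth: "\<lbrakk>word k w; i < length w\<rbrakk> \<Longrightarrow> w ! i \<in> E"
  by (induction w arbitrary: k i) (auto simp: nth_Cons split: nat.splits)

lemma word_nth_lab: "\<lbrakk>word k w; Suc i < length w\<rbrakk> \<Longrightarrow> lab (w ! i) \<noteq> lab (w ! Suc i)"
proof (induction w arbitrary: k i)
  case (Cons l w)
  then show ?case by (cases i; cases w) auto
qed simp

lemma act_linear: "word k w \<Longrightarrow> linear (act w)"
proof (induction w arbitrary: k)
  case (Cons l w)
  then have "linear (act w \<circ> op l)"
    by (intro linear_compose op_linear) auto
  then show ?case by (simp add: comp_def)
qed (simp add: linear_id[unfolded id_def] id_def)

lemma act_inj: "word k w \<Longrightarrow> inj (act w)"
proof (induction w arbitrary: k)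
  case (Cons l w)
  then have "inj (act w \<circ> op l)"
    by (intro inj_compose op_inj) auto
  then show ?case by (simp add: comp_def)
qed (simp add: id_def)

lemma norm_act_le: "word k w \<Longrightarrow> norm (act w x) \<le> exp (R * word_cost w) * norm x"
proof (induction w arbitrary: k x)
  case (Cons l w)
  then have "norm (act w (op l x)) \<le> exp (R * word_cost w) * norm (op l x)" by auto
  also have "\<dots> \<le> exp (R * word_cost w) * (exp (R * cost l) * norm x)"
    using Cons.prems by (intro mult_left_mono op_norm_le) auto
  finally show ?case by (simp add: exp_add algebra_simps)
qed simp

text \<open>Letters cost at most 1, so the shortest prefix whose cost reaches \<open>a\<close>
  overshoots by at most 1.\<close>

lemma word_split:
  assumes "word k w" "a > 0" "word_cost w \<ge> a"
  obtains u v where "w = u @ v" "a \<le> word_cost u" "word_cost u \<le> a + 1"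
proof -
  have "\<exists>u v. w = u @ v \<and> a \<le> word_cost u \<and> word_cost u \<le> a + 1"
    using assms
  proof (induction w arbitrary: k rule: rev_induct)
    case (snoc l w)
    show ?case
    proof (cases "word_cost w \<ge> a")
      case True
      then obtain u v where "w = u @ v \<and> a \<le> word_cost u \<and> word_cost u \<le> a + 1"
        using snoc.IH[of k] snoc.prems by (auto simp: word_append)
      then show ?thesis by (intro exI[of _ u] exI[of _ "v @ [l]"]) simp
    next
      case False
      moreover have "cost l \<le> 1" using snoc.prems(1) by (auto simp: word_append intro: cost_le_1)
      ultimately show ?thesis using snoc.prems(3)
        by (intro exI[of _ "w @ [l]"] exI[of _ "[]"]) simp
    qed
  qed simp
  then show ?thesis using that by blast
qed

end

text \<open>The hypothesis speaks about one infinite word at a time, with no uniformity; extracting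
  from it a rate common to all finite words (\<open>words_decay\<close>) is the aim of this
  locale.\<close>

locale convergent_words = labelled_words E lab cost op R
  for E :: "'l set" and lab :: "'l \<Rightarrow> 'k" and cost
    and op :: "'l \<Rightarrow> 'a::euclidean_space \<Rightarrow> 'a" and R +
  assumes converge: "\<lbrakk>\<And>i. l i \<in> E; \<And>i. lab (l i) \<noteq> lab (l (Suc i)); \<And>c. \<exists>n. c \<le> (\<Sum>i<n. cost (l i))\<rbrakk>
    \<Longrightarrow> (\<lambda>n. fold op (map l [0..<n]) x) \<longlonglongrightarrow> 0"
begin

text \<open>If a property keeping the vector away from 0 could always be continued by a word of cost
  at least 1, the pieces would form one infinite word of infinite cost whose products do not tend to
  0. The index \<open>n\<close> in \<open>Q\<close> lets the property weaken along the way.\<close>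

lemma no_persistent_chain:
  fixes Q :: "nat \<Rightarrow> 'k option \<Rightarrow> 'a \<Rightarrow> bool"
  assumes start: "Q 0 k0 x0" and "\<epsilon> > 0" and large: "\<And>n k x. Q n k x \<Longrightarrow> norm x \<ge> \<epsilon>"
    and step: "\<And>n k x. Q n k x \<Longrightarrow> \<exists>u. word k u \<and> word_cost u \<ge> 1 \<and> Q (Suc n) (end_label k u) (act u x)"
  shows False
proof -
  define P where "P n w \<longleftrightarrow> word k0 w \<and> Q n (end_label k0 w) (act w x0) \<and> word_cost w \<ge> real n" for n w
  have "\<exists>U. \<forall>n. P n (U n) \<and> (\<exists>u. u \<noteq> [] \<and> U (Suc n) = U n @ u)"
  proof (rule dependent_nat_choice)
    show "\<exists>w. P 0 w" using start by (intro exI[of _ "[]"]) (simp add: P_def)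
  next
    fix w n assume "P n w"
    then obtain u where "word (end_label k0 w) u" "word_cost u \<ge> 1"
      "Q (Suc n) (end_label (end_label k0 w) u) (act u (act w x0))"
      unfolding P_def using step by blast
    then show "\<exists>w'. P (Suc n) w' \<and> (\<exists>u. u \<noteq> [] \<and> w' = w @ u)"
      using \<open>P n w\<close> by (intro exI[of _ "w @ u"]) (auto simp: P_def word_append)
  qed
  then obtain U where U: "\<And>n. P n (U n)" "\<And>n. \<exists>u. u \<noteq> [] \<and> U (Suc n) = U n @ u" by blast
  have len: "n \<le> length (U n)" for n
  proof (induction n)
    case (Suc n)
    then show ?case using U(2)[of n] by (auto simp: Suc_le_eq intro: le_less_trans)
  qed simp
  have prefix: "\<exists>v. U n = U m @ v" if "m \<le> n" for m n
    using that
  proof (induction rule: dec_induct)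
    case (step n)
    then show ?case using U(2)[of n] by auto
  qed auto
  define l where "l i = U (Suc i) ! i" for i
  have l: "l i = U n ! i" if "i < length (U n)" for i n
  proof (cases "n \<le> Suc i")
    case True
    then show ?thesis using prefix[OF True] that by (auto simp: l_def nth_append)
  next
    case False
    then have "Suc i \<le> n" by simp
    moreover have "i < length (U (Suc i))" using len[of "Suc i"] by simp
    ultimately show ?thesis using prefix[of "Suc i" n] by (auto simp: l_def nth_append)
  qed
  have Ul: "U n = map l [0..<length (U n)]" for n
    by (rule nth_equalityI) (auto simp: l)
  have "(\<lambda>n. fold op (map l [0..<n]) x0) \<longlonglongrightarrow> 0"
  proof (rule converge)
    fix i
    have w: "word k0 (U (Suc (Suc i)))" and i: "Suc i < length (U (Suc (Suc i)))"
      using U(1)[of "Suc (Suc i)"] len[of "Suc (Suc i)"] by (auto simp: P_def)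
    show "l i \<in> E" using word_nth[OF w, of i] i l[of i "Suc (Suc i)"] by auto
    show "lab (l i) \<noteq> lab (l (Suc i))"
      using word_nth_lab[OF w i] i l[of i "Suc (Suc i)"] l[OF i] by auto
  next
    fix c :: real
    obtain n where "c \<le> real n" using real_arch_simple by blast
    also have "real n \<le> word_cost (U n)" using U(1) by (simp add: P_def)
    also have "\<dots> = (\<Sum>i<length (U n). cost (l i))"
      unfolding word_cost_def by (subst Ul) (simp add: interv_sum_list_conv_sum_set_nat atLeast0LessThan)
    finally show "\<exists>n. c \<le> (\<Sum>i<n. cost (l i))" by blast
  qed
  from LIMSEQ_D[OF this \<open>\<epsilon> > 0\<close>]
  obtain N where N: "\<And>n. n \<ge> N \<Longrightarrow> norm (fold op (map l [0..<n]) x0) < \<epsilon>" by auto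
  have "norm (act (U N) x0) < \<epsilon>" using N[OF len[of N]] by (subst Ul)
  moreover have "norm (act (U N) x0) \<ge> \<epsilon>" using U(1)[of N] large by (auto simp: P_def)
  ultimately show False by simp
qed

section \<open>Boundedness of the products along all words\<close>

lemma norm_le_sum_Basis:
  assumes f: "linear f" and c: "\<And>b. b \<in> Basis \<Longrightarrow> norm (f b) \<le> c"
  shows "norm (f (x :: 'a)) \<le> real DIM('a) * c * norm x"
proof -
  have "f x = f (\<Sum>b\<in>Basis. (x \<bullet> b) *\<^sub>R b)" by (simp add: euclidean_representation)
  also have "\<dots> = (\<Sum>b\<in>Basis. (x \<bullet> b) *\<^sub>R f b)"
    by (simp add: linear_sum[OF f] linear_scale[OF f])
  finally have "norm (f x) \<le> (\<Sum>b\<in>Basis. norm ((x \<bullet> b) *\<^sub>R f b))" by (metis norm_sum)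
  also have "\<dots> \<le> (\<Sum>b\<in>(Basis :: 'a set). norm x * c)"
    by (intro sum_mono) (auto intro!: mult_mono Basis_le_norm c)
  finally show ?thesis by (simp add: mult_ac)
qed

text \<open>The words from a label \<open>lab a\<close> back to another label can be concatenated freely. The set of
  points with bounded image under all of them is an invariant subspace; as the operators are
  invertible, its complement is invariant too, so an orbit starting there can be kept large forever.\<close>

lemma bounded_loops:
  assumes a: "a \<in> E"
  defines "S \<equiv> {w. word None w \<and> w \<noteq> [] \<and> lab (hd w) = lab a \<and> lab (last w) \<noteq> lab a}"
  shows "\<exists>C. \<forall>w\<in>S. \<forall>x. norm (act w x) \<le> C * norm x"
proof -
  define V where "V = {x. \<exists>c. \<forall>w\<in>S. norm (act w x) \<le> c}"
  have lin: "linear (act w)" if "w \<in> S" for w using that act_linear by (auto simp: S_def)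
  have "subspace V"
    unfolding subspace_def
  proof (intro conjI ballI allI)
    show "0 \<in> V" unfolding V_def using lin by (auto intro!: exI[of _ 0] simp: linear_0)
  next
    fix x y assume "x \<in> V" "y \<in> V"
    then obtain c d where cd: "\<And>w. w \<in> S \<Longrightarrow> norm (act w x) \<le> c" "\<And>w. w \<in> S \<Longrightarrow> norm (act w y) \<le> d"
      by (auto simp: V_def)
    have "norm (act w (x + y)) \<le> c + d" if "w \<in> S" for w
      using norm_triangle_mono[OF cd(1)[OF that] cd(2)[OF that]] by (simp add: linear_add[OF lin[OF that]])
    then show "x + y \<in> V" by (auto simp: V_def)
  next
    fix r x assume "x \<in> V"
    then obtain c where c: "\<And>w. w \<in> S \<Longrightarrow> norm (act w x) \<le> c" by (auto simp: V_def)
    have "norm (act w (r *\<^sub>R x)) \<le> \<bar>r\<bar> * c" if "w \<in> S" for w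
      using c[OF that] by (simp add: linear_scale[OF lin[OF that]] mult_left_mono)
    then show "r *\<^sub>R x \<in> V" by (auto simp: V_def)
  qed
  have append: "u @ w \<in> S" if "u \<in> S" "w \<in> S" for u w
    using that word_change[of None w "Some (lab (last u))"]
    by (auto simp: S_def word_append end_label_last)
  have V_iff: "act u x \<in> V \<longleftrightarrow> x \<in> V" if "u \<in> S" for u x
  proof -
    have inj: "inj (act u)" using that act_inj by (auto simp: S_def)
    have "act u ` V \<subseteq> V"
    proof safe
      fix y assume "y \<in> V"
      then obtain c where "\<And>w. w \<in> S \<Longrightarrow> norm (act w y) \<le> c" by (auto simp: V_def)
      then have "norm (act w (act u y)) \<le> c" if "w \<in> S" for w
        using append[OF \<open>u \<in> S\<close> that] by fastforce
      then show "act u y \<in> V" by (auto simp: V_def)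
    qed
    moreover have "dim (act u ` V) = dim V"
      using inj by (intro dim_image_eq lin that) (auto intro: inj_on_subset)
    ultimately have "act u ` V = V"
      using \<open>subspace V\<close> lin[OF that] by (intro subspace_dim_equal linear_subspace_image) auto
    then show ?thesis using inj by (metis inj_image_mem_iff)
  qed
  have "V = UNIV"
  proof (rule ccontr)
    assume "V \<noteq> UNIV"
    then obtain x0 where x0: "x0 \<notin> V" by auto
    define \<epsilon> where "\<epsilon> = norm x0"
    have "\<epsilon> > 0" using x0 subspace_0[OF \<open>subspace V\<close>] by (auto simp: \<epsilon>_def)
    \<comment> \<open>The condition on \<open>k\<close> leaves room for a loop beginning with
      \<open>lab a\<close>; every loop ends with another label, so the condition reproduces
      itself.\<close>
    define Q where "Q n k x \<longleftrightarrow> x \<notin> V \<and> k \<noteq> Some (lab a) \<and> norm x \<ge> \<epsilon>" for n :: nat and k x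
    show False
    proof (rule no_persistent_chain[of Q None x0 \<epsilon>])
      fix n k x assume Q: "Q n k x"
      \<comment> \<open>Exceeding \<open>exp R * norm x\<close> forces the loop to cost at least 1,
        as growth is bounded through the cost; exceeding \<open>\<epsilon>\<close> keeps the chain
        large.\<close>
      define c where "c = max \<epsilon> (exp R * norm x)"
      have "\<not> (\<forall>w\<in>S. norm (act w x) \<le> c)" using Q by (auto simp: Q_def V_def)
      then obtain u where u: "u \<in> S" "norm (act u x) > c" by force
      have "word_cost u \<ge> 1"
      proof (rule ccontr)
        assume "\<not> word_cost u \<ge> 1"
        then have "exp (R * word_cost u) * norm x \<le> exp (R * 1) * norm x"
          using R_nonneg by (intro mult_right_mono iffD2[OF exp_le_cancel_iff] mult_left_mono) auto
        then show False using norm_act_le[of None u x] u by (auto simp: S_def c_def)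
      qed
      moreover have "word k u" using u(1) Q word_change[of None u k] by (auto simp: S_def Q_def)
      moreover have "Q (Suc n) (end_label k u) (act u x)"
        using u Q V_iff[OF u(1)] by (auto simp: Q_def S_def c_def end_label_last)
      ultimately show "\<exists>u. word k u \<and> word_cost u \<ge> 1 \<and> Q (Suc n) (end_label k u) (act u x)" by blast
    qed (use x0 \<open>\<epsilon> > 0\<close> in \<open>auto simp: Q_def \<epsilon>_def\<close>)
  qed
  then have "\<forall>b. \<exists>c. \<forall>w\<in>S. norm (act w b) \<le> c" by (auto simp: V_def)
  then obtain c where c: "\<And>b w. w \<in> S \<Longrightarrow> norm (act w b) \<le> c b" by metis
  define D where "D = Max (c ` Basis)"
  have "norm (act w x) \<le> real DIM('a) * D * norm x" if "w \<in> S" for w x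
  proof (rule norm_le_sum_Basis[OF lin[OF that]])
    fix b :: 'a assume "b \<in> Basis"
    then have "c b \<le> D" unfolding D_def by (intro Max_ge) auto
    then show "norm (act w b) \<le> D" using c[OF that, of b] by simp
  qed
  then show ?thesis by blast
qed

text \<open>Any nonempty word becomes a loop for \<open>bounded_loops\<close> after putting
  \<open>a\<close> in front or \<open>b\<close> behind where necessary. Lower bounds for the two
  invertible operators undo these additions at the price of \<open>c ^ 2\<close>. With at most one
  label, words have at most one letter.\<close>

lemma bounded_words: "\<exists>C\<ge>1. \<forall>w x. word None w \<longrightarrow> norm (act w x) \<le> C * norm x"
proof (cases "\<exists>a\<in>E. \<exists>b\<in>E. lab a \<noteq> lab b")
  case False
  have "norm (act w x) \<le> exp R * norm x" if w: "word None w" for w x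
  proof -
    have "word_cost w \<le> 1"
    proof (cases w)
      case (Cons l w')
      then show ?thesis using w False cost_le_1 by (cases w') auto
    qed simp
    then have "exp (R * word_cost w) * norm x \<le> exp (R * 1) * norm x"
      using R_nonneg by (intro mult_right_mono iffD2[OF exp_le_cancel_iff] mult_left_mono) auto
    then show ?thesis using norm_act_le[OF w, of x] by simp
  qed
  then show ?thesis using R_nonneg by (intro exI[of _ "exp R"]) auto
next
  case True
  then obtain a b where ab: "a \<in> E" "b \<in> E" "lab a \<noteq> lab b" by blast
  obtain C where C: "\<And>w x. \<lbrakk>word None w; w \<noteq> []; lab (hd w) = lab a; lab (last w) \<noteq> lab a\<rbrakk>
      \<Longrightarrow> norm (act w x) \<le> C * norm x"
    using bounded_loops[OF ab(1)] by blast
  obtain ca where ca: "ca > 0" "\<And>x. ca * norm x \<le> norm (op a x)"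
    using linear_inj_bounded_below_pos[OF op_linear op_inj] ab by blast
  obtain cb where cb: "cb > 0" "\<And>x. cb * norm x \<le> norm (op b x)"
    using linear_inj_bounded_below_pos[OF op_linear op_inj] ab by blast
  define c where "c = min 1 (min ca cb)"
  have c: "c > 0" "c \<le> 1" "c \<le> ca" "c \<le> cb" using ca cb by (auto simp: c_def)
  have "norm (act w x) \<le> max 1 (\<bar>C\<bar> / c ^ 2) * norm x" if w: "word None w" for w x
  proof (cases "w = []")
    case True
    then show ?thesis by (simp add: mult_le_cancel_right1)
  next
    case False
    define pre where "pre = (if lab (hd w) = lab a then [] else [a])"
    define post where "post = (if lab (last w) = lab a then [b] else [])"
    have "\<exists>z. act pre z = x \<and> c * norm z \<le> norm x"
    proof (cases "lab (hd w) = lab a")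
      case True
      then show ?thesis using mult_right_mono[of c 1 "norm x"] c by (simp add: pre_def)
    next
      case False
      have "surj (op a)" using op_linear op_inj ab(1) linear_injective_imp_surjective by blast
      then obtain z where z: "op a z = x" by (metis surjD)
      have "c * norm z \<le> ca * norm z" using c by (intro mult_right_mono) auto
      then show ?thesis using z ca(2)[of z] False by (intro exI[of _ z]) (auto simp: pre_def)
    qed
    then obtain z where z: "act pre z = x" "c * norm z \<le> norm x" by blast
    have post: "c * norm y \<le> norm (act post y)" for y
    proof -
      have "c * norm y \<le> cb * norm y" "c * norm y \<le> 1 * norm y" using c by (intro mult_right_mono; simp)+
      then show ?thesis using cb(2)[of y] by (simp add: post_def)
    qed
    have "norm (act (pre @ w @ post) z) \<le> C * norm z"
    proof (rule C)
      have "word None pre" "end_label None pre \<noteq> Some (lab (hd w))"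
        using ab by (auto simp: pre_def)
      moreover have "word (end_label k w) post" for k
        using ab by (auto simp: post_def end_label_last[OF False])
      ultimately show "word None (pre @ w @ post)"
        using word_change[OF w] by (simp add: word_append)
      show "pre @ w @ post \<noteq> []" "lab (hd (pre @ w @ post)) = lab a" "lab (last (pre @ w @ post)) \<noteq> lab a"
        using False ab by (auto simp: pre_def post_def)
    qed
    also have "C * norm z \<le> \<bar>C\<bar> * norm z" by (intro mult_right_mono) auto
    finally have "norm (act post (act w x)) \<le> \<bar>C\<bar> * norm z" by (simp add: z(1))
    then have "c * (c * norm (act w x)) \<le> c * (\<bar>C\<bar> * norm z)"
      using post[of "act w x"] c(1) by (intro mult_left_mono) auto
    also have "\<dots> \<le> \<bar>C\<bar> * norm x" using mult_left_mono[OF z(2), of "\<bar>C\<bar>"] by (simp add: mult_ac)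
    finally have "norm (act w x) \<le> \<bar>C\<bar> / c ^ 2 * norm x"
      using c(1) by (simp add: field_simps power2_eq_square)
    also have "\<dots> \<le> max 1 (\<bar>C\<bar> / c ^ 2) * norm x" by (intro mult_right_mono) auto
    finally show ?thesis .
  qed
  then show ?thesis by (intro exI[of _ "max 1 (\<bar>C\<bar> / c ^ 2)"]) auto
qed

section \<open>From boundedness to uniform exponential decay\<close>

definition persistent :: "'k option \<Rightarrow> 'a \<Rightarrow> real \<Rightarrow> bool" where
  "persistent k x r \<longleftrightarrow> (\<forall>t. \<exists>w. word k w \<and> word_cost w \<ge> t \<and> norm (act w x) \<ge> r)"

text \<open>Long witnesses are cut into a prefix \<open>u j\<close> of cost between 1 and 2 and a
  remainder \<open>v j\<close> of growing cost. The vectors after \<open>u j\<close> accumulate at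
  some \<open>z\<close>, and by the uniform bound late remainders are large on \<open>z\<close> too;
  \<open>\<eta>\<close> pays for moving to \<open>z\<close> and back. The difficulty is that a
  remainder need not be allowed after another prefix, since labels may clash.\<close>

lemma persistent_step:
  assumes C: "C \<ge> 1" "\<And>w x. word None w \<Longrightarrow> norm (act w x) \<le> C * norm x"
    and pers: "persistent k x r" and "\<eta> > 0"
  shows "\<exists>u. word k u \<and> word_cost u \<ge> 1 \<and> persistent (end_label k u) (act u x) (r - \<eta>)"
proof (rule ccontr)
  assume neg: "\<not> ?thesis"
  have "\<exists>u v. word k u \<and> word (end_label k u) v \<and> 1 \<le> word_cost u \<and> real j \<le> word_cost v \<and>
      norm (act v (act u x)) \<ge> r" for j :: nat
  proof -
    obtain w where w: "word k w" "word_cost w \<ge> real j + 2" "norm (act w x) \<ge> r"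
      using pers unfolding persistent_def by blast
    obtain u v where "w = u @ v" "1 \<le> word_cost u" "word_cost u \<le> 1 + 1"
      by (rule word_split[OF w(1), of 1]) (use w(2) in auto)
    then show ?thesis using w by (intro exI[of _ u] exI[of _ v]) (auto simp: word_append)
  qed
  then obtain u v where uv: "\<And>j. word k (u j)" "\<And>j. word (end_label k (u j)) (v j)"
    "\<And>j. 1 \<le> word_cost (u j)" "\<And>j. real j \<le> word_cost (v j)" "\<And>j. norm (act (v j) (act (u j) x)) \<ge> r"
    by metis
  define y where "y j = act (u j) x" for j
  have y_bound: "\<forall>j. y j \<in> cball 0 (C * norm x)"
    using C(2)[OF word_None[OF uv(1)]] by (simp add: y_def)
  obtain z s where s: "strict_mono (s :: nat \<Rightarrow> nat)" and z: "(y \<circ> s) \<longlonglongrightarrow> z"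
    using compact_cball[of "0 :: 'a" "C * norm x"] y_bound unfolding compact_def by blast
  have "\<eta> / (2 * C) > 0" using \<open>\<eta> > 0\<close> C(1) by simp
  from LIMSEQ_D[OF z this] obtain J where J: "\<And>j. j \<ge> J \<Longrightarrow> norm (y (s j) - z) < \<eta> / (2 * C)"
    by (auto simp: o_def)
  have close: "norm (act w (y (s j)) - act w z) \<le> \<eta> / 2" if "word None w" "j \<ge> J" for w j
  proof -
    have "act w (y (s j)) - act w z = act w (y (s j) - z)"
      using linear_diff[OF act_linear[OF that(1)]] by simp
    then have "norm (act w (y (s j)) - act w z) \<le> C * norm (y (s j) - z)"
      using C(2)[OF that(1)] by simp
    also have "\<dots> \<le> C * (\<eta> / (2 * C))"
      using J[OF that(2)] C(1) by (intro mult_left_mono) auto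
    also have "\<dots> = \<eta> / 2" using C(1) by simp
    finally show ?thesis .
  qed
  define B where "B j = end_label k (u (s j))" for j
  define V where "V j = v (s j)" for j
  have V: "word (B j) (V j)" "real j \<le> word_cost (V j)" for j
  proof -
    show "word (B j) (V j)" using uv(2) by (simp add: B_def V_def)
    have "real j \<le> real (s j)" using strict_mono_imp_increasing[OF s] by simp
    also have "\<dots> \<le> word_cost (V j)" using uv(4) by (simp add: V_def)
    finally show "real j \<le> word_cost (V j)" .
  qed
  have Vz: "norm (act (V j) z) \<ge> r - \<eta> / 2" if "j \<ge> J" for j
    using close[OF word_None[OF V(1)] that, of j] uv(5)[of "s j"] norm_triangle_ineq2[of "act (V j) (y (s j))" "act (V j) z"]
    by (simp add: V_def y_def)
  have infinite: "persistent k' z (r - \<eta> / 2)" if "\<And>n. \<exists>j\<ge>n. word k' (V j)" for k'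
    unfolding persistent_def
  proof
    fix t :: real
    obtain n where "t \<le> real n" using real_arch_simple by blast
    moreover obtain j where "j \<ge> max n J" "word k' (V j)" using \<open>\<And>n. \<exists>j\<ge>n. word k' (V j)\<close> by blast
    ultimately show "\<exists>w. word k' w \<and> t \<le> word_cost w \<and> r - \<eta> / 2 \<le> norm (act w z)"
      using V(2)[of j] Vz[of j] by (intro exI[of _ "V j"]) auto
  qed
  have transfer: "\<not> persistent (B j) z (r - \<eta> / 2)" if "j \<ge> J" for j
  proof
    assume p: "persistent (B j) z (r - \<eta> / 2)"
    have "persistent (B j) (y (s j)) (r - \<eta>)"
      unfolding persistent_def
    proof
      fix t
      obtain w where w: "word (B j) w" "t \<le> word_cost w" "r - \<eta> / 2 \<le> norm (act w z)"
        using p unfolding persistent_def by blast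
      have "norm (act w z) - norm (act w (y (s j))) \<le> \<eta> / 2"
        using close[OF word_None[OF w(1)] that] norm_triangle_ineq2[of "act w z" "act w (y (s j))"]
        by (simp add: norm_minus_commute)
      then show "\<exists>w. word (B j) w \<and> t \<le> word_cost w \<and> r - \<eta> \<le> norm (act w (y (s j)))"
        using w by (intro exI[of _ w]) auto
    qed
    then show False using neg uv(1,3) by (auto simp: B_def y_def)
  qed
  have ev: "\<exists>n. \<forall>i\<ge>n. \<not> word (B j) (V i)" if "j \<ge> J" for j
    using infinite[of "B j"] transfer[OF that] by blast
  from ev[OF order_refl] obtain n where n: "\<And>i. i \<ge> n \<Longrightarrow> \<not> word (B J) (V i)" by blast
  have hd: "V i \<noteq> [] \<and> B J = Some (lab (hd (V i)))" if "i \<ge> n" for i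
    using n[OF that] word_change[OF V(1)[of i], of "B J"] by blast
  \<comment> \<open>All late remainders begin with the label \<open>B J\<close>, including
    \<open>V j1\<close>, which is allowed after \<open>B j1\<close>. Hence \<open>B j1\<close>
    differs from \<open>B J\<close>, and every late remainder may follow \<open>B j1\<close>; but
    \<open>ev\<close> allows this for finitely many only.\<close>
  define j1 where "j1 = max n J"
  have "word (B j1) (V i)" if "i \<ge> n" for i
  proof (rule word_change[OF V(1)])
    have "B j1 \<noteq> B J"
      using hd[of j1] V(1)[of j1] by (cases "V j1") (auto simp: j1_def)
    then show "V i = [] \<or> B j1 \<noteq> Some (lab (hd (V i)))" using hd[OF that] by auto
  qed
  moreover obtain n1 where "\<forall>i\<ge>n1. \<not> word (B j1) (V i)" using ev[of j1] by (auto simp: j1_def)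
  ultimately show False using max.cobounded1 max.cobounded2 by metis
qed

text \<open>Failure makes the start persistent, and \<open>persistent_step\<close> continues it
  forever. The threshold drops each time, but only by a convergent total.\<close>

lemma words_eventually_small:
  assumes "\<epsilon> > 0"
  shows "\<exists>t. \<forall>w. word None w \<and> word_cost w \<ge> t \<longrightarrow> norm (act w x) \<le> \<epsilon>"
proof (rule ccontr)
  assume "\<not> ?thesis"
  then have start: "persistent None x \<epsilon>"
    unfolding persistent_def by (metis linorder_not_le order_less_imp_le)
  obtain C where C: "C \<ge> 1" "\<And>w x. word None w \<Longrightarrow> norm (act w x) \<le> C * norm x"
    using bounded_words by blast
  \<comment> \<open>The losses \<open>\<epsilon> / 2 ^ (n + 2)\<close> add up to
    \<open>\<epsilon> / 2\<close>, so the threshold starts at \<open>\<epsilon>\<close> and never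
    falls below \<open>\<epsilon> / 2\<close>.\<close>
  define r where "r n = \<epsilon> / 2 + \<epsilon> / 2 ^ (n + 1)" for n
  show False
  proof (rule no_persistent_chain[of "\<lambda>n k x. persistent k x (r n)" None x "\<epsilon> / (2 * C)"])
    show "persistent None x (r 0)" using start by (simp add: r_def)
    show "\<epsilon> / (2 * C) > 0" using \<open>\<epsilon> > 0\<close> C(1) by simp
    show "\<epsilon> / (2 * C) \<le> norm x" if p: "persistent k x (r n)" for n k x
    proof -
      obtain w where w: "word k w" "norm (act w x) \<ge> r n" using p unfolding persistent_def by blast
      have "\<epsilon> / 2 \<le> r n" using \<open>\<epsilon> > 0\<close> by (simp add: r_def)
      also have "\<dots> \<le> C * norm x" using w(2) C(2)[OF word_None[OF w(1)], of x] by simp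
      finally show ?thesis using C(1) by (simp add: field_simps)
    qed
    show "\<exists>u. word k u \<and> 1 \<le> word_cost u \<and> persistent (end_label k u) (act u x) (r (Suc n))"
      if "persistent k x (r n)" for n k x
    proof -
      have "r (Suc n) = r n - \<epsilon> / 2 ^ (n + 2)" by (simp add: r_def field_simps)
      then show ?thesis using persistent_step[OF C that, of "\<epsilon> / 2 ^ (n + 2)"] \<open>\<epsilon> > 0\<close> by simp
    qed
  qed
qed

theorem words_decay:
  obtains C b where "C \<ge> 1" "b > 0"
    "\<And>w x. word None w \<Longrightarrow> norm (act w x) \<le> C * exp (- b * word_cost w) * norm x"
proof -
  obtain C where C: "C \<ge> 1" "\<And>w x. word None w \<Longrightarrow> norm (act w x) \<le> C * norm x"
    using bounded_words by blast
  \<comment> \<open>Smallness is known vector by vector only; images of size \<open>d\<close> for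
    all basis vectors give operator norm at most one half.\<close>
  define d where "d = 1 / (2 * real DIM('a))"
  have "d > 0" by (simp add: d_def)
  from words_eventually_small[OF this]
  obtain t where t: "\<And>x w. \<lbrakk>word None w; word_cost w \<ge> t x\<rbrakk> \<Longrightarrow> norm (act w x) \<le> d" by metis
  define \<tau> where "\<tau> = Max (insert 1 (t ` Basis))"
  have \<tau>: "\<tau> \<ge> 1" "\<And>b. b \<in> Basis \<Longrightarrow> t b \<le> \<tau>"
    unfolding \<tau>_def by (intro Max_ge; simp)+
  have half: "norm (act w x) \<le> 1 / 2 * norm x" if "word None w" "word_cost w \<ge> \<tau>" for w x
  proof -
    have "norm (act w x) \<le> real DIM('a) * d * norm x"
      using t[OF that(1)] \<tau>(2) that(2) by (intro norm_le_sum_Basis act_linear[OF that(1)]) force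
    then show ?thesis by (simp add: d_def)
  qed
  \<comment> \<open>A halving prefix costs between \<open>\<tau>\<close> and
    \<open>\<tau> + 1\<close>, the overshoot coming from \<open>word_split\<close>; the rate is
    spread over the larger value.\<close>
  define b where "b = ln 2 / (\<tau> + 1)"
  have "b > 0" using \<tau>(1) by (simp add: b_def)
  have expb: "exp (b * s) \<le> 2" if "s \<le> \<tau> + 1" for s
  proof -
    have "b * s \<le> b * (\<tau> + 1)" using that \<open>b > 0\<close> by simp
    also have "\<dots> = ln 2" using \<tau>(1) by (simp add: b_def)
    finally have "exp (b * s) \<le> exp (ln (2 :: real))" by (simp only: exp_le_cancel_iff)
    then show ?thesis by simp
  qed
  have main: "norm (act w x) \<le> 2 * C * exp (- b * word_cost w) * norm x" if "word None w" for w x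
    using that
  proof (induction "length w" arbitrary: w x rule: less_induct)
    case less
    show ?case
    proof (cases "word_cost w \<le> \<tau> + 1")
      case True
      have "1 \<le> 2 * exp (- b * word_cost w)" using expb[OF True] by (simp add: exp_minus field_simps)
      then have "C * norm x * 1 \<le> C * norm x * (2 * exp (- b * word_cost w))"
        using C(1) by (intro mult_left_mono) auto
      then show ?thesis using C(2)[OF less.prems, of x] by (simp add: mult_ac)
    next
      case False
      obtain u v where uv: "w = u @ v" "\<tau> \<le> word_cost u" "word_cost u \<le> \<tau> + 1"
        by (rule word_split[OF less.prems, of \<tau>]) (use \<tau>(1) False in auto)
      have wuv: "word None u" "word None v"
        using less.prems uv(1) by (auto simp: word_append intro: word_None)
      have "u \<noteq> []" using uv(2) \<tau>(1) by auto
      then have "norm (act v (act u x)) \<le> 2 * C * exp (- b * word_cost v) * norm (act u x)"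
        using uv(1) by (intro less.hyps wuv) simp
      also have "\<dots> \<le> 2 * C * exp (- b * word_cost v) * (1 / 2 * norm x)"
        using half[OF wuv(1) uv(2)] C(1) by (intro mult_left_mono) auto
      also have "\<dots> = C * exp (- b * word_cost w) * exp (b * word_cost u) * norm x"
      proof -
        have "exp (- b * word_cost v) = exp (- b * word_cost w) * exp (b * word_cost u)"
          unfolding uv(1) by (subst exp_add[symmetric]) (simp add: algebra_simps)
        then show ?thesis by simp
      qed
      also have "\<dots> \<le> C * exp (- b * word_cost w) * 2 * norm x"
        using expb[OF uv(3)] C(1) by (intro mult_right_mono mult_left_mono) auto
      finally show ?thesis by (simp add: uv(1) mult_ac)
    qed
  qed
  show ?thesis by (rule that[OF _ \<open>b > 0\<close> main]) (use C(1) in auto)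
qed

end

section \<open>Norms adapted to the decay along words\<close>

context labelled_words
begin

definition word_norm :: "real \<Rightarrow> 'k option \<Rightarrow> 'a \<Rightarrow> real" where
  "word_norm b k x = (SUP w\<in>{w. word k w}. exp (b * word_cost w) * norm (act w x))"

context
  fixes b C :: real
  assumes decay: "\<And>w x. word None w \<Longrightarrow> norm (act w x) \<le> C * exp (- b * word_cost w) * norm x"
begin

lemma weighted_act_le:
  assumes "word k w"
  shows "exp (b * word_cost w) * norm (act w x) \<le> C * norm x"
proof -
  have "exp (b * word_cost w) * norm (act w x) \<le> exp (b * word_cost w) * (C * exp (- b * word_cost w) * norm x)"
    by (intro mult_left_mono decay word_None[OF assms]) auto
  also have "\<dots> = C * norm x" by (simp add: exp_minus field_simps)
  finally show ?thesis .
qed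

lemma word_norm_upper: "word k w \<Longrightarrow> exp (b * word_cost w) * norm (act w x) \<le> word_norm b k x"
  unfolding word_norm_def
  by (rule cSUP_upper) (auto intro!: bdd_aboveI2[where M = "C * norm x"] weighted_act_le)

lemma word_norm_least:
  assumes "\<And>w. word k w \<Longrightarrow> exp (b * word_cost w) * norm (act w x) \<le> B"
  shows "word_norm b k x \<le> B"
  unfolding word_norm_def using assms by (intro cSUP_least) (auto intro: exI[of _ "[]"])

lemma norm_le_word_norm: "norm x \<le> word_norm b k x"
  using word_norm_upper[of k "[]" x] by simp

lemma word_norm_le: "word_norm b k x \<le> C * norm x"
  by (intro word_norm_least weighted_act_le)

lemma word_norm_add: "word_norm b k (x + y) \<le> word_norm b k x + word_norm b k y"
proof (rule word_norm_least)
  fix w assume w: "word k w"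
  have "exp (b * word_cost w) * norm (act w (x + y)) \<le> exp (b * word_cost w) * (norm (act w x) + norm (act w y))"
    by (intro mult_left_mono) (auto simp: linear_add[OF act_linear[OF w]] norm_triangle_ineq)
  also have "\<dots> \<le> word_norm b k x + word_norm b k y"
    using word_norm_upper[OF w, of x] word_norm_upper[OF w, of y] by (simp add: distrib_left)
  finally show "exp (b * word_cost w) * norm (act w (x + y)) \<le> word_norm b k x + word_norm b k y" .
qed

lemma word_norm_scaleR: "word_norm b k (r *\<^sub>R x) \<le> \<bar>r\<bar> * word_norm b k x"
proof (rule word_norm_least)
  fix w assume w: "word k w"
  have "exp (b * word_cost w) * norm (act w (r *\<^sub>R x)) = \<bar>r\<bar> * (exp (b * word_cost w) * norm (act w x))"
    by (simp add: linear_scale[OF act_linear[OF w]])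
  also have "\<dots> \<le> \<bar>r\<bar> * word_norm b k x"
    by (intro mult_left_mono word_norm_upper[OF w]) auto
  finally show "exp (b * word_cost w) * norm (act w (r *\<^sub>R x)) \<le> \<bar>r\<bar> * word_norm b k x" .
qed

text \<open>A continuation after \<open>l\<close> becomes, with \<open>l\<close> prefixed, a
  continuation from \<open>k\<close>; their costs differ exactly by that of \<open>l\<close>. This
  contraction is what the exponential weight is for.\<close>

lemma word_norm_op:
  assumes l: "l \<in> E" "k \<noteq> Some (lab l)"
  shows "word_norm b (Some (lab l)) (op l x) \<le> exp (- b * cost l) * word_norm b k x"
proof (rule word_norm_least)
  fix w assume w: "word (Some (lab l)) w"
  have "exp (b * word_cost w) * norm (act w (op l x)) =
      exp (- b * cost l) * (exp (b * word_cost (l # w)) * norm (act (l # w) x))"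
  proof -
    have "exp (b * word_cost w) = exp (- b * cost l) * exp (b * word_cost (l # w))"
      by (subst exp_add[symmetric]) (simp add: algebra_simps)
    then show ?thesis by simp
  qed
  also have "\<dots> \<le> exp (- b * cost l) * word_norm b k x"
    using l w by (intro mult_left_mono word_norm_upper) auto
  finally show "exp (b * word_cost w) * norm (act w (op l x)) \<le> exp (- b * cost l) * word_norm b k x" .
qed

end

end

section \<open>Contraction along arbitrarily long intervals\<close>

text \<open>Telescoping: each step adds an error \<open>D\<close> transported by a flow bounded by
  \<open>C\<close>, and since \<open>\<bar>\<nu>\<bar> \<le> 1\<close> the old errors do not
  grow.\<close>

lemma near_eigenvector_iterate:
  fixes A :: "real^'n^'n"
  assumes decay: "\<And>t x. t \<ge> 0 \<Longrightarrow> norm (mat_exp (t *\<^sub>R A) *v x) \<le> C * norm x"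
    and "\<bar>\<nu>\<bar> \<le> 1" "u \<ge> 0" "norm (mat_exp (u *\<^sub>R A) *v y - \<nu> *\<^sub>R y) \<le> D"
    and "C \<ge> 0"
  shows "norm (mat_exp ((real k * u) *\<^sub>R A) *v y - \<nu> ^ k *\<^sub>R y) \<le> real k * C * D"
proof (induction k)
  case (Suc k)
  let ?E = "\<lambda>t x. mat_exp (t *\<^sub>R A) *v x"
  have "D \<ge> 0" using assms(4) norm_ge_zero order_trans by blast
  have "?E (real (Suc k) * u) y = ?E (real k * u) (?E u y)"
    using mat_exp_add_apply[of "real k * u" u A y] \<open>u \<ge> 0\<close> by (simp add: algebra_simps)
  then have "?E (real (Suc k) * u) y - \<nu> ^ Suc k *\<^sub>R y =
      ?E (real k * u) (?E u y - \<nu> *\<^sub>R y) + \<nu> *\<^sub>R (?E (real k * u) y - \<nu> ^ k *\<^sub>R y)"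
    by (simp add: matrix_vector_mult_diff_distrib scaleR_diff_right
        bounded_bilinear.scaleR_right[OF bounded_bilinear_matrix_vector_mult])
  also have "norm \<dots> \<le> C * D + 1 * (real k * C * D)"
  proof (rule norm_triangle_mono)
    have "norm (?E (real k * u) (?E u y - \<nu> *\<^sub>R y)) \<le> C * norm (?E u y - \<nu> *\<^sub>R y)"
      using \<open>u \<ge> 0\<close> by (intro decay) auto
    also have "\<dots> \<le> C * D" by (intro mult_left_mono assms)
    finally show "norm (?E (real k * u) (?E u y - \<nu> *\<^sub>R y)) \<le> C * D" .
    show "norm (\<nu> *\<^sub>R (?E (real k * u) y - \<nu> ^ k *\<^sub>R y)) \<le> 1 * (real k * C * D)"
      unfolding norm_scaleR using Suc.IH \<open>\<bar>\<nu>\<bar> \<le> 1\<close> by (intro mult_mono) auto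
  qed
  finally show ?case by (simp add: algebra_simps)
qed simp

text \<open>If \<open>e\<^sup>u\<^sup>A y\<close> were almost as large as \<open>\<kappa>\<close>, then the convex combination representing it would be
  concentrated near \<open>s = 0\<close>, so \<open>y\<close> would be nearly an eigenvector with eigenvalue \<open>\<nu>\<close>
  close to \<open>1\<close> in modulus. This contradicts the decay of \<open>e\<^sup>t\<^sup>A\<close>.\<close>

lemma uniform_contraction:
  fixes C C0 C1 b0 \<beta> :: real
  assumes "C \<ge> 1" "C0 \<ge> 1" "C1 \<ge> 0" "b0 > 0" "0 < \<beta>" "\<beta> \<le> 1"
  obtains c where "c > 0" "c \<le> \<beta>"
    "\<And>(A :: real^'n^'n) N m u T y \<kappa>.
      \<lbrakk>\<And>x z. N (x + z) \<le> N x + N z; \<And>r x. N (r *\<^sub>R x) \<le> \<bar>r\<bar> * N x;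
       \<And>x. norm x \<le> N x; \<And>x. N x \<le> C * norm x;
       \<And>t x. t \<ge> 0 \<Longrightarrow> norm (mat_exp (t *\<^sub>R A) *v x) \<le> C0 * exp (- b0 * t) * norm x;
       \<And>t x. t \<ge> 0 \<Longrightarrow> norm (mat_exp (t *\<^sub>R A) *v x - x) \<le> C1 * min t 1 * norm x;
       mat_exp (u *\<^sub>R A) \<in> convex hull ((\<lambda>t. mat_exp (t *\<^sub>R A)) ` {0..T} \<union> uminus ` (\<lambda>t. mat_exp (t *\<^sub>R A)) ` {0..T});
       u > 0; m > 0; T \<ge> 0; \<kappa> \<ge> 0;
       \<And>s. \<lbrakk>0 \<le> s; s \<le> T\<rbrakk> \<Longrightarrow> N (mat_exp (s *\<^sub>R A) *v y) \<le> (1 - \<beta> * min (m + s) 1) * \<kappa>\<rbrakk>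
      \<Longrightarrow> N (mat_exp (u *\<^sub>R A) *v y) \<le> (1 - c * min (m + u) 1) * \<kappa>"
proof -
  \<comment> \<open>A time after which the flow has shrunk every vector to at most a quarter; a near
    eigenvector with \<open>\<nu>\<close> too close to 1 in modulus could not shrink that
    much.\<close>
  define \<tau> where "\<tau> = max 1 (ln (4 * C0) / b0)"
  have "\<tau> \<ge> 1" by (simp add: \<tau>_def)
  have \<tau>: "C0 * exp (- b0 * t) \<le> 1 / 4" if "t \<ge> \<tau>" for t
  proof -
    have "ln (4 * C0) / b0 \<le> t" using that by (simp add: \<tau>_def)
    then have "ln (4 * C0) \<le> b0 * t" using assms by (simp add: field_simps)
    then have "exp (ln (4 * C0)) \<le> exp (b0 * t)" by (simp only: exp_le_cancel_iff)
    then have "4 * C0 \<le> exp (b0 * t)" using assms by simp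
    then show ?thesis by (simp add: exp_minus field_simps)
  qed
  \<comment> \<open>Threshold for \<open>\<theta>\<close> below which \<open>y\<close> counts as a
    near eigenvector. The denominator keeps three errors small: \<open>c'1\<close> after iterating
    up to time \<open>\<tau>\<close>, \<open>c'2\<close> against the gap of \<open>\<nu>\<close>,
    \<open>c'3\<close> for short \<open>y\<close>.\<close>
  define c' where "c' = 1 / (16 * \<tau> * C0 * C * (C1 + 1))"
  have pos: "16 * \<tau> * C0 * C * (C1 + 1) > 0" using \<open>\<tau> \<ge> 1\<close> assms by simp
  have "c' > 0" using pos by (simp add: c'_def)
  have c'1: "16 * \<tau> * C0 * C * C1 * c' \<le> 1"
  proof -
    have "16 * \<tau> * C0 * C * C1 * c' \<le> 16 * \<tau> * C0 * C * (C1 + 1) * c'"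
      using \<open>c' > 0\<close> \<open>\<tau> \<ge> 1\<close> assms by (intro mult_right_mono mult_left_mono) auto
    also have "\<dots> = 1" using \<open>\<tau> \<ge> 1\<close> assms by (auto simp: c'_def)
    finally show ?thesis .
  qed
  have c'2: "16 * \<tau> * (C * C1 * c') \<le> 1"
  proof -
    have "1 * (16 * \<tau> * (C * C1 * c')) \<le> C0 * (16 * \<tau> * (C * C1 * c'))"
      using \<open>c' > 0\<close> \<open>\<tau> \<ge> 1\<close> assms by (intro mult_right_mono) auto
    then show ?thesis using c'1 by (simp add: mult_ac)
  qed
  have c'3: "C * C1 * c' \<le> 1 / 4"
  proof -
    have "1 * (C * C1 * c') \<le> \<tau> * (C * C1 * c')"
      using \<open>c' > 0\<close> \<open>\<tau> \<ge> 1\<close> assms by (intro mult_right_mono) auto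
    then show ?thesis using c'2 by simp
  qed
  \<comment> \<open>One term per use: \<open>\<beta> * c'\<close> when \<open>\<theta>\<close> is
    large, \<open>1 / (8 * \<tau>)\<close> from the gap between 1 and the modulus of
    \<open>\<nu>\<close>, \<open>\<beta>\<close> for the bound in \<open>m\<close> alone.\<close>
  define c2 where "c2 = min \<beta> (min (\<beta> * c') (1 / (8 * \<tau>)))"
  have c2: "c2 > 0" "c2 \<le> \<beta>" "c2 \<le> \<beta> * c'" "c2 \<le> 1 / (8 * \<tau>)"
    using \<open>c' > 0\<close> \<open>\<tau> \<ge> 1\<close> assms by (simp_all add: c2_def)
  have "1 / (8 * \<tau>) \<le> 1 / 4" using \<open>\<tau> \<ge> 1\<close> by (simp add: field_simps)
  then have c2_quarter: "c2 \<le> 1 / 4" using c2(4) by simp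
  show ?thesis
  proof (rule that[of "c2 / 2"])
    fix A :: "real^'n^'n" and N m u T y \<kappa>
    assume N_add: "\<And>x z. N (x + z) \<le> N x + N z" and N_scale: "\<And>r x. N (r *\<^sub>R x) \<le> \<bar>r\<bar> * N x"
      and N_ge: "\<And>x. norm x \<le> N x" and N_le: "\<And>x. N x \<le> C * norm x"
      and decay: "\<And>t x. t \<ge> 0 \<Longrightarrow> norm (mat_exp (t *\<^sub>R A) *v x) \<le> C0 * exp (- b0 * t) * norm x"
      and drift: "\<And>t x. t \<ge> 0 \<Longrightarrow> norm (mat_exp (t *\<^sub>R A) *v x - x) \<le> C1 * min t 1 * norm x"
      and hull: "mat_exp (u *\<^sub>R A) \<in> convex hull ((\<lambda>t. mat_exp (t *\<^sub>R A)) ` {0..T} \<union> uminus ` (\<lambda>t. mat_exp (t *\<^sub>R A)) ` {0..T})"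
      and "u > 0" "m > 0" "T \<ge> 0" "\<kappa> \<ge> 0"
      and N\<kappa>: "\<And>s. \<lbrakk>0 \<le> s; s \<le> T\<rbrakk> \<Longrightarrow> N (mat_exp (s *\<^sub>R A) *v y) \<le> (1 - \<beta> * min (m + s) 1) * \<kappa>"
    have N_minus: "N (- x) \<le> N x" for x using N_scale[of "-1" x] by simp
    have "N y \<le> (1 - \<beta> * min m 1) * \<kappa>" using N\<kappa>[of 0] \<open>T \<ge> 0\<close> by simp
    also have "\<dots> \<le> 1 * \<kappa>" using \<open>\<kappa> \<ge> 0\<close> \<open>m > 0\<close> assms by (intro mult_right_mono) auto
    finally have Ny: "N y \<le> \<kappa>" by simp
    \<comment> \<open>For a point of the hull, \<open>\<nu>\<close> is the mean of the signs and
      \<open>\<theta>\<close> the mean of \<open>min (m + s) 1\<close> over its combination. All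
      conditions survive mixing, so \<open>Y\<close> is convex and only the generators have to be
      checked.\<close>
    define Y where "Y = {M :: real^'n^'n. \<exists>\<nu> \<theta>. min m 1 \<le> \<theta> \<and> \<bar>\<nu>\<bar> \<le> 1 \<and> norm (M *v y - \<nu> *\<^sub>R y) \<le> C1 * \<theta> * \<kappa> \<and>
      N (M *v y) \<le> (1 - \<beta> * \<theta>) * \<kappa>}"
    have "mat_exp (u *\<^sub>R A) \<in> Y"
    proof (rule subsetD[OF hull_minimal hull])
      have "mat_exp (s *\<^sub>R A) \<in> Y \<and> - mat_exp (s *\<^sub>R A) \<in> Y" if s: "0 \<le> s" "s \<le> T" for s
      proof -
        have "norm (mat_exp (s *\<^sub>R A) *v y - y) \<le> C1 * min s 1 * norm y" by (rule drift) fact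
        also have "\<dots> \<le> C1 * min (m + s) 1 * \<kappa>"
          using \<open>m > 0\<close> s assms Ny N_ge[of y] by (intro mult_mono) auto
        finally have d: "norm (mat_exp (s *\<^sub>R A) *v y - y) \<le> C1 * min (m + s) 1 * \<kappa>" .
        have n: "N (mat_exp (s *\<^sub>R A) *v y) \<le> (1 - \<beta> * min (m + s) 1) * \<kappa>" by (rule N\<kappa>[OF s])
        have min: "min m 1 \<le> min (m + s) 1" using s by auto
        have "mat_exp (s *\<^sub>R A) \<in> Y"
          unfolding Y_def using d n min by (intro CollectI exI[of _ 1] exI[of _ "min (m + s) 1"]) simp
        moreover have "- mat_exp (s *\<^sub>R A) \<in> Y"
          unfolding Y_def using d order_trans[OF N_minus n] min
          by (intro CollectI exI[of _ "-1"] exI[of _ "min (m + s) 1"])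
            (simp add: bounded_bilinear.minus_left[OF bounded_bilinear_matrix_vector_mult] norm_minus_commute)
        ultimately show ?thesis by blast
      qed
      then show "(\<lambda>t. mat_exp (t *\<^sub>R A)) ` {0..T} \<union> uminus ` (\<lambda>t. mat_exp (t *\<^sub>R A)) ` {0..T} \<subseteq> Y"
        by auto
      show "convex Y"
      proof (rule convexI)
        fix M M' and p q :: real
        assume MM': "M \<in> Y" "M' \<in> Y" and pq: "0 \<le> p" "0 \<le> q" "p + q = 1"
        obtain \<nu> \<theta> where 1: "min m 1 \<le> \<theta>" "\<bar>\<nu>\<bar> \<le> 1" "norm (M *v y - \<nu> *\<^sub>R y) \<le> C1 * \<theta> * \<kappa>"
          "N (M *v y) \<le> (1 - \<beta> * \<theta>) * \<kappa>" using MM'(1) by (auto simp: Y_def)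
        obtain \<nu>' \<theta>' where 2: "min m 1 \<le> \<theta>'" "\<bar>\<nu>'\<bar> \<le> 1" "norm (M' *v y - \<nu>' *\<^sub>R y) \<le> C1 * \<theta>' * \<kappa>"
          "N (M' *v y) \<le> (1 - \<beta> * \<theta>') * \<kappa>" using MM'(2) by (auto simp: Y_def)
        have eq: "(p *\<^sub>R M + q *\<^sub>R M') *v y = p *\<^sub>R (M *v y) + q *\<^sub>R (M' *v y)"
          by (simp add: matrix_vector_mult_add_rdistrib scaleR_matrix_vector_assoc[symmetric])
        have a: "min m 1 \<le> p * \<theta> + q * \<theta>'"
        proof -
          have "min m 1 = p * min m 1 + q * min m 1" using pq(3) by (metis distrib_right mult_1)
          also have "\<dots> \<le> p * \<theta> + q * \<theta>'" using 1 2 pq by (intro add_mono mult_left_mono) auto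
          finally show ?thesis .
        qed
        have b: "\<bar>p * \<nu> + q * \<nu>'\<bar> \<le> 1"
        proof -
          have "\<bar>p * \<nu> + q * \<nu>'\<bar> \<le> \<bar>p * \<nu>\<bar> + \<bar>q * \<nu>'\<bar>" by (rule abs_triangle_ineq)
          also have "\<dots> \<le> p * 1 + q * 1" unfolding abs_mult using 1 2 pq by (intro add_mono mult_mono) auto
          finally show ?thesis using pq by simp
        qed
        have c: "norm ((p *\<^sub>R M + q *\<^sub>R M') *v y - (p * \<nu> + q * \<nu>') *\<^sub>R y) \<le> C1 * (p * \<theta> + q * \<theta>') * \<kappa>"
        proof -
          have "(p *\<^sub>R M + q *\<^sub>R M') *v y - (p * \<nu> + q * \<nu>') *\<^sub>R y =
              p *\<^sub>R (M *v y - \<nu> *\<^sub>R y) + q *\<^sub>R (M' *v y - \<nu>' *\<^sub>R y)"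
            unfolding eq by (simp add: algebra_simps)
          also have "norm \<dots> \<le> p * (C1 * \<theta> * \<kappa>) + q * (C1 * \<theta>' * \<kappa>)"
            using 1 2 pq by (intro norm_triangle_mono) (auto intro: mult_left_mono)
          finally show ?thesis by (simp add: algebra_simps)
        qed
        have d: "N ((p *\<^sub>R M + q *\<^sub>R M') *v y) \<le> (1 - \<beta> * (p * \<theta> + q * \<theta>')) * \<kappa>"
        proof -
          have "N ((p *\<^sub>R M + q *\<^sub>R M') *v y) \<le> N (p *\<^sub>R (M *v y)) + N (q *\<^sub>R (M' *v y))"
            unfolding eq by (rule N_add)
          also have "\<dots> \<le> p * N (M *v y) + q * N (M' *v y)"
            using N_scale[of p "M *v y"] N_scale[of q "M' *v y"] pq by simp
          also have "\<dots> \<le> p * ((1 - \<beta> * \<theta>) * \<kappa>) + q * ((1 - \<beta> * \<theta>') * \<kappa>)"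
            using 1 2 pq by (intro add_mono mult_left_mono) auto
          also have "\<dots> = (p + q - \<beta> * (p * \<theta> + q * \<theta>')) * \<kappa>" by (simp add: algebra_simps)
          finally show ?thesis using pq by simp
        qed
        show "p *\<^sub>R M + q *\<^sub>R M' \<in> Y" unfolding Y_def using a b c d by blast
      qed
    qed
    then obtain \<nu> \<theta> where \<theta>m: "min m 1 \<le> \<theta>" and \<nu>1: "\<bar>\<nu>\<bar> \<le> 1"
      and near: "norm (mat_exp (u *\<^sub>R A) *v y - \<nu> *\<^sub>R y) \<le> C1 * \<theta> * \<kappa>"
      and N\<theta>: "N (mat_exp (u *\<^sub>R A) *v y) \<le> (1 - \<beta> * \<theta>) * \<kappa>" by (auto simp: Y_def)
    have "\<theta> \<ge> 0" using \<theta>m \<open>m > 0\<close> by auto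
    define \<mu> where "\<mu> = min u 1"
    have \<mu>: "0 < \<mu>" "\<mu> \<le> 1" "\<mu> \<le> u" using \<open>u > 0\<close> by (auto simp: \<mu>_def)
    have weaken: "(1 - r) * \<kappa> \<le> (1 - c2 * \<mu>) * \<kappa>" if "c2 * \<mu> \<le> r" for r
      using that \<open>\<kappa> \<ge> 0\<close> by (intro mult_right_mono) auto
    have Nu: "N (mat_exp (u *\<^sub>R A) *v y) \<le> \<bar>\<nu>\<bar> * N y + C * C1 * \<theta> * \<kappa>"
    proof -
      have "N (mat_exp (u *\<^sub>R A) *v y) = N (\<nu> *\<^sub>R y + (mat_exp (u *\<^sub>R A) *v y - \<nu> *\<^sub>R y))" by simp
      also have "\<dots> \<le> N (\<nu> *\<^sub>R y) + N (mat_exp (u *\<^sub>R A) *v y - \<nu> *\<^sub>R y)" by (rule N_add)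
      also have "\<dots> \<le> \<bar>\<nu>\<bar> * N y + C * (C1 * \<theta> * \<kappa>)"
      proof (rule add_mono[OF N_scale])
        have "N (mat_exp (u *\<^sub>R A) *v y - \<nu> *\<^sub>R y) \<le> C * norm (mat_exp (u *\<^sub>R A) *v y - \<nu> *\<^sub>R y)" by (rule N_le)
        also have "\<dots> \<le> C * (C1 * \<theta> * \<kappa>)" using near assms by (intro mult_left_mono) auto
        finally show "N (mat_exp (u *\<^sub>R A) *v y - \<nu> *\<^sub>R y) \<le> C * (C1 * \<theta> * \<kappa>)" .
      qed
      finally show ?thesis by (simp add: mult_ac)
    qed
    have main: "N (mat_exp (u *\<^sub>R A) *v y) \<le> (1 - c2 * \<mu>) * \<kappa>"
    \<comment> \<open>Large \<open>\<theta>\<close>: the combination uses lengths long enough to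
      contract by themselves. Small \<open>\<theta>\<close>: it is concentrated on short lengths, so
      \<open>e^(uA) y\<close> is close to \<open>\<nu> y\<close>.\<close>
    proof (cases "\<theta> \<ge> c' * \<mu>")
      case True
      have "c2 * \<mu> \<le> \<beta> * c' * \<mu>" using c2 \<mu> by (intro mult_right_mono) auto
      also have "\<dots> \<le> \<beta> * \<theta>" using True assms by (simp add: mult.assoc mult_left_mono)
      finally show ?thesis using N\<theta> weaken by fastforce
    next
      case False
      then have \<theta>: "\<theta> \<le> c' * \<mu>" by simp
      have err: "C * C1 * \<theta> \<le> C * C1 * c' * \<mu>"
        using \<theta> assms by (simp add: mult.assoc mult_left_mono)
      show ?thesis
      \<comment> \<open>If \<open>y\<close> is short compared to \<open>\<kappa>\<close>,
        equivalence of the norms gives \<open>N y \<le> \<kappa> / 2\<close>, with room for the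
        error. Otherwise errors measured in \<open>\<kappa>\<close> become relative errors on
        \<open>y\<close>.\<close>
      proof (cases "norm y < \<kappa> / (2 * C)")
        case True
        have "\<bar>\<nu>\<bar> * N y \<le> 1 * (C * norm y)"
          using \<nu>1 N_le[of y] order_trans[OF norm_ge_zero N_ge[of y]] by (intro mult_mono) auto
        also have "\<dots> \<le> 1 / 2 * \<kappa>" using True assms by (simp add: field_simps)
        finally have l: "\<bar>\<nu>\<bar> * N y \<le> 1 / 2 * \<kappa>" .
        have "C * C1 * c' * \<mu> \<le> 1 / 4 * 1"
          using c'3 \<mu> by (intro mult_mono) auto
        then have "C * C1 * \<theta> * \<kappa> \<le> 1 / 4 * \<kappa>"
          using err \<open>\<kappa> \<ge> 0\<close> by (intro mult_right_mono) auto
        then have "N (mat_exp (u *\<^sub>R A) *v y) \<le> (1 - 1 / 4) * \<kappa>"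
          using Nu l by (simp add: algebra_simps)
        moreover have "c2 * \<mu> \<le> 1 / 4 * 1" using c2_quarter \<mu> by (intro mult_mono) auto
        ultimately show ?thesis using weaken[of "1 / 4"] by simp
      next
        case False
        then have y\<kappa>: "\<kappa> \<le> 2 * C * norm y" using assms by (simp add: field_simps)
        show ?thesis
        proof (cases "y = 0")
          case True
          then have "\<kappa> = 0" using y\<kappa> \<open>\<kappa> \<ge> 0\<close> by simp
          then show ?thesis using N\<theta> by simp
        next
          case False
          \<comment> \<open>Enough applications of \<open>e^(uA)\<close> to reach time
            \<open>\<tau>\<close>, yet so few that the accumulated error, proportional to
            \<open>k * \<mu>\<close>, stays within a multiple of \<open>\<tau>\<close> even for tiny
            \<open>u\<close>.\<close>
          define k where "k = nat \<lceil>\<tau> / u\<rceil>"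
          have "\<tau> / u > 0" using \<open>\<tau> \<ge> 1\<close> \<open>u > 0\<close> by simp
          then have k: "\<tau> / u \<le> real k" "real k \<le> \<tau> / u + 1" by (auto simp: k_def)
          have "k > 0" using k(1) \<open>\<tau> / u > 0\<close> by (cases k) auto
          have ku: "\<tau> \<le> real k * u" using k(1) \<open>u > 0\<close> by (simp add: field_simps)
          have k\<mu>: "real k * \<mu> \<le> 2 * \<tau>"
          proof -
            have "real k * \<mu> \<le> (\<tau> / u + 1) * \<mu>" using k(2) \<mu> by (intro mult_right_mono) auto
            also have "\<dots> = \<tau> * (\<mu> / u) + \<mu>" by (simp add: field_simps)
            also have "\<dots> \<le> \<tau> * 1 + \<tau>"
              using \<mu> \<open>u > 0\<close> \<open>\<tau> \<ge> 1\<close> by (intro add_mono mult_left_mono) auto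
            finally show ?thesis by simp
          qed
          have "norm (mat_exp ((real k * u) *\<^sub>R A) *v y - \<nu> ^ k *\<^sub>R y) \<le> real k * C0 * (C1 * \<theta> * \<kappa>)"
          proof (rule near_eigenvector_iterate[OF _ \<nu>1 _ near])
            fix t :: real and x :: "real^'n" assume "t \<ge> 0"
            have "C0 * exp (- b0 * t) * norm x \<le> C0 * 1 * norm x"
              using \<open>t \<ge> 0\<close> assms by (intro mult_right_mono mult_left_mono) auto
            then show "norm (mat_exp (t *\<^sub>R A) *v x) \<le> C0 * norm x" using decay[OF \<open>t \<ge> 0\<close>, of x] by simp
          qed (use \<open>u > 0\<close> assms in auto)
          also have "\<dots> \<le> real k * C0 * (C1 * (c' * \<mu>) * (2 * C * norm y))"
            using \<theta> y\<kappa> assms \<open>\<theta> \<ge> 0\<close> \<open>\<kappa> \<ge> 0\<close> by (intro mult_left_mono mult_mono) auto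
          also have "\<dots> = (real k * \<mu>) * (2 * (C0 * C1 * c' * C) * norm y)" by (simp add: mult_ac)
          also have "\<dots> \<le> (2 * \<tau>) * (2 * (C0 * C1 * c' * C) * norm y)"
            using k\<mu> assms \<open>c' > 0\<close> by (intro mult_right_mono) auto
          also have "\<dots> = (16 * \<tau> * C0 * C * C1 * c') * (1 / 4 * norm y)" by (simp add: mult_ac)
          also have "\<dots> \<le> 1 * (1 / 4 * norm y)" using c'1 by (intro mult_right_mono) auto
          finally have "norm (mat_exp ((real k * u) *\<^sub>R A) *v y - \<nu> ^ k *\<^sub>R y) \<le> 1 / 4 * norm y" by simp
          moreover have "norm (mat_exp ((real k * u) *\<^sub>R A) *v y) \<le> 1 / 4 * norm y"
          proof -
            have "norm (mat_exp ((real k * u) *\<^sub>R A) *v y) \<le> C0 * exp (- b0 * (real k * u)) * norm y"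
              using ku \<open>\<tau> \<ge> 1\<close> by (intro decay) auto
            also have "\<dots> \<le> 1 / 4 * norm y" using \<tau>[OF ku] by (intro mult_right_mono) auto
            finally show ?thesis .
          qed
          moreover have "norm (\<nu> ^ k *\<^sub>R y) \<le> norm (mat_exp ((real k * u) *\<^sub>R A) *v y) +
              norm (mat_exp ((real k * u) *\<^sub>R A) *v y - \<nu> ^ k *\<^sub>R y)"
            by (metis norm_minus_commute norm_triangle_sub)
          ultimately have "\<bar>\<nu>\<bar> ^ k * norm y \<le> 1 / 2 * norm y" by (simp add: power_abs)
          then have \<nu>k: "\<bar>\<nu>\<bar> ^ k \<le> 1 / 2" using False by simp
          \<comment> \<open>By Bernoulli, a \<open>\<nu>\<close> closer to 1 in modulus would keep
            its \<open>k\<close>-th power above one half.\<close>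
          have "\<bar>\<nu>\<bar> \<le> 1 - 1 / (2 * real k)"
          proof (rule ccontr)
            assume "\<not> ?thesis"
            then have "(1 - 1 / (2 * real k)) ^ k < \<bar>\<nu>\<bar> ^ k"
              using \<open>k > 0\<close> by (intro power_strict_mono) (auto simp: field_simps)
            moreover have "1 + real k * (- 1 / (2 * real k)) \<le> (1 + (- 1 / (2 * real k))) ^ k"
              using \<open>k > 0\<close> by (intro Bernoulli_inequality) (auto simp: field_simps)
            ultimately show False using \<nu>k \<open>k > 0\<close> by simp
          qed
          moreover have "\<mu> / (4 * \<tau>) \<le> 1 / (2 * real k)"
            using k\<mu> \<open>k > 0\<close> \<open>\<tau> \<ge> 1\<close> by (simp add: field_simps)
          ultimately have "\<bar>\<nu>\<bar> * N y \<le> (1 - \<mu> / (4 * \<tau>)) * \<kappa>"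
            using Ny order_trans[OF norm_ge_zero N_ge[of y]] by (intro mult_mono) auto
          moreover have "C * C1 * \<theta> * \<kappa> \<le> \<mu> / (8 * \<tau>) * \<kappa>"
          proof (rule mult_right_mono[OF order_trans[OF err] \<open>\<kappa> \<ge> 0\<close>])
            have "C * C1 * c' \<le> 1 / (8 * \<tau>)"
              using c'2 \<open>\<tau> \<ge> 1\<close> assms \<open>c' > 0\<close> by (simp add: field_simps)
            then show "C * C1 * c' * \<mu> \<le> \<mu> / (8 * \<tau>)"
              using mult_right_mono[of "C * C1 * c'" "1 / (8 * \<tau>)" \<mu>] \<mu> by simp
          qed
          ultimately have "N (mat_exp (u *\<^sub>R A) *v y) \<le> (1 - \<mu> / (4 * \<tau>)) * \<kappa> + \<mu> / (8 * \<tau>) * \<kappa>"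
            using Nu by linarith
          also have "\<dots> = (1 - \<mu> / (8 * \<tau>)) * \<kappa>" by (simp add: field_simps)
          also have "\<dots> \<le> (1 - c2 * \<mu>) * \<kappa>"
            using mult_right_mono[OF c2(4), of \<mu>] \<mu> by (intro weaken) simp
          finally show ?thesis .
        qed
      qed
    qed
    have "N (mat_exp (u *\<^sub>R A) *v y) \<le> (1 - c2 * min m 1) * \<kappa>"
    proof -
      have "c2 * min m 1 \<le> \<beta> * \<theta>" using c2 \<theta>m \<open>m > 0\<close> assms by (intro mult_mono) auto
      then have "(1 - \<beta> * \<theta>) * \<kappa> \<le> (1 - c2 * min m 1) * \<kappa>" using \<open>\<kappa> \<ge> 0\<close> by (intro mult_right_mono) auto
      then show ?thesis using N\<theta> by simp
    qed
    \<comment> \<open>Averaging the bounds in \<open>min m 1\<close> and in \<open>\<mu>\<close>: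
      their sum dominates \<open>min (m + u) 1\<close>, at the cost of a factor 2 in the final
      constant.\<close>
    then have "2 * N (mat_exp (u *\<^sub>R A) *v y) \<le> (2 - c2 * (min m 1 + \<mu>)) * \<kappa>"
      using main by (simp add: algebra_simps)
    also have "\<dots> \<le> (2 - c2 * min (m + u) 1) * \<kappa>"
      using \<open>\<kappa> \<ge> 0\<close> c2(1) \<open>m > 0\<close> \<open>u > 0\<close>
      by (intro mult_right_mono diff_left_mono mult_left_mono) (auto simp: \<mu>_def)
    finally show "N (mat_exp (u *\<^sub>R A) *v y) \<le> (1 - c2 / 2 * min (m + u) 1) * \<kappa>"
      by (simp add: algebra_simps)
  qed (use c2 in auto)
qed

section \<open>Switching laws\<close>

lemma piecewise_constant_right:
  assumes "piecewise_constant L" "t \<ge> 0"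
  shows "\<exists>e>0. \<forall>u. t \<le> u \<and> u < t + e \<longrightarrow> L u = L t"
proof -
  obtain P where P: "\<And>T. finite (P \<inter> {0..T})"
    "\<And>s t. \<lbrakk>0 \<le> s; s \<le> t; P \<inter> {s<..t} = {}\<rbrakk> \<Longrightarrow> L s = L t"
    using assms(1) unfolding piecewise_constant_def by blast
  define F where "F = P \<inter> {t<..t + 1}"
  have "F \<subseteq> P \<inter> {0..t + 1}" using assms(2) by (auto simp: F_def)
  then have "finite F" using P(1) finite_subset by blast
  define e where "e = Min (insert 1 ((\<lambda>p. p - t) ` F))"
  have "e > 0" using \<open>finite F\<close> by (simp add: e_def F_def)
  have e: "e \<le> 1" "\<And>p. p \<in> F \<Longrightarrow> e \<le> p - t"
    unfolding e_def using \<open>finite F\<close> by (intro Min_le; simp)+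
  have "L u = L t" if "t \<le> u" "u < t + e" for u
  proof (rule P(2)[symmetric, OF assms(2) that(1)])
    show "P \<inter> {t<..u} = {}"
    proof (rule ccontr)
      assume "P \<inter> {t<..u} \<noteq> {}"
      then obtain p where p: "p \<in> P" "t < p" "p \<le> u" by auto
      then have "p \<in> F" using that e(1) by (auto simp: F_def)
      then show False using e(2)[of p] p that by simp
    qed
  qed
  then show ?thesis using \<open>e > 0\<close> by blast
qed

lemma piecewise_constant_left:
  assumes "piecewise_constant L" "t > 0"
  shows "\<exists>r. 0 \<le> r \<and> r < t \<and> (\<forall>u. r \<le> u \<and> u < t \<longrightarrow> L u = L r)"
proof -
  obtain P where P: "\<And>T. finite (P \<inter> {0..T})"
    "\<And>s t. \<lbrakk>0 \<le> s; s \<le> t; P \<inter> {s<..t} = {}\<rbrakk> \<Longrightarrow> L s = L t"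
    using assms(1) unfolding piecewise_constant_def by blast
  define F where "F = insert 0 (P \<inter> {0..<t})"
  have "P \<inter> {0..<t} \<subseteq> P \<inter> {0..t}" by auto
  then have "finite F" using finite_subset[OF _ P(1)] by (simp add: F_def)
  define r where "r = Max F"
  have "r \<in> F" unfolding r_def using \<open>finite F\<close> by (intro Max_in) (auto simp: F_def)
  then have r: "0 \<le> r" "r < t" using assms(2) by (auto simp: F_def)
  have "L u = L r" if "r \<le> u" "u < t" for u
  proof (rule P(2)[symmetric, OF r(1) that(1)])
    show "P \<inter> {r<..u} = {}"
    proof (rule ccontr)
      assume "P \<inter> {r<..u} \<noteq> {}"
      then obtain p where p: "p \<in> P" "r < p" "p \<le> u" by auto
      then have "p \<in> F" using that r(1) by (auto simp: F_def)
      then have "p \<le> r" unfolding r_def using \<open>finite F\<close> by (intro Max_ge)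
      then show False using p(2) by simp
    qed
  qed
  then show ?thesis using r by blast
qed

text \<open>Laws are constant on a short stretch to the right of every point, so discontinuity is
  decided on the left. At 0 there is no left side within \<open>{0..}\<close>, so 0 is never a
  switching point.\<close>

lemma switching_points_iff:
  fixes L :: "real \<Rightarrow> 'a::t2_space"
  assumes pc: "piecewise_constant L"
  shows "t \<in> switching_points L \<longleftrightarrow> t > 0 \<and> \<not> (\<exists>r. 0 \<le> r \<and> r < t \<and> (\<forall>u\<in>{r..t}. L u = L t))"
proof (cases "t \<ge> 0")
  case True
  obtain e where e: "e > 0" "\<And>u. \<lbrakk>t \<le> u; u < t + e\<rbrakk> \<Longrightarrow> L u = L t"
    using piecewise_constant_right[OF pc True] by blast
  have cont: "continuous (at t within {0..}) L" if r: "r < t \<or> t = 0" "\<And>u. \<lbrakk>0 \<le> u; r \<le> u; u \<le> t\<rbrakk> \<Longrightarrow> L u = L t" for r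
  proof -
    have "\<forall>\<^sub>F u in at t within {0..}. L u = L t"
      unfolding eventually_at
    proof (intro exI[of _ "if t = 0 then e else min e (t - r)"] conjI ballI impI)
      fix u assume "u \<in> {0..}" "u \<noteq> t \<and> dist u t < (if t = 0 then e else min e (t - r))"
      then show "L u = L t"
        using e(2)[of u] r(1) r(2)[of u] by (cases "u \<le> t") (auto simp: dist_real_def split: if_splits)
    qed (use e(1) r(1) in auto)
    then have "(L \<longlongrightarrow> L t) (at t within {0..})" by (rule tendsto_eventually)
    then show ?thesis by (simp add: continuous_within)
  qed
  show ?thesis
  proof (cases "t = 0")
    case True
    then show ?thesis using cont[of 0] by (auto simp: switching_points_def)
  next
    case False
    then have "t > 0" using \<open>t \<ge> 0\<close> by simp
    have "\<exists>r. 0 \<le> r \<and> r < t \<and> (\<forall>u\<in>{r..t}. L u = L t)" if "continuous (at t within {0..}) L"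
    proof -
      obtain r where r: "0 \<le> r" "r < t" "\<And>u. \<lbrakk>r \<le> u; u < t\<rbrakk> \<Longrightarrow> L u = L r"
        using piecewise_constant_left[OF pc \<open>t > 0\<close>] by blast
      have "(L \<longlongrightarrow> L t) (at t within {r<..<t})"
        using that unfolding continuous_within by (rule tendsto_within_subset) (use r(1) in auto)
      moreover have "(L \<longlongrightarrow> L r) (at t within {r<..<t})"
      proof (rule tendsto_eventually)
        show "\<forall>\<^sub>F u in at t within {r<..<t}. L u = L r"
          unfolding eventually_at
        proof (intro exI[of _ 1] conjI ballI impI)
          show "L u = L r" if "u \<in> {r<..<t}" for u using r(3)[of u] that by simp
        qed simp
      qed
      moreover have "at t within {r<..<t} \<noteq> bot"
        using islimpt_greaterThanLessThan2[OF r(2)] by (simp add: trivial_limit_within)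
      ultimately have "L t = L r" by (rule tendsto_unique[rotated 1])
      then have "L u = L t" if "u \<in> {r..t}" for u using r(3)[of u] that by (cases "u = t") auto
      then show ?thesis using r(1,2) by blast
    qed
    moreover have "continuous (at t within {0..}) L" if "\<exists>r. 0 \<le> r \<and> r < t \<and> (\<forall>u\<in>{r..t}. L u = L t)"
    proof -
      from that obtain r where r: "0 \<le> r" "r < t" "\<forall>u\<in>{r..t}. L u = L t" by blast
      show ?thesis
      proof (rule cont[of r])
        show "L u = L t" if "0 \<le> u" "r \<le> u" "u \<le> t" for u
          using bspec[OF r(3), of u] that by simp
      qed (use r(2) in simp)
    qed
    ultimately show ?thesis
      using \<open>t > 0\<close> \<open>t \<ge> 0\<close> unfolding switching_points_def by blast
  qed
qed (auto simp: switching_points_def)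

lemma finite_switching_points:
  fixes L :: "real \<Rightarrow> 'a::t2_space"
  assumes pc: "piecewise_constant L"
  shows "finite (switching_points L \<inter> {0..T})"
proof -
  obtain P where P: "\<And>T. finite (P \<inter> {0..T})"
    "\<And>s t. \<lbrakk>0 \<le> s; s \<le> t; P \<inter> {s<..t} = {}\<rbrakk> \<Longrightarrow> L s = L t"
    using pc unfolding piecewise_constant_def by blast
  have "t \<in> P" if t: "t \<in> switching_points L" for t
  proof (rule ccontr)
    assume "t \<notin> P"
    have "t > 0" using t switching_points_iff[OF pc] by blast
    define F where "F = insert 0 (P \<inter> {0..t})"
    have F: "finite F" "F \<noteq> {}" using P(1) by (auto simp: F_def)
    define r where "r = Max F"
    have "r \<in> F" unfolding r_def by (rule Max_in[OF F])
    then have r: "0 \<le> r" "r < t" using \<open>t > 0\<close> \<open>t \<notin> P\<close> by (auto simp: F_def less_le)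
    have "L u = L t" if "u \<in> {r..t}" for u
    proof (rule P(2))
      show "P \<inter> {u<..t} = {}"
      proof (rule ccontr)
        assume "P \<inter> {u<..t} \<noteq> {}"
        then obtain p where p: "p \<in> P" "u < p" "p \<le> t" by auto
        then have "p \<in> F" using that r(1) by (auto simp: F_def)
        then have "p \<le> r" unfolding r_def using F(1) by (intro Max_ge)
        then show False using p(2) that by simp
      qed
    qed (use that r in auto)
    then show False using t r switching_points_iff[OF pc] by blast
  qed
  then have "switching_points L \<inter> {0..T} \<subseteq> P \<inter> {0..T}" by auto
  then show ?thesis using P(1) by (rule finite_subset)
qed

text \<open>The set \<open>P\<close> may contain breakpoints at which nothing changes. The induction
  on their number removes the last one, crossing it by means of the constant stretch to its
  left.\<close>

lemma constant_between_switching_points: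
  fixes L :: "real \<Rightarrow> 'a::t2_space"
  assumes pc: "piecewise_constant L"
  shows "\<lbrakk>0 \<le> s; s \<le> t; switching_points L \<inter> {s<..t} = {}\<rbrakk> \<Longrightarrow> L s = L t"
proof -
  obtain P where P: "\<And>T. finite (P \<inter> {0..T})"
    "\<And>s t. \<lbrakk>0 \<le> s; s \<le> t; P \<inter> {s<..t} = {}\<rbrakk> \<Longrightarrow> L s = L t"
    using pc unfolding piecewise_constant_def by blast
  show "\<lbrakk>0 \<le> s; s \<le> t; switching_points L \<inter> {s<..t} = {}\<rbrakk> \<Longrightarrow> L s = L t"
  proof (induction "card (P \<inter> {s<..t})" arbitrary: t rule: less_induct)
    case less
    have "P \<inter> {s<..t} \<subseteq> P \<inter> {0..t}" using less.prems(1) by auto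
    then have fin: "finite (P \<inter> {s<..t})" using P(1) finite_subset by blast
    show ?case
    proof (cases "P \<inter> {s<..t} = {}")
      case True
      then show ?thesis using P(2) less.prems by blast
    next
      case False
      define p where "p = Max (P \<inter> {s<..t})"
      have p: "p \<in> P" "s < p" "p \<le> t" using Max_in[OF fin False] by (auto simp: p_def)
      have "L p = L t"
      proof (rule P(2))
        show "P \<inter> {p<..t} = {}"
        proof (rule ccontr)
          assume "P \<inter> {p<..t} \<noteq> {}"
          then obtain q where q: "q \<in> P" "p < q" "q \<le> t" by auto
          then have "q \<le> p" unfolding p_def using fin p(2) by (intro Max_ge) (auto simp: p_def)
          then show False using q(2) by simp
        qed
      qed (use p less.prems in auto)
      have "p \<notin> switching_points L" using less.prems(3) p by auto
      then have "\<exists>r. 0 \<le> r \<and> r < p \<and> (\<forall>u\<in>{r..p}. L u = L p)"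
        using p less.prems(1) unfolding switching_points_iff[OF pc] by (meson le_less_trans)
      then obtain r where r: "0 \<le> r" "r < p" "\<And>u. u \<in> {r..p} \<Longrightarrow> L u = L p" by blast
      define r' where "r' = max r s"
      have r': "r \<le> r'" "s \<le> r'" "r' < p" using r p by (auto simp: r'_def)
      have "L s = L r'"
      proof (rule less.hyps)
        have "P \<inter> {s<..r'} \<subseteq> P \<inter> {s<..t}" "p \<in> P \<inter> {s<..t}" "p \<notin> P \<inter> {s<..r'}"
          using p r' by auto
        then have "P \<inter> {s<..r'} \<subset> P \<inter> {s<..t}" by blast
        then show "card (P \<inter> {s<..r'}) < card (P \<inter> {s<..t})" by (rule psubset_card_mono[OF fin])
        show "switching_points L \<inter> {s<..r'} = {}" using less.prems(3) p r' by auto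
      qed (use less.prems r' in auto)
      then show ?thesis using r(3)[of r'] r' \<open>L p = L t\<close> by simp
    qed
  qed
qed

lemma solution_on_interval:
  assumes sol: "solution L x0 x" and "0 \<le> r" "r \<le> t"
    and nosw: "switching_points L \<inter> {r<..<t} = {}" and L: "\<And>u. \<lbrakk>r < u; u < t\<rbrakk> \<Longrightarrow> L u = B"
  shows "x t = mat_exp ((t - r) *\<^sub>R B) *v x r"
proof (rule mat_exp_ode_unique[OF \<open>r \<le> t\<close>])
  show "continuous_on {r..t} x"
    using sol \<open>0 \<le> r\<close> unfolding solution_def by (auto intro: continuous_on_subset)
  fix u assume u: "r < u" "u < t"
  then have "u \<notin> switching_points L" "0 < u" using nosw \<open>0 \<le> r\<close> by auto
  then have "(x has_vector_derivative L u *v x u) (at u within {0..})"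
    using sol unfolding solution_def by auto
  moreover have "at u within {0..} = at u"
    using \<open>0 < u\<close> by (intro at_within_interior) simp
  ultimately show "(x has_vector_derivative B *v x u) (at u)" using L[OF u] by simp
qed

text \<open>Only intervals between two switching points are known to have length at least
  \<open>m\<close>, so \<open>step\<close> serves those; the first and the last piece are handled by
  \<open>decay\<close>. At a switching point the norm is indexed by the regime that has just
  ended.\<close>

lemma admissible_solution_tendsto:
  fixes x :: "real \<Rightarrow> real^'n" and N :: "(real^'n^'n) option \<Rightarrow> real^'n \<Rightarrow> real"
  assumes adm: "admissible \<A> m (\<lambda>A. \<infinity>) L" and sol: "solution L x0 x"
    and "C \<ge> 1" "C0 \<ge> 1" "c > 0"
    and N: "\<And>k x. norm x \<le> N k x" "\<And>k x. N k x \<le> C * norm x"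
    and decay: "\<And>B t x. \<lbrakk>B \<in> \<A>; t \<ge> 0\<rbrakk> \<Longrightarrow> norm (mat_exp (t *\<^sub>R B) *v x) \<le> C0 * exp (- c * t) * norm x"
    and step: "\<And>B k l x. \<lbrakk>B \<in> \<A>; k \<noteq> Some B; m B \<le> l\<rbrakk> \<Longrightarrow>
      N (Some B) (mat_exp (l *\<^sub>R B) *v x) \<le> exp (- c * l) * N k x"
  shows "(x \<longlongrightarrow> 0) at_top"
proof -
  let ?S = "switching_points L"
  have pc: "piecewise_constant L" and LA: "\<And>t. t \<ge> 0 \<Longrightarrow> L t \<in> \<A>"
    and len: "\<And>A s t. \<lbrakk>A \<in> \<A>; switching_interval L A s t\<rbrakk> \<Longrightarrow> m A \<le> t - s"
    using adm by (auto simp: admissible_def)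
  have x0: "x 0 = x0" using sol by (simp add: solution_def)
  define D where "D = C * C0 * norm x0"
  have norm_x0: "norm x0 \<le> D"
  proof -
    have "1 * 1 \<le> C * C0" using \<open>C \<ge> 1\<close> \<open>C0 \<ge> 1\<close> by (intro mult_mono) auto
    then show ?thesis unfolding D_def by (simp add: mult_le_cancel_right1)
  qed
  have S_pos: "t > 0" if "t \<in> ?S" for t using that switching_points_iff[OF pc] by blast
  have last: "\<exists>r. 0 \<le> r \<and> r < t \<and> (r = 0 \<or> r \<in> ?S) \<and> ?S \<inter> {r<..<t} = {}" if "t > 0" for t
  proof -
    define F where "F = insert 0 (?S \<inter> {0..<t})"
    have "?S \<inter> {0..<t} \<subseteq> ?S \<inter> {0..t}" by auto
    then have F: "finite F" using finite_subset[OF _ finite_switching_points[OF pc]] by (simp add: F_def)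
    have M: "Max F \<in> F" using F by (intro Max_in) (auto simp: F_def)
    have "?S \<inter> {Max F<..<t} = {}"
    proof (rule ccontr)
      assume "?S \<inter> {Max F<..<t} \<noteq> {}"
      then obtain p where p: "p \<in> ?S" "Max F < p" "p < t" by auto
      then have "p \<in> F" using S_pos[OF p(1)] by (auto simp: F_def)
      then have "p \<le> Max F" using F by (intro Max_ge)
      then show False using p(2) by simp
    qed
    then show ?thesis using M that by (intro exI[of _ "Max F"]) (auto simp: F_def)
  qed
  have const: "L u = L r" if "0 \<le> r" "r \<le> u" "u < t" "?S \<inter> {r<..<t} = {}" for r u t
  proof -
    have "?S \<inter> {r<..u} = {}" using that by auto
    then show ?thesis using constant_between_switching_points[OF pc that(1,2)] by simp
  qed
  have at_switch: "N (Some A) (x t) \<le> D * exp (- c * t)"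
    if "t \<in> ?S" "0 \<le> r" "r < t" "\<And>u. \<lbrakk>r \<le> u; u < t\<rbrakk> \<Longrightarrow> L u = A" for t r A
    using that
  proof (induction "card (?S \<inter> {0..t})" arbitrary: t r A rule: less_induct)
    case less
    obtain q where q: "0 \<le> q" "q < t" "q = 0 \<or> q \<in> ?S" "?S \<inter> {q<..<t} = {}"
      using last S_pos[OF less.prems(1)] by blast
    define w where "w = max q r"
    have "L w = A" using less.prems(3) q(2) by (intro less.prems(4)) (auto simp: w_def)
    moreover have "L w = L q" using q less.prems(3) by (intro const[of q w t]) (auto simp: w_def)
    ultimately have A: "L q = A" by simp
    then have "A \<in> \<A>" using LA[OF q(1)] by simp
    have Lq: "L u = A" if "q < u" "u < t" for u using const[of q u t] that q A by simp
    have xt: "x t = mat_exp ((t - q) *\<^sub>R A) *v x q"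
      by (rule solution_on_interval[OF sol q(1) _ q(4) Lq]) (use q in auto)
    show ?case
    proof (cases "q = 0")
      case True
      have "N (Some A) (x t) \<le> C * norm (x t)" by (rule N)
      also have "\<dots> \<le> C * (C0 * exp (- c * t) * norm x0)"
        using decay[OF \<open>A \<in> \<A>\<close>, of t x0] xt True x0 q \<open>C \<ge> 1\<close> by (intro mult_left_mono) auto
      finally show ?thesis by (simp add: D_def mult_ac)
    next
      case False
      then have qS: "q \<in> ?S" "q > 0" using q by auto
      obtain r' where r': "0 \<le> r'" "r' < q" "\<And>u. \<lbrakk>r' \<le> u; u < q\<rbrakk> \<Longrightarrow> L u = L r'"
        using piecewise_constant_left[OF pc qS(2)] by blast
      \<comment> \<open>Equality would make \<open>q\<close> a point of continuity. The change of
        regime at \<open>q\<close> is what permits \<open>step\<close>, whose index must differ from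
        the regime applied.\<close>
      have "L r' \<noteq> A"
      proof
        assume "L r' = A"
        then have "L u = L q" if "u \<in> {r'..q}" for u using r'(3)[of u] A that by (cases "u = q") auto
        then show False using qS(1) r'(1,2) unfolding switching_points_iff[OF pc] by blast
      qed
      have "switching_interval L A q t"
        unfolding switching_interval_def
        using q qS less.prems(1) Lq by auto
      then have "m A \<le> t - q" by (rule len[OF \<open>A \<in> \<A>\<close>])
      then have "N (Some A) (x t) \<le> exp (- c * (t - q)) * N (Some (L r')) (x q)"
        unfolding xt using \<open>L r' \<noteq> A\<close> by (intro step \<open>A \<in> \<A>\<close>) auto
      also have "\<dots> \<le> exp (- c * (t - q)) * (D * exp (- c * q))"
      proof (rule mult_left_mono)
        have "?S \<inter> {0..q} \<subseteq> ?S \<inter> {0..t}" "t \<in> ?S \<inter> {0..t}" "t \<notin> ?S \<inter> {0..q}"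
          using q less.prems(1) by auto
        then have "?S \<inter> {0..q} \<subset> ?S \<inter> {0..t}" by blast
        then have "card (?S \<inter> {0..q}) < card (?S \<inter> {0..t})"
          by (rule psubset_card_mono[OF finite_switching_points[OF pc]])
        then show "N (Some (L r')) (x q) \<le> D * exp (- c * q)"
          using qS(1) r' by (rule less.hyps)
      qed simp
      also have "\<dots> = D * exp (- c * t)"
      proof -
        have "exp (- c * t) = exp (- c * (t - q)) * exp (- c * q)"
          by (subst exp_add[symmetric]) (simp add: algebra_simps)
        then show ?thesis by simp
      qed
      finally show ?thesis .
    qed
  qed
  have bound: "norm (x t) \<le> C0 * D * exp (- c * t)" if "t > 0" for t
  proof -
    obtain q where q: "0 \<le> q" "q < t" "q = 0 \<or> q \<in> ?S" "?S \<inter> {q<..<t} = {}"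
      using last \<open>t > 0\<close> by blast
    have xt: "x t = mat_exp ((t - q) *\<^sub>R L q) *v x q"
    proof (rule solution_on_interval[OF sol q(1) _ q(4)])
      show "L u = L q" if "q < u" "u < t" for u using const[of q u t] that q by simp
    qed (use q in auto)
    have xq: "norm (x q) \<le> D * exp (- c * q)"
    proof (cases "q = 0")
      case True
      then show ?thesis using norm_x0 x0 by simp
    next
      case False
      then have qS: "q \<in> ?S" "q > 0" using q by auto
      obtain r where r: "0 \<le> r" "r < q" "\<And>u. \<lbrakk>r \<le> u; u < q\<rbrakk> \<Longrightarrow> L u = L r"
        using piecewise_constant_left[OF pc qS(2)] by blast
      show ?thesis using order_trans[OF N(1) at_switch[OF qS(1) r]] .
    qed
    have "norm (x t) \<le> C0 * exp (- c * (t - q)) * norm (x q)"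
      unfolding xt using q LA by (intro decay) auto
    also have "\<dots> \<le> C0 * exp (- c * (t - q)) * (D * exp (- c * q))"
      using xq \<open>C0 \<ge> 1\<close> by (intro mult_left_mono) auto
    also have "\<dots> = C0 * D * exp (- c * t)"
    proof -
      have "exp (- c * t) = exp (- c * (t - q)) * exp (- c * q)"
        by (subst exp_add[symmetric]) (simp add: algebra_simps)
      then show ?thesis by simp
    qed
    finally show ?thesis .
  qed
  have "((\<lambda>t. C0 * D * exp (- c * t)) \<longlongrightarrow> 0) at_top"
  proof (rule tendsto_mult_right_zero)
    have "filterlim (\<lambda>t. - c * t) at_bot at_top"
      using \<open>c > 0\<close> by (intro filterlim_tendsto_neg_mult_at_bot[OF tendsto_const] filterlim_ident) auto
    then show "((\<lambda>t. exp (- c * t)) \<longlongrightarrow> 0) at_top"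
      by (rule filterlim_compose[OF exp_at_bot])
  qed
  moreover have "\<forall>\<^sub>F t in at_top. norm (x t) \<le> C0 * D * exp (- c * t)"
    using eventually_gt_at_top[of 0] by eventually_elim (rule bound)
  ultimately show ?thesis by (rule Lim_null_comparison[rotated])
qed

text \<open>Turns an infinite word into a law. Infinite total length makes the law cover
  \<open>{0..}\<close>, and distinct neighbours make every junction a genuine switching point, so
  that switching intervals have the prescribed lengths.\<close>

locale interval_sequence =
  fixes B :: "nat \<Rightarrow> real^'n^'n" and s :: "nat \<Rightarrow> real" and x0 :: "real^'n"
  assumes s_pos: "s i > 0" and B_neq: "B i \<noteq> B (Suc i)" and unbounded: "\<exists>n. c \<le> (\<Sum>i<n. s i)"
begin

definition \<tau> :: "nat \<Rightarrow> real" where "\<tau> n = (\<Sum>i<n. s i)"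

definition idx :: "real \<Rightarrow> nat" where "idx t = (LEAST n. t < \<tau> (Suc n))"

definition law :: "real \<Rightarrow> real^'n^'n" where "law t = B (idx t)"

definition state :: "nat \<Rightarrow> real^'n" where
  "state n = fold (\<lambda>i x. mat_exp (s i *\<^sub>R B i) *v x) [0..<n] x0"

definition traj :: "real \<Rightarrow> real^'n" where
  "traj t = mat_exp ((t - \<tau> (idx t)) *\<^sub>R B (idx t)) *v state (idx t)"

lemma \<tau>_0 [simp]: "\<tau> 0 = 0" by (simp add: \<tau>_def)

lemma \<tau>_Suc: "\<tau> (Suc n) = \<tau> n + s n" by (simp add: \<tau>_def)

lemma strict_mono_\<tau>: "strict_mono \<tau>"
  by (rule strict_monoI_Suc) (simp add: \<tau>_Suc s_pos)

lemma \<tau>_less_iff [simp]: "\<tau> i < \<tau> j \<longleftrightarrow> i < j" and \<tau>_le_iff [simp]: "\<tau> i \<le> \<tau> j \<longleftrightarrow> i \<le> j"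
  using strict_mono_\<tau> by (simp_all add: strict_mono_less strict_mono_less_eq)

lemma \<tau>_nonneg [simp]: "0 \<le> \<tau> n"
  using \<tau>_le_iff[of 0 n] by simp

lemma idx_eq: "\<lbrakk>\<tau> n \<le> t; t < \<tau> (Suc n)\<rbrakk> \<Longrightarrow> idx t = n"
  unfolding idx_def
proof (rule Least_equality)
  fix k assume "\<tau> n \<le> t" "t < \<tau> (Suc k)"
  then have "\<tau> n < \<tau> (Suc k)" by (rule le_less_trans)
  then show "n \<le> k" unfolding \<tau>_less_iff by simp
qed

lemma idx_bounds:
  assumes "t \<ge> 0"
  shows "\<tau> (idx t) \<le> t" "t < \<tau> (Suc (idx t))"
proof -
  obtain n where "t + 1 \<le> \<tau> n" using unbounded unfolding \<tau>_def by blast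
  then have "t < \<tau> (Suc n)" using \<tau>_le_iff[of n "Suc n"] by linarith
  then show "t < \<tau> (Suc (idx t))" unfolding idx_def by (rule LeastI)
  show "\<tau> (idx t) \<le> t"
  proof (cases "idx t")
    case 0
    then show ?thesis using assms by simp
  next
    case (Suc k)
    then have "\<not> t < \<tau> (Suc k)" using not_less_Least[of k "\<lambda>n. t < \<tau> (Suc n)"] by (simp add: idx_def)
    then show ?thesis using Suc by simp
  qed
qed

lemma idx_\<tau> [simp]: "idx (\<tau> n) = n"
  by (rule idx_eq) simp_all

lemma law_eq: "\<lbrakk>\<tau> n \<le> t; t < \<tau> (Suc n)\<rbrakk> \<Longrightarrow> law t = B n"
  by (simp add: law_def idx_eq)

lemma piecewise_constant_law: "piecewise_constant law"
  unfolding piecewise_constant_def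
proof (intro exI[of _ "range \<tau>"] conjI allI impI)
  fix T :: real
  have "range \<tau> \<inter> {0..T} \<subseteq> \<tau> ` {..idx T}"
  proof
    fix p assume "p \<in> range \<tau> \<inter> {0..T}"
    then obtain n where n: "p = \<tau> n" "\<tau> n \<le> T" "0 \<le> T" by auto
    have "\<tau> n < \<tau> (Suc (idx T))" by (rule le_less_trans[OF n(2) idx_bounds(2)[OF n(3)]])
    then show "p \<in> \<tau> ` {..idx T}" using n unfolding \<tau>_less_iff by simp
  qed
  then show "finite (range \<tau> \<inter> {0..T})" by (rule finite_subset) simp
next
  fix a b assume ab: "0 \<le> a \<and> a \<le> b \<and> range \<tau> \<inter> {a<..b} = {}"
  then have "\<tau> (idx a) \<le> b" using idx_bounds(1)[of a] by simp
  moreover have "b < \<tau> (Suc (idx a))"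
  proof (rule ccontr)
    assume "\<not> b < \<tau> (Suc (idx a))"
    moreover have "a < \<tau> (Suc (idx a))" using idx_bounds(2)[of a] ab by blast
    ultimately have "\<tau> (Suc (idx a)) \<in> {a<..b}" by simp
    then show False using ab by blast
  qed
  ultimately have "idx b = idx a" by (rule idx_eq)
  then show "law a = law b" by (simp add: law_def)
qed

text \<open>Index 0 is left out because \<open>\<tau> 0\<close> is time 0; the first piece is
  therefore not a switching interval of the law.\<close>

lemma switching_points_law: "switching_points law = \<tau> ` {1..}"
proof (rule set_eqI)
  fix t
  show "t \<in> switching_points law \<longleftrightarrow> t \<in> \<tau> ` {1..}"
  proof
    assume "t \<in> switching_points law"
    then have t: "t > 0" "\<not> (\<exists>r. 0 \<le> r \<and> r < t \<and> (\<forall>u\<in>{r..t}. law u = law t))"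
      unfolding switching_points_iff[OF piecewise_constant_law] by auto
    define n where "n = idx t"
    have n: "\<tau> n \<le> t" "t < \<tau> (Suc n)" using idx_bounds[of t] t(1) by (simp_all add: n_def)
    have "\<tau> n = t"
    proof (rule ccontr)
      assume "\<tau> n \<noteq> t"
      then have "\<tau> n < t" using n by simp
      moreover have "law u = law t" if "u \<in> {\<tau> n..t}" for u
        using law_eq[of n u] law_eq[of n t] that n by simp
      ultimately show False using t(2) \<tau>_nonneg by blast
    qed
    then show "t \<in> \<tau> ` {1..}" using t(1) by (cases n) auto
  next
    assume "t \<in> \<tau> ` {1..}"
    then obtain n where n: "t = \<tau> (Suc n)" by (metis atLeast_iff imageE not0_implies_Suc not_one_le_zero)
    have "\<not> (\<exists>r. 0 \<le> r \<and> r < t \<and> (\<forall>u\<in>{r..t}. law u = law t))"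
    proof safe
      fix r assume r: "0 \<le> r" "r < t" "\<forall>u\<in>{r..t}. law u = law t"
      define u where "u = max r (\<tau> n)"
      have u: "u \<in> {r..t}" "\<tau> n \<le> u" "u < \<tau> (Suc n)" using r n by (auto simp: u_def)
      have "law t = B (Suc n)" using law_eq[of "Suc n" t] n by simp
      then show False using r(3) u law_eq[of n u] B_neq[of n] by auto
    qed
    moreover have "t > 0" using \<tau>_less_iff[of 0 "Suc n"] n by simp
    ultimately show "t \<in> switching_points law"
      unfolding switching_points_iff[OF piecewise_constant_law] by blast
  qed
qed

lemma switching_interval_law:
  assumes "switching_interval law A a b"
  obtains n where "A = B n" "b - a = s n"
proof -
  have ab: "a < b" "a \<in> \<tau> ` {1..}" "b \<in> \<tau> ` {1..}" "{a<..<b} \<inter> \<tau> ` {1..} = {}" "\<forall>u\<in>{a<..<b}. law u = A"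
    using assms unfolding switching_interval_def switching_points_law by auto
  obtain i where i: "a = \<tau> i" "i \<ge> 1" using ab(2) by auto
  obtain j where j: "b = \<tau> j" using ab(3) by auto
  have "i < j" using ab(1) i j by simp
  have "j = Suc i"
  proof (rule ccontr)
    assume "j \<noteq> Suc i"
    then have "\<tau> (Suc i) \<in> {a<..<b} \<inter> \<tau> ` {1..}" using i j \<open>i < j\<close> by auto
    then show False using ab(4) by blast
  qed
  define u where "u = (a + b) / 2"
  have u: "u \<in> {a<..<b}" using ab(1) by (auto simp: u_def)
  then have "law u = B i" using i j \<open>j = Suc i\<close> by (intro law_eq) auto
  then have "A = B i" using ab(5) u by auto
  moreover have "b - a = s i" using i j \<open>j = Suc i\<close> by (simp add: \<tau>_Suc)
  ultimately show ?thesis using that by blast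
qed

lemma state_Suc: "state (Suc n) = mat_exp (s n *\<^sub>R B n) *v state n"
  by (simp add: state_def)

text \<open>Valid at both endpoints: at \<open>\<tau> (Suc n)\<close> the next piece starts from
  \<open>state (Suc n)\<close>, which is where this one ends. This glues the pieces
  continuously.\<close>

lemma traj_eq: "\<lbrakk>\<tau> n \<le> t; t \<le> \<tau> (Suc n)\<rbrakk> \<Longrightarrow> traj t = mat_exp ((t - \<tau> n) *\<^sub>R B n) *v state n"
proof (cases "t = \<tau> (Suc n)")
  case True
  then show ?thesis by (simp add: traj_def state_Suc) (simp add: \<tau>_Suc)
next
  case False
  assume "\<tau> n \<le> t" "t \<le> \<tau> (Suc n)"
  then show ?thesis using idx_eq[of n t] False by (simp add: traj_def)
qed

lemma piece_has_vector_derivative: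
  "((\<lambda>t. mat_exp ((t - \<tau> n) *\<^sub>R B n) *v state n) has_vector_derivative
    B n *v (mat_exp ((t - \<tau> n) *\<^sub>R B n) *v state n)) (at t within S)"
proof -
  have "((\<lambda>t. t - \<tau> n) has_vector_derivative 1) (at t within S)"
    by (auto intro!: derivative_eq_intros)
  from vector_diff_chain_within[OF this mat_exp_apply_has_vector_derivative[of "B n" "state n"]]
  show ?thesis by (simp add: o_def)
qed

lemma continuous_on_traj: "continuous_on {0..} traj"
proof -
  have piece: "continuous_on {\<tau> n..\<tau> (Suc n)} traj" for n
  proof -
    have "continuous_on {\<tau> n..\<tau> (Suc n)} (\<lambda>t. mat_exp ((t - \<tau> n) *\<^sub>R B n) *v state n)"
      by (rule continuous_on_vector_derivative, rule piece_has_vector_derivative)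
    then show ?thesis by (subst continuous_on_cong[OF refl traj_eq]) auto
  qed
  have upto: "continuous_on {0..\<tau> n} traj" for n
  proof (induction n)
    case (Suc n)
    have "{0..\<tau> (Suc n)} = {0..\<tau> n} \<union> {\<tau> n..\<tau> (Suc n)}"
      using \<tau>_le_iff[of n "Suc n"] by (intro ivl_disj_un_two_touch(4)[symmetric]) auto
    then show ?case using continuous_on_closed_Un[OF _ _ Suc piece[of n]] by simp
  qed simp
  show ?thesis
    unfolding continuous_on_eq_continuous_within
  proof
    fix t :: real assume "t \<in> {0..}"
    define n where "n = Suc (idx t)"
    have t: "0 \<le> t" "t < \<tau> n" using idx_bounds(2)[of t] \<open>t \<in> {0..}\<close> by (auto simp: n_def)
    have "continuous (at t within {0..\<tau> n}) traj"
      using upto[of n] t by (auto simp: continuous_on_eq_continuous_within)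
    moreover have "at t within {0..} = at t within {0..\<tau> n}"
      by (rule at_within_nhd[of _ "{..<\<tau> n}"]) (use t in auto)
    ultimately show "continuous (at t within {0..}) traj" by simp
  qed
qed

lemma solution_law: "solution law x0 traj"
  unfolding solution_def
proof (intro conjI allI impI)
  have "idx 0 = 0" using idx_\<tau>[of 0] by simp
  then show "traj 0 = x0" by (simp add: traj_def state_def)
  show "continuous_on {0..} traj" by (rule continuous_on_traj)
  fix t :: real assume t: "0 \<le> t" "t \<notin> switching_points law"
  define n where "n = idx t"
  have n: "\<tau> n \<le> t" "t < \<tau> (Suc n)" using idx_bounds[OF t(1)] by (auto simp: n_def)
  have d: "t = 0 \<or> \<tau> n < t"
  proof (rule ccontr)
    assume *: "\<not> (t = 0 \<or> \<tau> n < t)"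
    then have "t = \<tau> n" "n \<noteq> 0" using n by (auto intro: Nat.gr0I)
    then show False using t(2) unfolding switching_points_law by auto
  qed
  define e where "e = (if t = 0 then \<tau> (Suc n) else min (t - \<tau> n) (\<tau> (Suc n) - t))"
  have "((\<lambda>t. mat_exp ((t - \<tau> n) *\<^sub>R B n) *v state n) has_vector_derivative law t *v traj t) (at t within {0..})"
    using piece_has_vector_derivative[of n t "{0..}"] law_eq[OF n] traj_eq[of n t] n by simp
  then show "(traj has_vector_derivative law t *v traj t) (at t within {0..})"
  proof (rule has_vector_derivative_transform_within)
    show "0 < e" using d n \<tau>_nonneg[of n] by (auto simp: e_def)
    fix u assume u: "u \<in> {0..}" "dist u t < e"
    have "\<tau> n \<le> u \<and> u \<le> \<tau> (Suc n)"
      using u n by (auto simp: e_def dist_real_def split: if_splits)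
    then show "mat_exp ((u - \<tau> n) *\<^sub>R B n) *v state n = traj u" using traj_eq[of n u] by simp
  qed (use t in auto)
qed

lemma admissible_law:
  assumes "\<And>i. B i \<in> \<A>" "\<And>i. m (B i) \<le> s i" "\<And>i. ereal (s i) \<le> M (B i)"
  shows "admissible \<A> m M law"
  unfolding admissible_def
proof (intro conjI ballI allI impI)
  show "law ` {0..} \<subseteq> \<A>" using assms(1) by (auto simp: law_def)
  show "piecewise_constant law" by (rule piecewise_constant_law)
  fix A a b assume "switching_interval law A a b"
  then obtain n where "A = B n" "b - a = s n" by (rule switching_interval_law)
  then show "ereal (b - a) \<in> {ereal (m A)..M A}" using assms by simp
qed

lemma state_tendsto_0:
  assumes "stable \<A> m M" "admissible \<A> m M law"
  shows "state \<longlonglongrightarrow> 0"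
proof -
  have "(traj \<longlongrightarrow> 0) at_top"
    using assms solution_law unfolding stable_def by blast
  moreover have "filterlim \<tau> at_top sequentially"
    unfolding filterlim_at_top eventually_sequentially
  proof (intro allI)
    fix c
    obtain n where "c \<le> \<tau> n" using unbounded unfolding \<tau>_def by blast
    then have "\<forall>k\<ge>n. c \<le> \<tau> k" by (meson \<tau>_le_iff order_trans)
    then show "\<exists>n. \<forall>k\<ge>n. c \<le> \<tau> k" by blast
  qed
  ultimately have "(\<lambda>n. traj (\<tau> n)) \<longlonglongrightarrow> 0" by (rule filterlim_compose)
  then show ?thesis by (simp add: traj_def)
qed

end

lemma stable_imp_interval_products_tendsto:
  fixes B :: "nat \<Rightarrow> real^'n^'n" and x0 :: "real^'n"
  assumes "stable \<A> m M" "\<And>i. B i \<in> \<A>" "\<And>i. m (B i) \<le> s i" "\<And>i. ereal (s i) \<le> M (B i)"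
    and "\<And>i. s i > 0" "\<And>i. B i \<noteq> B (Suc i)" "\<And>c. \<exists>n. c \<le> (\<Sum>i<n. s i)"
  shows "(\<lambda>n. fold (\<lambda>i x. mat_exp (s i *\<^sub>R B i) *v x) [0..<n] x0) \<longlonglongrightarrow> 0"
proof -
  interpret interval_sequence B s x0 by unfold_locales (use assms in auto)
  show ?thesis
    using state_tendsto_0[OF assms(1) admissible_law[OF assms(2-4)]] by (simp add: state_def[abs_def])
qed

section \<open>The main theorem\<close>

text \<open>A constant law has no switching points, hence no switching intervals, and is admissible
  whatever \<open>m\<close> is; every solution of the single regime must then tend to 0.\<close>

lemma stable_imp_Hurwitz:
  assumes "stable \<A> m (\<lambda>A. \<infinity>)" "A \<in> \<A>"
  shows "Hurwitz A"
proof (rule Hurwitz_if_solutions_tendsto)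
  fix x assume x: "\<And>t. (x has_vector_derivative A *v x t) (at t)"
  have sw: "switching_points (\<lambda>_. A) = {}" by (simp add: switching_points_def)
  have "piecewise_constant (\<lambda>_. A)" unfolding piecewise_constant_def by (intro exI[of _ "{}"]) simp
  then have "admissible \<A> m (\<lambda>A. \<infinity>) (\<lambda>_. A)"
    using assms(2) by (auto simp: admissible_def switching_interval_def sw)
  moreover have "solution (\<lambda>_. A) (x 0) x"
    unfolding solution_def using has_vector_derivative_at_within[OF x]
    by (auto intro: continuous_on_vector_derivative[OF has_vector_derivative_at_within[OF x]])
  ultimately show "(x \<longlongrightarrow> 0) at_top" using assms(1) unfolding stable_def by blast
qed

lemma stable_antimono:
  assumes "stable \<A> m M" "\<And>A. A \<in> \<A> \<Longrightarrow> M' A \<le> M A"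
  shows "stable \<A> m M'"
proof -
  have "admissible \<A> m M L" if "admissible \<A> m M' L" for L
    using that assms(2) unfolding admissible_def by (fastforce intro: order_trans)
  then show ?thesis using assms(1) unfolding stable_def by blast
qed

lemma stable_if_stable_cut:
  fixes \<A> :: "(real^'n^'n) set" and m :: "real^'n^'n \<Rightarrow> real"
  assumes "compact \<A>" and m_pos: "\<And>A. A \<in> \<A> \<Longrightarrow> m A > 0"
    and H: "\<And>A. A \<in> \<A> \<Longrightarrow> Hurwitz A"
    and st: "stable \<A> m (\<lambda>A. ereal (m A + T_cut A))"
  shows "stable \<A> m (\<lambda>A. \<infinity>)"
proof -
  obtain R where R: "R \<ge> 0" "\<And>A x. A \<in> \<A> \<Longrightarrow> norm (A *v x) \<le> R * norm x"
    using bounded_matrices_apply_le[OF compact_imp_bounded[OF \<open>compact \<A>\<close>]] by blast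
  obtain C0 b0 where C0: "C0 \<ge> 1" "b0 > 0"
    and decay0: "\<And>A t x. \<lbrakk>A \<in> \<A>; t \<ge> 0\<rbrakk> \<Longrightarrow> norm (mat_exp (t *\<^sub>R A) *v x) \<le> C0 * exp (- b0 * t) * norm x"
    using compact_Hurwitz_uniform_decay[OF \<open>compact \<A>\<close> H] by blast
  have bounded0: "norm (mat_exp (t *\<^sub>R A) *v x) \<le> C0 * norm x" if "A \<in> \<A>" "t \<ge> 0" for A t x
  proof -
    have "C0 * exp (- b0 * t) * norm x \<le> C0 * 1 * norm x"
      using C0 that(2) by (intro mult_right_mono mult_left_mono) auto
    then show ?thesis using decay0[OF that, of x] by simp
  qed
  have tend: "((\<lambda>t. mat_exp (t *\<^sub>R A)) \<longlongrightarrow> 0) at_top" if "A \<in> \<A>" for A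
    by (rule Hurwitz_imp_mat_exp_tendsto[OF H[OF that]])
  have T_nonneg: "T_cut A \<ge> 0" if "A \<in> \<A>" for A
    by (rule T_cut_nonneg[OF tend[OF that]])
  define E where "E = {(B, s). B \<in> \<A> \<and> m B \<le> s \<and> s \<le> m B + T_cut B}"
  \<comment> \<open>The rate \<open>R + C0\<close> serves both cases: up to length 1 the flow grows
    by at most \<open>exp (R * s)\<close>, and longer intervals grow by at most \<open>C0\<close>,
    which is below \<open>exp (R + C0)\<close>.\<close>
  interpret convergent_words E fst "\<lambda>l. min (snd l) 1" "\<lambda>l. (*v) (mat_exp (snd l *\<^sub>R fst l))" "R + C0"
  proof
    fix l assume "l \<in> E"
    then obtain B s where l: "l = (B, s)" "B \<in> \<A>" "s > 0" using m_pos by (force simp: E_def)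
    show "min (snd l) 1 > 0" "min (snd l) 1 \<le> 1" using l by auto
    show "mat_exp (snd l *\<^sub>R fst l) *v (x + y) = mat_exp (snd l *\<^sub>R fst l) *v x + mat_exp (snd l *\<^sub>R fst l) *v y"
      and "mat_exp (snd l *\<^sub>R fst l) *v (r *\<^sub>R x) = r *\<^sub>R (mat_exp (snd l *\<^sub>R fst l) *v x)" for x y r
      by (simp_all add: matrix_vector_right_distrib
          bounded_bilinear.scaleR_right[OF bounded_bilinear_matrix_vector_mult])
    have inv: "mat_exp ((- s) *\<^sub>R B) *v (mat_exp (s *\<^sub>R B) *v x) = x" for x
      using mat_exp_minus_mult_apply[of "- s" B x] by (simp only: minus_minus)
    show "inj ((*v) (mat_exp (snd l *\<^sub>R fst l)))"
      unfolding l fst_conv snd_conv by (rule inj_on_inverseI, rule inv)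
    show "norm (mat_exp (snd l *\<^sub>R fst l) *v x) \<le> exp ((R + C0) * min (snd l) 1) * norm x" for x
    proof (cases "s \<le> 1")
      case True
      have "norm (mat_exp (s *\<^sub>R B) *v x) \<le> exp (R * s) * norm x"
        using R l by (intro norm_mat_exp_apply_le) auto
      also have "\<dots> \<le> exp ((R + C0) * s) * norm x"
        using C0 l by (intro mult_right_mono iffD2[OF exp_le_cancel_iff]) (auto simp: mult_right_mono)
      finally show ?thesis using l True by simp
    next
      case False
      have "norm (mat_exp (s *\<^sub>R B) *v x) \<le> C0 * norm x" using l by (intro bounded0) auto
      also have "\<dots> \<le> exp (R + C0) * norm x"
      proof (rule mult_right_mono)
        show "C0 \<le> exp (R + C0)" using exp_ge_add_one_self[of "R + C0"] R(1) by linarith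
      qed simp
      finally show ?thesis using l False by simp
    qed
  next
    fix l :: "nat \<Rightarrow> (real^'n^'n) \<times> real" and x :: "real^'n"
    assume l: "\<And>i. l i \<in> E" "\<And>i. fst (l i) \<noteq> fst (l (Suc i))"
      and sum: "\<And>c. \<exists>n. c \<le> (\<Sum>i<n. min (snd (l i)) 1)"
    have lE: "fst (l i) \<in> \<A>" "m (fst (l i)) \<le> snd (l i)" "snd (l i) \<le> m (fst (l i)) + T_cut (fst (l i))" for i
      using l(1)[of i] by (auto simp: E_def split: prod.splits)
    have "(\<lambda>n. fold (\<lambda>i x. mat_exp (snd (l i) *\<^sub>R fst (l i)) *v x) [0..<n] x) \<longlonglongrightarrow> 0"
    proof (rule stable_imp_interval_products_tendsto[OF st])
      show "0 < snd (l i)" for i using m_pos[OF lE(1)] lE(2)[of i] by (rule less_le_trans)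
      show "\<exists>n. c \<le> (\<Sum>i<n. snd (l i))" for c
      proof -
        obtain n where "c \<le> (\<Sum>i<n. min (snd (l i)) 1)" using sum by blast
        also have "\<dots> \<le> (\<Sum>i<n. snd (l i))" by (intro sum_mono) simp
        finally show ?thesis by blast
      qed
    qed (use l lE in auto)
    then show "(\<lambda>n. fold (\<lambda>l. (*v) (mat_exp (snd l *\<^sub>R fst l))) (map l [0..<n]) x) \<longlonglongrightarrow> 0"
      by (simp add: fold_map comp_def)
  qed (use R(1) C0(1) in auto)
  obtain C b where C: "C \<ge> 1" "b > 0"
    and words: "\<And>w x. word None w \<Longrightarrow> norm (fold (\<lambda>l. (*v) (mat_exp (snd l *\<^sub>R fst l))) w x) \<le> C * exp (- b * word_cost w) * norm x"
    using words_decay by blast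
  define N where "N = word_norm b"
  have N_ge: "norm x \<le> N k x" and N_le: "N k x \<le> C * norm x" and N_add: "N k (x + z) \<le> N k x + N k z"
    and N_scale: "N k (r *\<^sub>R x) \<le> \<bar>r\<bar> * N k x" for k x z r
    unfolding N_def
    by (rule norm_le_word_norm[OF words] word_norm_le[OF words] word_norm_add[OF words] word_norm_scaleR[OF words]; simp)+
  have N_nonneg: "N k x \<ge> 0" for k x using order_trans[OF norm_ge_zero N_ge] .
  \<comment> \<open>\<open>1 - \<beta> * \<theta>\<close> is the chord of
    \<open>exp (- b * \<theta>)\<close> over \<open>[0, 1]\<close>. The contraction is put in linear
    form because that form survives convex combinations.\<close>
  define \<beta> where "\<beta> = 1 - exp (- b)"
  have \<beta>: "0 < \<beta>" "\<beta> \<le> 1" using C(2) by (auto simp: \<beta>_def)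
  have exp_\<beta>: "exp (- b * \<theta>) \<le> 1 - \<beta> * \<theta>" if "0 \<le> \<theta>" "\<theta> \<le> 1" for \<theta>
  proof -
    have "exp ((1 - \<theta>) *\<^sub>R 0 + \<theta> *\<^sub>R (- b)) \<le> (1 - \<theta>) * exp 0 + \<theta> * exp (- b)"
      using that by (intro convex_onD[OF exp_convex]) auto
    then show ?thesis by (simp add: \<beta>_def algebra_simps)
  qed
  have letter: "N (Some B) (mat_exp (l *\<^sub>R B) *v x) \<le> (1 - \<beta> * min l 1) * N k x"
    if "B \<in> \<A>" "k \<noteq> Some B" "m B \<le> l" "l \<le> m B + T_cut B" for B k l x
  proof -
    have "(B, l) \<in> E" using that by (simp add: E_def)
    from word_norm_op[OF words this, of k x] that(2)
    have "N (Some B) (mat_exp (l *\<^sub>R B) *v x) \<le> exp (- b * min l 1) * N k x" by (auto simp: N_def)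
    also have "\<dots> \<le> (1 - \<beta> * min l 1) * N k x"
      using m_pos[OF that(1)] that(3) by (intro mult_right_mono exp_\<beta> N_nonneg) auto
    finally show ?thesis .
  qed
  \<comment> \<open>\<open>R * exp R\<close> bounds the slope of \<open>exp (R * t)\<close> on
    \<open>[0, 1]\<close>; \<open>C0 + 1\<close> bounds the displacement at later times.\<close>
  define C1 where "C1 = R * exp R + C0 + 1"
  have C1: "C1 \<ge> 0" using R(1) C0 by (simp add: C1_def)
  have drift: "norm (mat_exp (t *\<^sub>R A) *v x - x) \<le> C1 * min t 1 * norm x" if "A \<in> \<A>" "t \<ge> 0" for A t x
  proof (cases "t \<le> 1")
    case True
    have "norm (mat_exp (t *\<^sub>R A) *v x - x) \<le> (exp (R * t) - 1) * norm x"
      using R that by (intro norm_mat_exp_apply_diff_le) auto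
    also have "\<dots> \<le> C1 * t * norm x"
    proof (rule mult_right_mono)
      have "(1 - R * t) * exp (R * t) \<le> exp (- (R * t)) * exp (R * t)"
        using exp_ge_add_one_self[of "- (R * t)"] by (intro mult_right_mono) auto
      then have "exp (R * t) - 1 \<le> R * t * exp (R * t)" by (simp add: exp_minus algebra_simps)
      also have "\<dots> \<le> R * t * exp R"
        using R(1) that(2) True mult_left_mono[of t 1 R] by (intro mult_left_mono) auto
      also have "\<dots> \<le> C1 * t"
        using mult_right_mono[of "R * exp R" C1 t] C0 that(2) by (simp add: C1_def mult_ac)
      finally show "exp (R * t) - 1 \<le> C1 * t" .
    qed simp
    finally show ?thesis using True by simp
  next
    case False
    have "norm (mat_exp (t *\<^sub>R A) *v x - x) \<le> norm (mat_exp (t *\<^sub>R A) *v x) + norm x" by (rule norm_triangle_ineq4)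
    also have "\<dots> \<le> (C0 + 1) * norm x" using bounded0[OF that, of x] by (simp add: algebra_simps)
    also have "\<dots> \<le> C1 * norm x" using R(1) by (intro mult_right_mono) (auto simp: C1_def)
    finally show ?thesis using False by simp
  qed
  obtain c where c: "c > 0" "c \<le> \<beta>" and contraction: "\<And>(A :: real^'n^'n) N m u T y \<kappa>.
      \<lbrakk>\<And>x z. N (x + z) \<le> N x + N z; \<And>r x. N (r *\<^sub>R x) \<le> \<bar>r\<bar> * N x;
       \<And>x. norm x \<le> N x; \<And>x. N x \<le> C * norm x;
       \<And>t x. t \<ge> 0 \<Longrightarrow> norm (mat_exp (t *\<^sub>R A) *v x) \<le> C0 * exp (- b0 * t) * norm x;
       \<And>t x. t \<ge> 0 \<Longrightarrow> norm (mat_exp (t *\<^sub>R A) *v x - x) \<le> C1 * min t 1 * norm x;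
       mat_exp (u *\<^sub>R A) \<in> convex hull ((\<lambda>t. mat_exp (t *\<^sub>R A)) ` {0..T} \<union> uminus ` (\<lambda>t. mat_exp (t *\<^sub>R A)) ` {0..T});
       u > 0; m > 0; T \<ge> 0; \<kappa> \<ge> 0;
       \<And>s. \<lbrakk>0 \<le> s; s \<le> T\<rbrakk> \<Longrightarrow> N (mat_exp (s *\<^sub>R A) *v y) \<le> (1 - \<beta> * min (m + s) 1) * \<kappa>\<rbrakk>
      \<Longrightarrow> N (mat_exp (u *\<^sub>R A) *v y) \<le> (1 - c * min (m + u) 1) * \<kappa>"
    using uniform_contraction[OF C(1) C0(1) C1 C0(2) \<beta>, where 'n = 'n] by metis
  have step: "N (Some B) (mat_exp (l *\<^sub>R B) *v x) \<le> (1 - c * min l 1) * N k x"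
    if B: "B \<in> \<A>" and k: "k \<noteq> Some B" and l: "m B \<le> l" for B k l x
  proof (cases "l \<le> m B + T_cut B")
    case True
    have "c * min l 1 \<le> \<beta> * min l 1" using c(2) m_pos[OF B] l by (intro mult_right_mono) auto
    then have "(1 - \<beta> * min l 1) * N k x \<le> (1 - c * min l 1) * N k x"
      by (intro mult_right_mono N_nonneg) auto
    then show ?thesis using letter[OF B k l True, of x] by simp
  next
    case False
    \<comment> \<open>The first \<open>m B\<close> time units are split off:
      \<open>contraction\<close> is applied to the vector reached then, with
      \<open>\<kappa> = N k x\<close>, and its premise for \<open>s \<le> T_cut B\<close> is
      \<open>letter\<close> at length \<open>m B + s\<close>.\<close>
    define u where "u = l - m B"
    have u: "u > 0" using False T_nonneg[OF B] by (simp add: u_def)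
    have split: "mat_exp (s *\<^sub>R B) *v (mat_exp (m B *\<^sub>R B) *v x) = mat_exp ((m B + s) *\<^sub>R B) *v x" if "s \<ge> 0" for s
      using mat_exp_add_apply[OF that, of "m B" B x] by (simp add: add.commute)
    have "N (Some B) (mat_exp (u *\<^sub>R B) *v (mat_exp (m B *\<^sub>R B) *v x)) \<le> (1 - c * min (m B + u) 1) * N k x"
    proof (rule contraction)
      show "mat_exp (u *\<^sub>R B) \<in> convex hull ((\<lambda>t. mat_exp (t *\<^sub>R B)) ` {0..T_cut B} \<union> uminus ` (\<lambda>t. mat_exp (t *\<^sub>R B)) ` {0..T_cut B})"
        using u by (intro mat_exp_in_hull_cut tend B) auto
      show "N (Some B) (mat_exp (s *\<^sub>R B) *v (mat_exp (m B *\<^sub>R B) *v x)) \<le> (1 - \<beta> * min (m B + s) 1) * N k x"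
        if "0 \<le> s" "s \<le> T_cut B" for s
        unfolding split[OF that(1)] using that by (intro letter B k) auto
    qed (fact N_add N_scale N_ge N_le u m_pos[OF B] T_nonneg[OF B] N_nonneg decay0[OF B] drift[OF B])+
    then show ?thesis using u split[of u] by (simp add: u_def)
  qed
  \<comment> \<open>Passage from \<open>min l 1\<close> to \<open>l\<close>. Up to \<open>l0\<close>
    the two are comparable by the factor \<open>l0\<close>; beyond it the uniform decay of the flow,
    half of its rate spent on absorbing \<open>C * C0\<close>, contracts by itself.\<close>
  define l0 where "l0 = max 1 (2 * ln (C * C0) / b0)"
  have l0: "l0 \<ge> 1" by (simp add: l0_def)
  define c' where "c' = min (c / l0) (b0 / 2)"
  have c': "c' > 0" "c' \<le> c / l0" "c' \<le> b0 / 2"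
    unfolding c'_def by (use c(1) l0 C0(2) in simp, rule min.cobounded1, rule min.cobounded2)
  have CC0: "C * C0 \<ge> 1" using mult_mono[of 1 C 1 C0] C(1) C0(1) by simp
  have step': "N (Some B) (mat_exp (l *\<^sub>R B) *v x) \<le> exp (- c' * l) * N k x"
    if B: "B \<in> \<A>" and k: "k \<noteq> Some B" and l: "m B \<le> l" for B k l x
  proof (cases "l \<le> l0")
    case True
    have "l > 0" using m_pos[OF B] l by simp
    have "l / l0 \<le> min l 1" using True l0 \<open>l > 0\<close> by (simp add: field_simps mult_le_cancel_left1)
    then have "c * (l / l0) \<le> c * min l 1" using c(1) by (intro mult_left_mono) auto
    moreover have "c' * l \<le> c / l0 * l" using c'(2) \<open>l > 0\<close> by (intro mult_right_mono) auto
    ultimately have "1 - c * min l 1 \<le> 1 + (- c' * l)" by simp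
    also have "\<dots> \<le> exp (- c' * l)" by (rule exp_ge_add_one_self)
    finally have "(1 - c * min l 1) * N k x \<le> exp (- c' * l) * N k x" by (intro mult_right_mono N_nonneg)
    then show ?thesis using step[OF B k l, of x] by simp
  next
    case False
    have "l > 0" using False l0 by simp
    have "2 * ln (C * C0) / b0 \<le> l" using False by (simp add: l0_def)
    then have "ln (C * C0) \<le> b0 / 2 * l" using C0(2) by (simp add: field_simps)
    then have "exp (ln (C * C0)) \<le> exp (b0 / 2 * l)" by (simp only: exp_le_cancel_iff)
    then have "C * C0 \<le> exp (b0 / 2 * l)" using CC0 by simp
    then have "C * C0 * exp (- b0 * l) \<le> exp (b0 / 2 * l) * exp (- b0 * l)" by (intro mult_right_mono) auto
    also have "\<dots> = exp (- (b0 / 2) * l)" by (subst exp_add[symmetric]) simp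
    also have "\<dots> \<le> exp (- c' * l)" using c'(3) \<open>l > 0\<close> by (auto simp: mult_right_mono)
    finally have e: "C * C0 * exp (- b0 * l) \<le> exp (- c' * l)" .
    have "N (Some B) (mat_exp (l *\<^sub>R B) *v x) \<le> C * norm (mat_exp (l *\<^sub>R B) *v x)" by (rule N_le)
    also have "\<dots> \<le> C * (C0 * exp (- b0 * l) * norm x)"
      using C(1) \<open>l > 0\<close> by (intro mult_left_mono decay0 B) auto
    also have "\<dots> = (C * C0 * exp (- b0 * l)) * norm x" by (simp add: mult_ac)
    also have "\<dots> \<le> exp (- c' * l) * N k x" using e by (intro mult_mono N_ge) auto
    finally show ?thesis .
  qed
  have decay': "norm (mat_exp (t *\<^sub>R A) *v x) \<le> C0 * exp (- c' * t) * norm x" if "A \<in> \<A>" "t \<ge> 0" for A t x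
  proof -
    have "c' * t \<le> b0 * t" using c'(3) C0(2) that(2) by (intro mult_right_mono) auto
    then have "C0 * exp (- b0 * t) * norm x \<le> C0 * exp (- c' * t) * norm x"
      using C0(1) by (intro mult_right_mono mult_left_mono) auto
    then show ?thesis using decay0[OF that, of x] by simp
  qed
  show ?thesis
    unfolding stable_def
  proof (intro allI impI)
    fix L x0 x assume "admissible \<A> m (\<lambda>A. \<infinity>) L \<and> solution L x0 x"
    then show "(x \<longlongrightarrow> 0) at_top"
      using admissible_solution_tendsto[OF _ _ C(1) C0(1) c'(1) N_ge N_le decay' step'] by blast
  qed
qed

theorem theorem2:
  fixes \<A> :: "(real^'n^'n) set" and m :: "real^'n^'n \<Rightarrow> real"
  assumes "compact \<A>" and "\<And>A. A \<in> \<A> \<Longrightarrow> m A > 0"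
  shows "stable \<A> m (\<lambda>A. \<infinity>) \<longleftrightarrow>
    (\<forall>A\<in>\<A>. Hurwitz A) \<and> stable \<A> m (\<lambda>A. ereal (m A + T_cut A))"
proof
  assume st: "stable \<A> m (\<lambda>A. \<infinity>)"
  show "(\<forall>A\<in>\<A>. Hurwitz A) \<and> stable \<A> m (\<lambda>A. ereal (m A + T_cut A))"
    using stable_imp_Hurwitz[OF st] stable_antimono[OF st, of "\<lambda>A. ereal (m A + T_cut A)"] by simp
next
  assume "(\<forall>A\<in>\<A>. Hurwitz A) \<and> stable \<A> m (\<lambda>A. ereal (m A + T_cut A))"
  then show "stable \<A> m (\<lambda>A. \<infinity>)"
    by (intro stable_if_stable_cut[of \<A> m] assms) auto
qed

end
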